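(* Let $n\ge 1$, let $\mathcal H = F^2(\mathbb C^n)$ be the Fock space, and let $A \in \mathcal C_1(\mathcal H)$ be even, i.e. $UAU = A$. If $A$ is a Fredholm operator, then its Fredholm index $\operatorname{ind}(A)$ is an even integer.
   Context: Let $\mu$ be the Gaussian measure $d\mu(z) = (2\pi)^{-n} e^{-|z|^2/2}\,dz$ on $\mathbb C^n$, and let $F^2(\mathbb C^n)$ be the closed subspace of $L^2(\mathbb C^n,\mu)$ consisting of entire functions. For $z\in\mathbb C^n$ let $k_z(w) = e^{\frac{w\cdot\overline z}{2}-\frac{|z|^2}{4}}$ be the normalized reproducing kernel, and define the unitary Weyl operators $W_z$ on $F^2(\mathbb C^n)$ by $W_z f(w) = k_z(w) f(w-z)$. The parity operator is $Uf(z) = f(-z)$. $\mathcal L(\mathcal H)$ denotes the bounded linear operators on $\mathcal H$, and $$\mathcal C_1(\mathcal H) = \{A\in\mathcal L(\mathcal H): \|W_zAW_z^\ast - A\|_{op}\to 0 \text{ as } z\to 0\}.$$ The Fredholm index is $\operatorname{ind}(A) = \dim\ker A - \dim\operatorname{coker} A$. *)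

theory Defs
  imports "HOL-Analysis.Analysis"
begin

section \<open>Entire functions on \<open>\<complex>\<^sup>n\<close> and the Gaussian measure\<close>

text \<open>Complex Frechet differentiability everywhere; \<^const>\<open>has_derivative\<close> alone only gives a
  real-linear derivative.\<close>

definition entire :: "(complex^'n \<Rightarrow> complex) \<Rightarrow> bool" where
  "entire f \<longleftrightarrow> (\<forall>z. \<exists>D. (f has_derivative D) (at z) \<and> (\<forall>c v. D (c *s v) = c * D v))"

definition gauss_density :: "complex^'n \<Rightarrow> real" where
  "gauss_density z = exp (- (norm z)\<^sup>2 / 2) / (2 * pi) ^ CARD('n)"

definition gauss :: "(complex^'n) measure" where
  "gauss = density lborel (\<lambda>z. ennreal (gauss_density z))"

text \<open>\<open>cdot w z\<close> is \<open>w \<cdot> cnj z\<close>; the conjugation is built in.\<close>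

definition cdot :: "complex^'n \<Rightarrow> complex^'n \<Rightarrow> complex" where
  "cdot w z = (\<Sum>i\<in>UNIV. w $ i * cnj (z $ i))"

definition kern :: "complex^'n \<Rightarrow> complex^'n \<Rightarrow> complex" where
  "kern z w = exp (cdot w z / 2 - of_real ((norm z)\<^sup>2 / 4))"

definition fock_fun :: "(complex^'n \<Rightarrow> complex) \<Rightarrow> bool" where
  "fock_fun f \<longleftrightarrow> entire f \<and> integrable gauss (\<lambda>z. (norm (f z))\<^sup>2)"

lemma entire_const: "entire (\<lambda>z. c)"
  unfolding entire_def by (intro allI exI[of _ "\<lambda>_. 0"]) auto

lemma entire_add:
  assumes "entire f" "entire g" shows "entire (\<lambda>z. f z + g z)"
  unfolding entire_def
proof
  fix z
  obtain D E where "(f has_derivative D) (at z)" "\<forall>c v. D (c *s v) = c * D v"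
    "(g has_derivative E) (at z)" "\<forall>c v. E (c *s v) = c * E v"
    using assms unfolding entire_def by metis
  then show "\<exists>D. ((\<lambda>z. f z + g z) has_derivative D) (at z) \<and> (\<forall>c v. D (c *s v) = c * D v)"
    by (intro exI[of _ "\<lambda>h. D h + E h"]) (auto intro!: derivative_eq_intros simp: algebra_simps)
qed

lemma entire_mult:
  assumes "entire f" "entire g" shows "entire (\<lambda>z. f z * g z)"
  unfolding entire_def
proof
  fix z
  obtain D E where "(f has_derivative D) (at z)" "\<forall>c v. D (c *s v) = c * D v"
    "(g has_derivative E) (at z)" "\<forall>c v. E (c *s v) = c * E v"
    using assms unfolding entire_def by metis
  then show "\<exists>D. ((\<lambda>z. f z * g z) has_derivative D) (at z) \<and> (\<forall>c v. D (c *s v) = c * D v)"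
    by (intro exI[of _ "\<lambda>h. f z * E h + D h * g z"] conjI has_derivative_mult)
       (auto simp: algebra_simps)
qed

lemma entire_shift:
  assumes "entire f" shows "entire (\<lambda>w. f (w - z))"
  unfolding entire_def
proof
  fix w
  obtain D where D: "(f has_derivative D) (at (w - z))" "\<forall>c v. D (c *s v) = c * D v"
    using assms unfolding entire_def by metis
  have "((\<lambda>w. w - z) has_derivative (\<lambda>h. h)) (at w)"
    by (auto intro!: derivative_eq_intros)
  from has_derivative_compose[OF this D(1)] D(2)
  show "\<exists>D. ((\<lambda>w. f (w - z)) has_derivative D) (at w) \<and> (\<forall>c v. D (c *s v) = c * D v)"
    by auto
qed

lemma entire_reflect:
  assumes "entire f" shows "entire (\<lambda>w. f (- w))"
  unfolding entire_def
proof
  fix w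
  obtain D where D: "(f has_derivative D) (at (- w))" "\<forall>c v. D (c *s v) = c * D v"
    using assms unfolding entire_def by metis
  have "(uminus has_derivative (\<lambda>h. - h)) (at w)"
    by (auto intro!: derivative_eq_intros)
  from has_derivative_compose[OF this D(1)] D(2)
  show "\<exists>D. ((\<lambda>w. f (- w)) has_derivative D) (at w) \<and> (\<forall>c v. D (c *s v) = c * D v)"
    by (intro exI[of _ "\<lambda>h. D (- h)"]) (metis (no_types, lifting) vector_smult_rneg)
qed

lemma entire_kern: "entire (kern z)"
  unfolding entire_def
proof
  fix w
  let ?a = "complex_of_real ((norm z)\<^sup>2 / 4)"
  have "bounded_linear (\<lambda>w. cdot w z / 2)"
    unfolding cdot_def by (intro bounded_linear_divide[THEN bounded_linear_compose]
      bounded_linear_sum bounded_linear_mult_left[THEN bounded_linear_compose] bounded_linear_vec_nth)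
  then have "((\<lambda>w. cdot w z / 2) has_derivative (\<lambda>h. cdot h z / 2)) (at w)"
    by (rule bounded_linear_imp_has_derivative)
  from has_derivative_diff[OF this has_derivative_const[of ?a]]
  have 1: "((\<lambda>w. cdot w z / 2 - ?a) has_derivative (\<lambda>h. cdot h z / 2)) (at w)"
    by (simp only: diff_zero)
  have "(exp has_derivative (*) (exp (cdot w z / 2 - ?a))) (at (cdot w z / 2 - ?a))"
    using DERIV_exp by (simp only: has_field_derivative_def)
  from has_derivative_compose[OF 1 this]
  have "(kern z has_derivative (\<lambda>h. cdot h z / 2 * kern z w)) (at w)"
    unfolding kern_def by (simp only: mult.commute)
  moreover have "cdot (c *s h) z / 2 * kern z w = c * (cdot h z / 2 * kern z w)" for c h
    by (simp add: cdot_def sum_distrib_left mult.assoc)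
  ultimately show "\<exists>D. (kern z has_derivative D) (at w) \<and> (\<forall>c v. D (c *s v) = c * D v)"
    by blast
qed

lemma entire_continuous: "entire f \<Longrightarrow> continuous_on S f"
  unfolding entire_def by (meson has_derivative_continuous continuous_at_imp_continuous_on)

lemma entire_borel [measurable_dest]: "entire f \<Longrightarrow> f \<in> borel_measurable borel"
  by (rule borel_measurable_continuous_onI) (rule entire_continuous)

lemma cnj_borel [measurable]: "cnj \<in> borel_measurable borel"
  by (intro borel_measurable_continuous_onI continuous_intros)

lemma gauss_density_pos: "gauss_density z > 0"
  by (simp add: gauss_density_def)

lemma gauss_density_borel [measurable]: "gauss_density \<in> borel_measurable borel"
  unfolding gauss_density_def by measurable

lemma sets_gauss [simp, measurable_cong]: "sets gauss = sets borel"
  by (simp add: gauss_def)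

lemma integrable_gauss:
  fixes f :: "complex^'n \<Rightarrow> real"
  assumes [measurable]: "f \<in> borel_measurable borel"
  shows "integrable gauss f \<longleftrightarrow> integrable lborel (\<lambda>z. gauss_density z * f z)"
  unfolding gauss_def using less_imp_le[OF gauss_density_pos]
  by (subst integrable_density) auto

lemma integrable_dominated:
  fixes f :: "complex^'n \<Rightarrow> 'b::{banach, second_countable_topology}"
  assumes "integrable gauss h" "\<And>z. norm (f z) \<le> h z" "f \<in> borel_measurable borel"
  shows "integrable gauss f"
proof (rule Bochner_Integration.integrable_bound[OF assms(1)])
  show "f \<in> borel_measurable gauss"
    using assms(3) by (simp cong: measurable_cong_sets)
  show "AE z in gauss. norm (f z) \<le> norm (h z)"
    using assms(2) by (intro AE_I2) (metis abs_ge_self order_trans real_norm_def)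
qed

lemma Re_cdot: "Re (cdot w z) = w \<bullet> z"
  by (simp add: cdot_def inner_vec_def inner_complex_def)

lemma norm_kern_density: "(norm (kern z w))\<^sup>2 * gauss_density w = gauss_density (w - z)"
proof -
  have "(norm (kern z w))\<^sup>2 = exp (w \<bullet> z - (norm z)\<^sup>2 / 2)"
    by (simp add: kern_def Re_cdot flip: exp_of_nat_mult)
  moreover have "(norm (w - z))\<^sup>2 = (norm w)\<^sup>2 - 2 * (w \<bullet> z) + (norm z)\<^sup>2"
    by (simp add: power2_norm_eq_inner inner_diff_left inner_diff_right inner_commute)
  ultimately show ?thesis
    by (simp add: gauss_density_def field_simps flip: exp_add)
qed

lemma fock_fun_0: "fock_fun (\<lambda>_. 0)"
  by (simp add: fock_fun_def entire_const)

lemma fock_fun_scale: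
  assumes "fock_fun f" shows "fock_fun (\<lambda>z. c * f z)"
  using assms entire_mult[OF entire_const, of f c]
  by (simp add: fock_fun_def norm_mult power_mult_distrib)

lemma fock_fun_add:
  assumes "fock_fun f" "fock_fun g" shows "fock_fun (\<lambda>z. f z + g z)"
proof -
  have [measurable]: "f \<in> borel_measurable borel" "g \<in> borel_measurable borel"
    using assms by (auto simp: fock_fun_def entire_borel)
  have "integrable gauss (\<lambda>z. 2 * (norm (f z))\<^sup>2 + 2 * (norm (g z))\<^sup>2)"
    using assms by (auto simp: fock_fun_def)
  moreover have "(norm (f z + g z))\<^sup>2 \<le> 2 * (norm (f z))\<^sup>2 + 2 * (norm (g z))\<^sup>2" for z
  proof -
    have "(norm (f z + g z))\<^sup>2 \<le> (norm (f z) + norm (g z))\<^sup>2"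
      by (intro power_mono norm_triangle_ineq) auto
    also have "\<dots> \<le> 2 * (norm (f z))\<^sup>2 + 2 * (norm (g z))\<^sup>2"
      using sum_squares_bound[of "norm (f z)" "norm (g z)"] by (simp add: power2_sum)
    finally show ?thesis .
  qed
  ultimately have "integrable gauss (\<lambda>z. (norm (f z + g z))\<^sup>2)"
    by - (rule integrable_dominated, assumption, simp_all)
  moreover have "entire (\<lambda>z. f z + g z)"
    using assms by (intro entire_add) (simp_all add: fock_fun_def)
  ultimately show ?thesis
    by (simp add: fock_fun_def)
qed

lemma lborel_reflect: "distr lborel borel uminus = (lborel :: (complex^'n) measure)"
  using lborel_affine[of "-1" "0 :: complex^'n"] by (simp add: density_1)

lemma fock_fun_reflect:
  fixes f :: "complex^'n \<Rightarrow> complex"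
  assumes "fock_fun f" shows "fock_fun (\<lambda>z. f (- z))"
proof -
  have [measurable]: "f \<in> borel_measurable borel"
    using assms by (auto simp: fock_fun_def entire_borel)
  have "integrable lborel (\<lambda>z. gauss_density z * (norm (f z))\<^sup>2)"
    using assms by (simp add: fock_fun_def integrable_gauss)
  then have "integrable (distr lborel borel uminus) (\<lambda>z. gauss_density z * (norm (f z))\<^sup>2)"
    by (simp add: lborel_reflect)
  then have "integrable lborel (\<lambda>z. gauss_density (- z) * (norm (f (- z)))\<^sup>2)"
    by (subst (asm) integrable_distr_eq) auto
  then have "integrable gauss (\<lambda>z. (norm (f (- z)))\<^sup>2)"
    by (simp add: integrable_gauss gauss_density_def)
  moreover have "entire (\<lambda>z. f (- z))"
    using assms by (intro entire_reflect) (simp add: fock_fun_def)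
  ultimately show ?thesis
    by (simp add: fock_fun_def)
qed

lemma fock_fun_weyl:
  assumes "fock_fun f" shows "fock_fun (\<lambda>w. kern z w * f (w - z))"
proof -
  have [measurable]: "f \<in> borel_measurable borel" "kern z \<in> borel_measurable borel"
    using assms by (auto simp: fock_fun_def entire_borel entire_kern)
  have "integrable lborel (\<lambda>w. gauss_density w * (norm (f w))\<^sup>2)"
    using assms by (simp add: fock_fun_def integrable_gauss)
  then have "integrable (distr lborel borel ((+) (- z))) (\<lambda>w. gauss_density w * (norm (f w))\<^sup>2)"
    by (simp add: lborel_distr_plus)
  then have "integrable lborel (\<lambda>w. gauss_density (w - z) * (norm (f (w - z)))\<^sup>2)"
    by (subst (asm) integrable_distr_eq) auto
  then have "integrable gauss (\<lambda>w. (norm (kern z w * f (w - z)))\<^sup>2)"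
    by (simp add: integrable_gauss norm_mult power_mult_distrib mult_ac
      flip: norm_kern_density)
  moreover have "entire (\<lambda>w. kern z w * f (w - z))"
    using assms by (intro entire_mult entire_kern entire_shift) (simp add: fock_fun_def)
  ultimately show ?thesis
    by (simp add: fock_fun_def)
qed

lemma fock_fun_integrable:
  assumes "fock_fun f" "fock_fun g" shows "integrable gauss (\<lambda>z. f z * cnj (g z))"
proof -
  have [measurable]: "f \<in> borel_measurable borel" "g \<in> borel_measurable borel"
    using assms by (auto simp: fock_fun_def entire_borel)
  have "integrable gauss (\<lambda>z. (norm (f z))\<^sup>2 + (norm (g z))\<^sup>2)"
    using assms by (auto simp: fock_fun_def)
  moreover have "norm (f z) * norm (g z) \<le> (norm (f z))\<^sup>2 + (norm (g z))\<^sup>2" for z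
    using sum_squares_bound[of "norm (f z)" "norm (g z)"]
      mult_nonneg_nonneg[OF norm_ge_zero[of "f z"] norm_ge_zero[of "g z"]] by linarith
  ultimately show ?thesis
    by - (rule integrable_dominated, assumption, simp add: norm_mult, measurable)
qed


section \<open>The Fock space as a Hilbert space\<close>

text \<open>An element of \<open>F\<^sup>2(\<complex>\<^sup>n)\<close> is represented by the entire function itself; this loses nothing
  since a class in \<open>L\<^sup>2\<close> contains at most one continuous function.\<close>

typedef (overloaded) ('n::finite) fock = "{f :: complex^'n \<Rightarrow> complex. fock_fun f}"
  morphisms fun_of Fock
  using fock_fun_0 by blast

setup_lifting type_definition_fock

lemma fock_fun_fun_of: "fock_fun (fun_of f)"
  using fun_of[of f] by simp

lift_definition fock_scale :: "complex \<Rightarrow> 'n::finite fock \<Rightarrow> 'n fock" (infixr \<open>*\<^sub>C\<close> 75)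
  is "\<lambda>c f z. c * f z" by (rule fock_fun_scale)

definition fock_inner :: "'n::finite fock \<Rightarrow> 'n fock \<Rightarrow> complex" where
  "fock_inner f g = (LINT z|gauss. fun_of f z * cnj (fun_of g z))"

lemma fock_inner_self: "fock_inner f f = of_real (LINT z|gauss. (norm (fun_of f z))\<^sup>2)"
  unfolding fock_inner_def
  by (subst integral_complex_of_real[symmetric]) (simp add: complex_norm_square del: of_real_power)

lemma fock_inner_self_eq_0:
  assumes "fock_inner f f = 0" shows "fun_of f z = 0"
proof -
  have f: "entire (fun_of f)" "integrable gauss (\<lambda>z. (norm (fun_of f z))\<^sup>2)"
    using fock_fun_fun_of[of f] by (auto simp: fock_fun_def)
  have [measurable]: "fun_of f \<in> borel_measurable borel"
    using f by (simp add: entire_borel)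
  have "(LINT z|gauss. (norm (fun_of f z))\<^sup>2) = 0"
    using assms by (simp add: fock_inner_self)
  then have "AE z in gauss. fun_of f z = 0"
    using f by (subst (asm) integral_nonneg_eq_0_iff_AE) auto
  then have "AE z in lborel. fun_of f z = 0"
    unfolding gauss_def by (subst (asm) AE_density) (auto simp: gauss_density_pos)
  then have "AE z in lebesgue. z \<in> {z. fun_of f z = 0}"
    by (simp add: AE_completion)
  then show ?thesis
    using mem_closed_if_AE_lebesgue[of "{z. fun_of f z = 0}" z]
      continuous_closed_preimage_constant[OF entire_continuous[OF f(1)] closed_UNIV, of 0]
    by simp
qed

text \<open>Underlying real structure: the real inner product is the real part of \<^const>\<open>fock_inner\<close>, so
  that the norm is the \<open>L\<^sup>2\<close> norm.\<close>

instantiation fock :: (finite) real_inner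
begin

lift_definition zero_fock :: "'a fock" is "\<lambda>_. 0" by (rule fock_fun_0)

lift_definition plus_fock :: "'a fock \<Rightarrow> 'a fock \<Rightarrow> 'a fock" is "\<lambda>f g z. f z + g z"
  by (rule fock_fun_add)

lift_definition uminus_fock :: "'a fock \<Rightarrow> 'a fock" is "\<lambda>f z. - f z"
  using fock_fun_scale[of _ "-1"] by simp

definition minus_fock :: "'a fock \<Rightarrow> 'a fock \<Rightarrow> 'a fock" where
  "f - g = f + - g" for f g :: "'a fock"

lift_definition scaleR_fock :: "real \<Rightarrow> 'a fock \<Rightarrow> 'a fock" is "\<lambda>r f z. of_real r * f z"
  by (rule fock_fun_scale)

definition inner_fock :: "'a fock \<Rightarrow> 'a fock \<Rightarrow> real" where
  "f \<bullet> g = Re (fock_inner f g)" for f g :: "'a fock"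

definition norm_fock :: "'a fock \<Rightarrow> real" where
  "norm f = sqrt (LINT z|gauss. (norm (fun_of f z))\<^sup>2)" for f :: "'a fock"

definition dist_fock :: "'a fock \<Rightarrow> 'a fock \<Rightarrow> real" where
  "dist f g = norm (f - g)" for f g :: "'a fock"

definition sgn_fock :: "'a fock \<Rightarrow> 'a fock" where
  "sgn f = scaleR (inverse (norm f)) f" for f :: "'a fock"

definition uniformity_fock :: "('a fock \<times> 'a fock) filter" where
  "uniformity_fock = (INF e\<in>{0 <..}. principal {(x, y). dist x y < e})"

definition open_fock :: "'a fock set \<Rightarrow> bool" where
  "open_fock U = (\<forall>x\<in>U. eventually (\<lambda>(x', y). x' = x \<longrightarrow> y \<in> U) uniformity)"

instance
proof
  fix f g h :: "'a fock" and r s :: real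
  show "f + g + h = f + (g + h)" by transfer (simp add: add.assoc)
  show "f + g = g + f" by transfer (simp add: add.commute)
  show "0 + f = f" by transfer simp
  show "- f + f = 0" by transfer simp
  show "f - g = f + - g" by (rule minus_fock_def)
  show "r *\<^sub>R (f + g) = r *\<^sub>R f + r *\<^sub>R g" by transfer (simp add: algebra_simps)
  show "(r + s) *\<^sub>R f = r *\<^sub>R f + s *\<^sub>R f" by transfer (simp add: algebra_simps)
  show "r *\<^sub>R s *\<^sub>R f = (r * s) *\<^sub>R f" by transfer (simp add: algebra_simps)
  show "1 *\<^sub>R f = f" by transfer simp
  show "sgn f = scaleR (inverse (norm f)) f" by (rule sgn_fock_def)
  show "dist f g = norm (f - g)" by (rule dist_fock_def)
  show "(uniformity :: ('a fock \<times> 'a fock) filter) = (INF e\<in>{0 <..}. principal {(x, y). dist x y < e})"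
    by (rule uniformity_fock_def)
  show "open U = (\<forall>x\<in>U. eventually (\<lambda>(x', y). x' = x \<longrightarrow> y \<in> U) uniformity)" for U :: "'a fock set"
    by (rule open_fock_def)
  have int: "integrable gauss (\<lambda>z. fun_of f z * cnj (fun_of g z))" for f g :: "'a fock"
    by (intro fock_fun_integrable fock_fun_fun_of)
  have "fock_inner f g = cnj (fock_inner g f)"
    by (simp add: fock_inner_def mult.commute flip: Bochner_Integration.integral_cnj)
  then show "f \<bullet> g = g \<bullet> f" by (simp add: inner_fock_def)
  show "(f + g) \<bullet> h = f \<bullet> h + g \<bullet> h"
    using int[of f h] int[of g h]
    by (simp add: inner_fock_def fock_inner_def plus_fock.rep_eq distrib_right)
  show "(r *\<^sub>R f) \<bullet> g = r * (f \<bullet> g)"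
    by (simp add: inner_fock_def fock_inner_def scaleR_fock.rep_eq mult.assoc)
  show "0 \<le> f \<bullet> f" by (simp add: inner_fock_def fock_inner_self)
  show "norm f = sqrt (f \<bullet> f)" by (simp add: inner_fock_def fock_inner_self norm_fock_def)
  show "f \<bullet> f = 0 \<longleftrightarrow> f = 0"
  proof
    assume "f \<bullet> f = 0"
    then have "fock_inner f f = 0"
      by (simp add: inner_fock_def fock_inner_self)
    from fock_inner_self_eq_0[OF this] show "f = 0"
      by transfer auto
  next
    assume "f = 0"
    then show "f \<bullet> f = 0" by (simp add: inner_fock_def fock_inner_def zero_fock.rep_eq)
  qed
qed

end

interpretation fock: vector_space "(*\<^sub>C) :: complex \<Rightarrow> 'n::finite fock \<Rightarrow> 'n fock"
  by unfold_locales (transfer; simp add: algebra_simps)+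


section \<open>Operators\<close>

text \<open>Being a \<^const>\<open>bounded_linear\<close> map only gives real linearity, hence the second conjunct.\<close>

definition bounded_ops :: "('n::finite fock \<Rightarrow> 'n fock) set" where
  "bounded_ops = {A. bounded_linear A \<and> (\<forall>c f. A (c *\<^sub>C f) = c *\<^sub>C A f)}"

definition is_adjoint :: "('n::finite fock \<Rightarrow> 'n fock) \<Rightarrow> ('n fock \<Rightarrow> 'n fock) \<Rightarrow> bool" where
  "is_adjoint A B \<longleftrightarrow> (\<forall>f g. fock_inner (A f) g = fock_inner f (B g))"

definition fock_adjoint :: "('n::finite fock \<Rightarrow> 'n fock) \<Rightarrow> 'n fock \<Rightarrow> 'n fock" where
  "fock_adjoint A = (THE B. is_adjoint A B)"

lift_definition weyl :: "complex^'n \<Rightarrow> 'n::finite fock \<Rightarrow> 'n fock"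
  is "\<lambda>z f w. kern z w * f (w - z)" by (rule fock_fun_weyl)

lift_definition parity :: "'n::finite fock \<Rightarrow> 'n fock"
  is "\<lambda>f z. f (- z)" by (rule fock_fun_reflect)

lemma weyl_adjoint:
  fixes z :: "complex^'n"
  shows "fock_adjoint (weyl z) = weyl (- z)"
proof -
  have adj: "fock_inner (weyl z f) g = fock_inner f (weyl (- z) g)" for f g
  proof -
    have [measurable]: "fun_of h \<in> borel_measurable borel" "kern u \<in> borel_measurable borel" for h u
      using fock_fun_fun_of[of h] by (auto simp: fock_fun_def entire_borel entire_kern)
    have LINT_gauss: "(LINT w|gauss. h w) = (LINT w|lborel. gauss_density w *\<^sub>R h w)"
      if [measurable]: "h \<in> borel_measurable borel" for h :: "complex^'n \<Rightarrow> complex"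
      unfolding gauss_def using less_imp_le[OF gauss_density_pos]
      by (subst integral_density) auto
    have kern: "gauss_density (z + w) *\<^sub>R kern z (z + w) = gauss_density w *\<^sub>R cnj (kern (- z) w)" for w
    proof -
      have *: "cdot (z + w) z = of_real ((norm z)\<^sup>2) + cdot w z"
      proof -
        have "cdot z z = of_real ((norm z)\<^sup>2)"
          by (simp add: cdot_def complex_norm_square norm_vec_def L2_set_def sum_nonneg
              del: of_real_power)
        then show ?thesis by (simp add: cdot_def distrib_right sum.distrib)
      qed
      have c: "cnj (cdot w (- z)) = - cdot z w"
        by (simp add: cdot_def sum_negf mult.commute)
      have "(norm (z + w))\<^sup>2 = (norm z)\<^sup>2 + 2 * Re (cdot w z) + (norm w)\<^sup>2"
        by (simp add: Re_cdot power2_norm_eq_inner inner_add_left inner_add_right inner_commute)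
      then have n: "complex_of_real ((norm (z + w))\<^sup>2)
          = of_real ((norm z)\<^sup>2) + (cdot w z + cnj (cdot w z)) + of_real ((norm w)\<^sup>2)"
        by (simp add: complex_add_cnj del: of_real_power)
      have d: "cdot z w = cnj (cdot w z)"
        by (simp add: cdot_def mult.commute)
      have "- (P + (X + Y) + Q) / 2 + ((P + X) / 2 - P / 4) = - Q / 2 + (- Y / 2 - P / 4)"
        for P Q X Y :: complex
        by (simp add: field_simps)
      from this[of "of_real ((norm z)\<^sup>2)" "cdot w z" "cnj (cdot w z)" "of_real ((norm w)\<^sup>2)"]
      have "- of_real ((norm (z + w))\<^sup>2) / 2 + (cdot (z + w) z / 2 - of_real ((norm z)\<^sup>2 / 4))
          = - of_real ((norm w)\<^sup>2) / 2 + (cnj (cdot w (- z)) / 2 - of_real ((norm z)\<^sup>2 / 4))"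
        unfolding n * c d by (simp del: of_real_power)
      then have "exp (- of_real ((norm (z + w))\<^sup>2) / 2) * kern z (z + w)
          = exp (- of_real ((norm w)\<^sup>2) / 2) * cnj (kern (- z) w)"
        by (simp only: kern_def exp_cnj exp_add[symmetric] complex_cnj_diff complex_cnj_divide
            complex_cnj_numeral complex_cnj_complex_of_real norm_minus_cancel)
      then show ?thesis
        by (simp add: gauss_density_def scaleR_conv_of_real flip: exp_of_real)
    qed
    have "fock_inner (weyl z f) g = (LINT w|lborel.
        gauss_density w *\<^sub>R (kern z w * fun_of f (w - z) * cnj (fun_of g w)))"
      by (simp add: fock_inner_def weyl.rep_eq LINT_gauss)
    also have "\<dots> = (LINT w|distr lborel borel ((+) z).
        gauss_density w *\<^sub>R (kern z w * fun_of f (w - z) * cnj (fun_of g w)))"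
      by (simp add: lborel_distr_plus)
    also have "\<dots> = (LINT w|lborel. (gauss_density (z + w) *\<^sub>R kern z (z + w)) *
        (fun_of f w * cnj (fun_of g (z + w))))"
      by (subst integral_distr) (auto simp: mult.assoc)
    also have "\<dots> = fock_inner f (weyl (- z) g)"
      unfolding kern
      by (simp add: fock_inner_def weyl.rep_eq LINT_gauss scaleR_conv_of_real mult_ac add.commute)
    finally show ?thesis .
  qed
  show ?thesis
    unfolding fock_adjoint_def
  proof (rule the_equality)
    show "is_adjoint (weyl z) (weyl (- z))"
      using adj by (simp add: is_adjoint_def)
    show "B = weyl (- z)" if "is_adjoint (weyl z) B" for B
    proof
      fix g
      have "f \<bullet> B g = f \<bullet> weyl (- z) g" for f
        using that adj by (simp add: inner_fock_def is_adjoint_def)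
      then show "B g = weyl (- z) g"
        using vector_eq_rdot[of "B g" "weyl (- z) g"] by (simp add: inner_commute)
    qed
  qed
qed

definition C1 :: "('n::finite fock \<Rightarrow> 'n fock) set" where
  "C1 = {A \<in> bounded_ops.
    ((\<lambda>z. onorm (\<lambda>f. weyl z (A (fock_adjoint (weyl z) f)) - A f)) \<longlongrightarrow> 0) (at 0)}"


section \<open>Fredholm operators and their index\<close>

definition kernel :: "('n::finite fock \<Rightarrow> 'n fock) \<Rightarrow> 'n fock set" where
  "kernel A = {f. A f = 0}"

definition finite_dim :: "'n::finite fock set \<Rightarrow> bool" where
  "finite_dim V \<longleftrightarrow> (\<exists>B. finite B \<and> V \<subseteq> fock.span B)"

text \<open>For a finite set \<open>B\<close> and a complex subspace \<open>S\<close>: the cosets \<open>b + S\<close> for \<open>b \<in> B\<close> are pairwise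
  distinct and form a basis of the quotient of the whole space by \<open>S\<close>. Distinctness is part of the
  independence, as \<open>b - b' \<in> S\<close> is a nontrivial relation.\<close>

definition quotient_basis :: "'n::finite fock set \<Rightarrow> 'n fock set \<Rightarrow> bool" where
  "quotient_basis S B \<longleftrightarrow> finite B
    \<and> (\<forall>u. (\<Sum>b\<in>B. u b *\<^sub>C b) \<in> S \<longrightarrow> (\<forall>b\<in>B. u b = 0))
    \<and> (\<forall>f. \<exists>u. f - (\<Sum>b\<in>B. u b *\<^sub>C b) \<in> S)"

definition finite_codim :: "'n::finite fock set \<Rightarrow> bool" where
  "finite_codim S \<longleftrightarrow> (\<exists>B. quotient_basis S B)"

definition codim :: "'n::finite fock set \<Rightarrow> nat" where
  "codim S = (THE k. \<exists>B. quotient_basis S B \<and> card B = k)"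

text \<open>Closedness of the range need not be required: for a bounded operator on a Hilbert space it
  follows from the finite dimension of the cokernel \<open>\<H> / range A\<close>.\<close>

definition fredholm :: "('n::finite fock \<Rightarrow> 'n fock) \<Rightarrow> bool" where
  "fredholm A \<longleftrightarrow> A \<in> bounded_ops \<and> finite_dim (kernel A) \<and> finite_codim (range A)"

definition fredholm_index :: "('n::finite fock \<Rightarrow> 'n fock) \<Rightarrow> int" where
  "fredholm_index A = int (fock.dim (kernel A)) - int (codim (range A))"

end

(*
  On the even and odd functions an even operator A is a direct sum A+ + A-, so that
  ind A = ind A+ + ind A-, and it is enough to show that the two summands have the same index.
  This follows from an odd Fredholm operator V that almost commutes with A: then V A+ is close to
  A- V, and the index is additive under composition.  For n > 1 the symbol of V cannot be
  scalar (Borsuk-Ulam), so V acts on functions with values in the exterior algebra of C^n.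
  It is V = D h(D^2), where D is the Dirac-type operator made of the coordinates z_j and
  their adjoints 2 d/dz_j.  D^2 is diagonal in the monomials, and h(l) = sum_j a_j / (l + a_j^2)
  with a_j = 2^j a behaves like l^(-1/2) for l >= a^2.  For an operator Y that is Lipschitz under
  conjugation by Weyl operators the commutator [D, Y] is bounded by some C, so that each term,
  a sum of resolvents of D, contributes O(C / a_j) to [V, Y], whence [V, Y] = O(C / a).  Averaging over
  short segments of translations approximates every A in C1 by such operators Y in norm.
*)

theory Submission
  imports Defs "HOL-Complex_Analysis.Cauchy_Integral_Formula" "HOL-Probability.Distributions"
begin

section \<open>Traces of finite-rank maps and the algebraic index\<close>

text \<open>The index is computed as a difference of two traces, so its calculus reduces to trace (F
  G) = trace (G F), and the comparison of the two summands needs only one topological fact: a map of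
  norm at most 1/2 subtracted from the identity leaves a bijection. To keep both summands on one
  space, each is completed by the identity on the other parity. The exterior algebra multiplies
  their indices by 2^n; this factor and the index of V occur on both sides of the final equation and
  cancel. The obstacle is uniformity: the commutator must be small relative to a parametrix W of V,
  so W must not grow with a. The dyadic sum h achieves this: for every a, D h(D^2) has norm at most
  4 and an inverse of norm at most 2 off the finite-dimensional space where D^2 < a^2. Raising a
  only enlarges that space. No theory of unbounded operators is involved: identities for D are
  proved as forms on polynomials and extended by density.\<close>

locale trace_space = vector_space scale
  for scale :: "'a::field \<Rightarrow> 'b::ab_group_add \<Rightarrow> 'b" (infixr \<open>\<odot>\<close> 75)
begin

definition functional :: "('b \<Rightarrow> 'a) \<Rightarrow> bool" where
  "functional \<phi> \<longleftrightarrow> (\<forall>x y. \<phi> (x + y) = \<phi> x + \<phi> y) \<and> (\<forall>c x. \<phi> (c \<odot> x) = c * \<phi> x)"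

lemma functional_sum: "functional \<phi> \<Longrightarrow> \<phi> (\<Sum>i\<in>I. f i) = (\<Sum>i\<in>I. \<phi> (f i))"
proof (induction I rule: infinite_finite_induct)
  case empty
  then have "\<phi> (0 \<odot> 0) = 0 * \<phi> 0"
    unfolding functional_def by blast
  then show ?case by simp
next
  case (infinite A)
  then have "\<phi> (0 \<odot> 0) = 0 * \<phi> 0"
    unfolding functional_def by blast
  with infinite show ?case by simp
qed (simp add: functional_def)

definition finite_rank :: "('b \<Rightarrow> 'b) \<Rightarrow> bool" where
  "finite_rank F \<longleftrightarrow> Vector_Spaces.linear scale scale F \<and> (\<exists>B. finite B \<and> range F \<subseteq> span B)"

text \<open>The diagonal sum in a Hamel basis of the whole space, obtained by extending the empty
  set. It is meaningful for finite rank; with infinitely many nonzero diagonal entries the sum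
  defaults to 0.\<close>

definition trace :: "('b \<Rightarrow> 'b) \<Rightarrow> 'a" where
  "trace F = (let R = representation (extend_basis {}) in \<Sum>b | R (F b) b \<noteq> 0. R (F b) b)"

lemma linear_iff_scale: "Vector_Spaces.linear scale scale F \<longleftrightarrow>
    (\<forall>x y. F (x + y) = F x + F y) \<and> (\<forall>c x. F (c \<odot> x) = c \<odot> F x)"
  using vector_space_axioms
  by (auto simp: Vector_Spaces.linear_iff)

text \<open>Only the finitely many basis vectors that occur in some \<open>v i\<close> can have a
  nonzero diagonal entry, and summing these entries reassembles \<open>v i\<close> under
  \<open>\<phi> i\<close>. Any finite expansion of F therefore computes the trace, and the choice of
  basis drops out.\<close>

lemma trace_sum:
  assumes "finite I" "\<And>i. i \<in> I \<Longrightarrow> functional (\<phi> i)"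
    and F: "\<And>x. F x = (\<Sum>i\<in>I. \<phi> i x \<odot> v i)"
  shows "trace F = (\<Sum>i\<in>I. \<phi> i (v i))"
proof -
  define E where "E = extend_basis {}"
  define R where "R = representation E"
  have E: "independent E" "span E = UNIV"
    unfolding E_def using independent_extend_basis[OF independent_empty] span_extend_basis[OF independent_empty] by auto
  define T where "T = (\<Union>i\<in>I. {b. R (v i) b \<noteq> 0})"
  have T: "finite T"
    unfolding T_def R_def using assms(1) finite_representation by blast
  have R: "R (F x) b = (\<Sum>i\<in>I. \<phi> i x * R (v i) b)" for x b
    unfolding F R_def by (simp add: representation_sum representation_scale E)
  have "trace F = (\<Sum>b | R (F b) b \<noteq> 0. R (F b) b)"
    unfolding trace_def R_def E_def Let_def ..
  also have "\<dots> = (\<Sum>b\<in>T. R (F b) b)"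
  proof (rule sum.mono_neutral_left[OF T])
    show "{b. R (F b) b \<noteq> 0} \<subseteq> T"
    proof (rule subsetI, rule ccontr)
      fix b assume b: "b \<in> {b. R (F b) b \<noteq> 0}" "b \<notin> T"
      then have "R (v i) b = 0" if "i \<in> I" for i
        using that by (auto simp: T_def)
      then have "R (F b) b = 0" by (simp add: R)
      with b show False by simp
    qed
  qed auto
  also have "\<dots> = (\<Sum>i\<in>I. \<Sum>b\<in>T. \<phi> i b * R (v i) b)"
    unfolding R by (rule sum.swap)
  also have "\<dots> = (\<Sum>i\<in>I. \<phi> i (v i))"
  proof (rule sum.cong[OF refl])
    fix i assume i: "i \<in> I"
    then have f: "functional (\<phi> i)" by (rule assms)
    have "v i = (\<Sum>b | R (v i) b \<noteq> 0. R (v i) b \<odot> b)"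
      unfolding R_def by (rule sum_nonzero_representation_eq[symmetric]) (auto simp: E)
    also have "\<dots> = (\<Sum>b\<in>T. R (v i) b \<odot> b)"
      using i by (intro sum.mono_neutral_left T) (auto simp: T_def)
    finally have "\<phi> i (v i) = \<phi> i (\<Sum>b\<in>T. R (v i) b \<odot> b)" by simp
    also have "\<dots> = (\<Sum>b\<in>T. \<phi> i b * R (v i) b)"
      unfolding functional_sum[OF f] using f by (auto simp: functional_def mult.commute)
    finally show "(\<Sum>b\<in>T. \<phi> i b * R (v i) b) = \<phi> i (v i)" by simp
  qed
  finally show ?thesis .
qed

text \<open>The inclusion of C in the range and the explicit coordinate functionals are recorded for
  \<open>trace_idempotent\<close>, where F fixes every vector of C.\<close>

lemma finite_rank_expansion:
  assumes "finite_rank F"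
  obtains C \<phi> where "finite C" "independent C" "C \<subseteq> range F" "\<And>c. c \<in> C \<Longrightarrow> functional (\<phi> c)"
    "\<And>x. F x = (\<Sum>c\<in>C. \<phi> c x \<odot> c)" 
    "\<And>c x. \<phi> c x = representation C (F x) c"
proof -
  obtain B where B: "finite B" "range F \<subseteq> span B" and lin: "Vector_Spaces.linear scale scale F"
    using assms by (auto simp: finite_rank_def)
  obtain C where C: "C \<subseteq> range F" "independent C" "range F \<subseteq> span C"
    using maximal_independent_subset by blast
  have fin: "finite C"
    using independent_span_bound[OF B(1) C(2)] C(1) B(2) by auto
  show ?thesis
  proof (rule that[of C "\<lambda>c x. representation C (F x) c"])
    show "functional (\<lambda>x. representation C (F x) c)" if "c \<in> C" for c
      using lin C(2,3) unfolding functional_def linear_iff_scale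
      by (auto simp: representation_add representation_scale subset_iff)
    show "F x = (\<Sum>c\<in>C. representation C (F x) c \<odot> c)" for x
      using C(3) by (intro sum_representation_eq[symmetric] C fin) auto
  qed (use C fin in auto)
qed

lemma finite_rank_sumI:
  assumes "finite I" "\<And>i. i \<in> I \<Longrightarrow> functional (\<phi> i)"
    and F: "\<And>x. F x = (\<Sum>i\<in>I. \<phi> i x \<odot> v i)"
  shows "finite_rank F"
  unfolding finite_rank_def linear_iff_scale
proof (intro conjI allI exI[of _ "v ` I"])
  show "range F \<subseteq> span (v ` I)"
    unfolding F by (auto intro!: span_sum span_scale intro: span_base)
qed (use assms in \<open>auto simp: F functional_def scale_left_distrib sum.distrib scale_sum_right\<close>)

lemma
  assumes "finite_rank F" "finite_rank G"
  shows finite_rank_add: "finite_rank (\<lambda>x. F x + G x)"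
    and trace_add: "trace (\<lambda>x. F x + G x) = trace F + trace G"
proof -
  obtain C \<phi> where C: "finite C" "\<And>c. c \<in> C \<Longrightarrow> functional (\<phi> c)" "\<And>x. F x = (\<Sum>c\<in>C. \<phi> c x \<odot> c)"
    using finite_rank_expansion[OF assms(1)] by metis
  obtain D \<psi> where D: "finite D" "\<And>c. c \<in> D \<Longrightarrow> functional (\<psi> c)" "\<And>x. G x = (\<Sum>c\<in>D. \<psi> c x \<odot> c)"
    using finite_rank_expansion[OF assms(2)] by metis
  \<comment> \<open>A disjoint union, because C and D may have vectors in common.\<close>
  let ?I = "C <+> D"
  let ?f = "case_sum \<phi> \<psi>" and ?v = "case_sum (\<lambda>c. c) (\<lambda>c. c)"
  have 1: "finite ?I" "\<And>i. i \<in> ?I \<Longrightarrow> functional (?f i)"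
    "\<And>x. F x + G x = (\<Sum>i\<in>?I. ?f i x \<odot> ?v i)"
    using C D by (auto simp: sum.Plus)
  show "finite_rank (\<lambda>x. F x + G x)" by (rule finite_rank_sumI[OF 1])
  show "trace (\<lambda>x. F x + G x) = trace F + trace G"
  proof -
    have F: "trace F = (\<Sum>c\<in>C. \<phi> c c)" by (rule trace_sum[OF C])
    have G: "trace G = (\<Sum>c\<in>D. \<psi> c c)" by (rule trace_sum[OF D])
    have "trace (\<lambda>x. F x + G x) = (\<Sum>i\<in>?I. ?f i (?v i))" by (rule trace_sum[OF 1])
    then show ?thesis unfolding F G sum.Plus[OF C(1) D(1)] by simp
  qed
qed

text \<open>Both traces equal the sum of \<open>\<phi> c (G c)\<close>, and G may have infinite
  rank. This cyclicity drives the whole index calculus.\<close>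

lemma
  assumes "finite_rank F" "Vector_Spaces.linear scale scale G"
  shows finite_rank_comp_left: "finite_rank (\<lambda>x. G (F x))"
    and finite_rank_comp_right: "finite_rank (\<lambda>x. F (G x))"
    and trace_commute: "trace (\<lambda>x. G (F x)) = trace (\<lambda>x. F (G x))"
proof -
  obtain C \<phi> where C: "finite C" "\<And>c. c \<in> C \<Longrightarrow> functional (\<phi> c)" "\<And>x. F x = (\<Sum>c\<in>C. \<phi> c x \<odot> c)"
    using finite_rank_expansion[OF assms(1)] by metis
  interpret G: Vector_Spaces.linear scale scale G by fact
  have 1: "G (F x) = (\<Sum>c\<in>C. \<phi> c x \<odot> G c)" for x
    by (simp add: C G.sum G.scale)
  have 2: "\<And>c. c \<in> C \<Longrightarrow> functional (\<lambda>x. \<phi> c (G x))" "\<And>x. F (G x) = (\<Sum>c\<in>C. \<phi> c (G x) \<odot> c)"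
    using C by (auto simp: functional_def G.add G.scale)
  show "finite_rank (\<lambda>x. G (F x))" by (rule finite_rank_sumI[OF C(1,2) 1])
  show "finite_rank (\<lambda>x. F (G x))" by (rule finite_rank_sumI[OF C(1) 2])
  show "trace (\<lambda>x. G (F x)) = trace (\<lambda>x. F (G x))"
    by (simp add: trace_sum[OF C(1,2) 1] trace_sum[OF C(1) 2])
qed

lemma
  assumes "finite_rank F" "finite_rank G"
  shows finite_rank_diff: "finite_rank (\<lambda>x. F x - G x)"
    and trace_diff: "trace (\<lambda>x. F x - G x) = trace F - trace G"
proof -
  obtain B where "finite B" "range G \<subseteq> span B" "Vector_Spaces.linear scale scale G"
    using assms(2) by (auto simp: finite_rank_def)
  then have G: "finite_rank (\<lambda>x. - G x)"
    unfolding finite_rank_def linear_iff_scale by (auto intro!: exI[of _ B] span_neg)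
  show 1: "finite_rank (\<lambda>x. F x - G x)" using finite_rank_add[OF assms(1) G] by simp
  show "trace (\<lambda>x. F x - G x) = trace F - trace G"
    using trace_add[OF 1 assms(2)] by simp
qed

lemma finite_rank_cong_span:
  assumes "Vector_Spaces.linear scale scale F" "finite B" "\<And>x. F x \<in> span B"
  shows "finite_rank F"
  using assms by (auto simp: finite_rank_def)

text \<open>On a basis of its range a projection has diagonal entries 1. This is the point where
  traces turn into dimensions, hence into integers.\<close>

lemma trace_idempotent:
  assumes "finite_rank F" "\<And>x. F (F x) = F x"
  shows "trace F = of_nat (dim (range F))"
proof -
  obtain C \<phi> where C: "finite C" "independent C" "C \<subseteq> range F" "\<And>c. c \<in> C \<Longrightarrow> functional (\<phi> c)"
      "\<And>x. F x = (\<Sum>c\<in>C. \<phi> c x \<odot> c)" "\<And>c x. \<phi> c x = representation C (F x) c"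
    by (rule finite_rank_expansion[OF assms(1)]) blast
  have "F c = c" if "c \<in> C" for c
    using C(3) that assms(2) by auto
  moreover have "trace F = (\<Sum>c\<in>C. \<phi> c c)"
    by (rule trace_sum[OF C(1,4,5)])
  ultimately have "trace F = (\<Sum>c\<in>C. 1)"
    by (simp only:) (intro sum.cong, auto simp: C(6) representation_basis[OF C(2)])
  moreover have "dim (range F) = card C"
  proof (rule dim_unique[OF C(3)])
    show "range F \<subseteq> span C"
      unfolding C(5) by (auto intro!: span_sum span_scale intro: span_base)
  qed (use C(2) in simp_all)
  ultimately show ?thesis by simp
qed

section \<open>Parametrices and the index as a difference of traces\<close>

definition parametrix :: "('b \<Rightarrow> 'b) \<Rightarrow> ('b \<Rightarrow> 'b) \<Rightarrow> bool" where
  "parametrix T B \<longleftrightarrow> Vector_Spaces.linear scale scale T \<and> Vector_Spaces.linear scale scale B \<and>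
     finite_rank (\<lambda>x. x - B (T x)) \<and> finite_rank (\<lambda>x. x - T (B x))"

text \<open>Fedosov's formula for the Fredholm index. It takes values in the scalar field;
  integrality has to be established separately.\<close>

definition pindex :: "('b \<Rightarrow> 'b) \<Rightarrow> ('b \<Rightarrow> 'b) \<Rightarrow> 'a" where
  "pindex T B = trace (\<lambda>x. x - B (T x)) - trace (\<lambda>x. x - T (B x))"

lemma parametrix_swap: "parametrix T B \<Longrightarrow> parametrix B T"
  and pindex_swap: "pindex B T = - pindex T B"
  by (simp_all add: parametrix_def pindex_def)

text \<open>Two inverses modulo finite rank differ by a finite-rank map D, and passing from one to
  the other changes the two traces by trace (D T) and trace (T D), which agree.\<close>

lemma pindex_unique:
  assumes "parametrix T B" "parametrix T B'"
  shows "pindex T B = pindex T B'"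
proof -
  interpret T: Vector_Spaces.linear scale scale T using assms by (simp add: parametrix_def)
  interpret B: Vector_Spaces.linear scale scale B using assms by (simp add: parametrix_def)
  interpret B': Vector_Spaces.linear scale scale B' using assms by (simp add: parametrix_def)
  have P: "finite_rank (\<lambda>x. x - B (T x))" "finite_rank (\<lambda>x. x - T (B x))"
    and P': "finite_rank (\<lambda>x. x - B' (T x))" "finite_rank (\<lambda>x. x - T (B' x))"
    using assms by (auto simp: parametrix_def)
  define D where "D = (\<lambda>x. B' x - B x)"
  have "D = (\<lambda>x. B' (x - T (B x)) - (B x - B' (T (B x))))"
    by (auto simp: D_def B'.diff)
  then have D: "finite_rank D"
    using finite_rank_diff[OF finite_rank_comp_left[OF P(2) B'.linear_axioms]
        finite_rank_comp_right[OF P'(1) B.linear_axioms]] by simp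
  have "trace (\<lambda>x. D (T x)) = trace (\<lambda>x. x - B (T x)) - trace (\<lambda>x. x - B' (T x))"
    unfolding trace_diff[OF P(1) P'(1), symmetric] by (simp add: D_def)
  moreover have "trace (\<lambda>x. T (D x)) = trace (\<lambda>x. x - T (B x)) - trace (\<lambda>x. x - T (B' x))"
    unfolding trace_diff[OF P(2) P'(2), symmetric] by (simp add: D_def T.diff)
  ultimately have "trace (\<lambda>x. x - B (T x)) - trace (\<lambda>x. x - B' (T x))
      = trace (\<lambda>x. x - T (B x)) - trace (\<lambda>x. x - T (B' x))"
    using trace_commute[OF D T.linear_axioms] by metis
  then show ?thesis
    by (simp add: pindex_def algebra_simps)
qed

text \<open>With P' = 1 - B S and Q' = 1 - T C, cyclicity turns the extra terms of the composition
  into trace P' - trace (P' Q') and trace Q' - trace (Q' P'); the mixed traces agree and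
  cancel.\<close>

lemma
  assumes "parametrix S B" "parametrix T C"
  shows parametrix_comp: "parametrix (\<lambda>x. S (T x)) (\<lambda>x. C (B x))"
    and pindex_comp: "pindex (\<lambda>x. S (T x)) (\<lambda>x. C (B x)) = pindex S B + pindex T C"
proof -
  interpret S: Vector_Spaces.linear scale scale S using assms by (simp add: parametrix_def)
  interpret B: Vector_Spaces.linear scale scale B using assms by (simp add: parametrix_def)
  interpret T: Vector_Spaces.linear scale scale T using assms by (simp add: parametrix_def)
  interpret C: Vector_Spaces.linear scale scale C using assms by (simp add: parametrix_def)
  have P: "finite_rank (\<lambda>x. x - B (S x))" "finite_rank (\<lambda>x. x - S (B x))"
    and Q: "finite_rank (\<lambda>x. x - C (T x))" "finite_rank (\<lambda>x. x - T (C x))"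
    using assms by (auto simp: parametrix_def)
  have lin: "Vector_Spaces.linear scale scale (\<lambda>x. S (T x))" "Vector_Spaces.linear scale scale (\<lambda>x. C (B x))"
    using vector_space_axioms by (auto simp: linear_iff_scale S.add T.add C.add B.add S.scale T.scale C.scale B.scale)
  have PT: "finite_rank (\<lambda>x. T x - B (S (T x)))"
    using finite_rank_comp_right[OF P(1) T.linear_axioms] .
  have QB: "finite_rank (\<lambda>x. B x - T (C (B x)))"
    using finite_rank_comp_right[OF Q(2) B.linear_axioms] .
  have CPT: "finite_rank (\<lambda>x. C (T x - B (S (T x))))" and SQB: "finite_rank (\<lambda>x. S (B x - T (C (B x))))"
    using finite_rank_comp_left[OF PT C.linear_axioms] finite_rank_comp_left[OF QB S.linear_axioms] .
  have e1: "(\<lambda>x. x - C (B (S (T x)))) = (\<lambda>x. (x - C (T x)) + C (T x - B (S (T x))))"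
    and e2: "(\<lambda>x. x - S (T (C (B x)))) = (\<lambda>x. (x - S (B x)) + S (B x - T (C (B x))))"
    by (auto simp: C.diff S.diff)
  show "parametrix (\<lambda>x. S (T x)) (\<lambda>x. C (B x))"
    unfolding parametrix_def e1 e2
    using lin finite_rank_add[OF Q(1) CPT] finite_rank_add[OF P(2) SQB] by simp
  define P' where "P' = (\<lambda>x. x - B (S x))"
  define Q' where "Q' = (\<lambda>x. x - T (C x))"
  have fr: "finite_rank P'" "finite_rank Q'" using P Q by (simp_all add: P'_def Q'_def)
  interpret P': Vector_Spaces.linear scale scale P' using fr by (simp add: finite_rank_def)
  interpret Q': Vector_Spaces.linear scale scale Q' using fr by (simp add: finite_rank_def)
  have PT': "finite_rank (\<lambda>x. P' (T x))" and QB': "finite_rank (\<lambda>x. Q' (B x))"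
    using PT QB by (simp_all add: P'_def Q'_def)
  have PTC: "finite_rank (\<lambda>x. P' (T (C x)))"
    by (rule finite_rank_comp_right[OF PT' C.linear_axioms])
  have QP: "finite_rank (\<lambda>x. Q' (P' x))" and PQ: "finite_rank (\<lambda>x. P' (Q' x))"
    using finite_rank_comp_left[OF fr(1) Q'.linear_axioms] finite_rank_comp_left[OF fr(2) P'.linear_axioms] .
  have "trace (\<lambda>x. C (P' (T x))) = trace (\<lambda>x. P' (T (C x)))"
    using trace_commute[OF PT' C.linear_axioms] by simp
  also have "(\<lambda>x. P' (T (C x))) = (\<lambda>x. P' x - P' (Q' x))"
    unfolding P'.diff[symmetric] by (simp add: Q'_def)
  also have "trace \<dots> = trace P' - trace (\<lambda>x. P' (Q' x))"
    using trace_diff[OF fr(1) PQ] .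
  finally have 1: "trace (\<lambda>x. C (P' (T x))) = trace P' - trace (\<lambda>x. P' (Q' x))" .
  have "trace (\<lambda>x. S (Q' (B x))) = trace (\<lambda>x. Q' (B (S x)))"
    using trace_commute[OF QB' S.linear_axioms] by simp
  also have "(\<lambda>x. Q' (B (S x))) = (\<lambda>x. Q' x - Q' (P' x))"
    unfolding Q'.diff[symmetric] by (simp add: P'_def)
  also have "trace \<dots> = trace Q' - trace (\<lambda>x. Q' (P' x))"
    using trace_diff[OF fr(2) QP] .
  finally have 2: "trace (\<lambda>x. S (Q' (B x))) = trace Q' - trace (\<lambda>x. Q' (P' x))" .
  show "pindex (\<lambda>x. S (T x)) (\<lambda>x. C (B x)) = pindex S B + pindex T C"
    unfolding pindex_def e1 e2 trace_add[OF Q(1) CPT] trace_add[OF P(2) SQB]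
    using 1 2 trace_commute[OF fr(1) Q'.linear_axioms] by (simp add: P'_def Q'_def)
qed

text \<open>Stability of the index in algebraic form: B Y differs from a bijection by finite rank,
  so its index is 0, and additivity gives index Y = - index B = index X. In the application J is the
  identity minus a map of small norm.\<close>

lemma pindex_perturbation:
  assumes "parametrix X B" "parametrix Y C"
    and J: "Vector_Spaces.linear scale scale J" "bij J"
    and P: "finite_rank P" and eq: "\<And>x. B (Y x) = J x - P x"
  shows "pindex X B = pindex Y C"
proof -
  interpret J: Vector_Spaces.linear scale scale J by fact
  interpret P: Vector_Spaces.linear scale scale P using P by (simp add: finite_rank_def)
  define M where "M = inv J"
  have M: "M (J x) = x" "J (M x) = x" for x
    using J(2) by (auto simp: M_def bij_def surj_f_inv_f)
  have Mlin: "Vector_Spaces.linear scale scale M"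
    unfolding linear_iff_scale using M J.add J.scale by metis
  interpret M: Vector_Spaces.linear scale scale M by fact
  have e: "(\<lambda>x. x - M (B (Y x))) = (\<lambda>x. M (P x))" "(\<lambda>x. x - B (Y (M x))) = (\<lambda>x. P (M x))"
    unfolding eq by (auto simp: M M.diff)
  have BY: "parametrix (\<lambda>x. B (Y x)) (\<lambda>x. C (X x))"
    and i: "pindex (\<lambda>x. B (Y x)) (\<lambda>x. C (X x)) = pindex B X + pindex Y C"
    using parametrix_comp[OF parametrix_swap[OF assms(1)] assms(2)]
      pindex_comp[OF parametrix_swap[OF assms(1)] assms(2)] by auto
  \<comment> \<open>The inverse of J is a parametrix of B Y whose two defects are M P and P M; they
    have the same trace.\<close>
  have "parametrix (\<lambda>x. B (Y x)) M"
    unfolding parametrix_def e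
    using BY Mlin finite_rank_comp_left[OF P Mlin] finite_rank_comp_right[OF P Mlin]
    by (simp add: parametrix_def)
  from pindex_unique[OF this BY] have "pindex (\<lambda>x. B (Y x)) (\<lambda>x. C (X x)) = 0"
    using trace_commute[OF P Mlin] by (simp add: pindex_def e)
  with i show ?thesis by (simp add: pindex_swap[of B X])
qed

end

section \<open>Bounded operators\<close>

text \<open>Baire category and successive approximation give the open mapping theorem with a bound
  on preimages. The domain is a closed subspace rather than a type, since it will be an orthogonal
  complement times a finite-dimensional span.\<close>

lemma open_mapping_bound:
  fixes f :: "'a::banach \<Rightarrow> 'b::banach"
  assumes f: "bounded_linear f" and X: "subspace X" "closed X" and surj: "f ` X = UNIV"
  obtains C where "C > 0" "\<And>y. \<exists>x\<in>X. f x = y \<and> norm x \<le> C * norm y"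
proof -
  interpret f: bounded_linear f by fact
  define F where "F n = closure (f ` (X \<inter> cball 0 (real n)))" for n
  have "(\<Union>n. F n) = UNIV"
  proof -
    have "y \<in> (\<Union>n. F n)" for y
    proof -
      obtain x where x: "x \<in> X" "f x = y" using surj by (metis UNIV_I imageE)
      obtain n where "norm x \<le> real n" using real_arch_simple by blast
      then have "y \<in> F n"
        unfolding F_def using x closure_subset by fastforce
      then show ?thesis by blast
    qed
    then show ?thesis by blast
  qed
  have "\<exists>n. interior (F n) \<noteq> {}"
  proof (rule ccontr)
    assume *: "\<nexists>n. interior (F n) \<noteq> {}"
    have "Met_TC.mtopology interior_of \<Union>(range F) = {}"
    proof (rule Met_TC.metric_Baire_category_alt)
      show "Met_TC.mcomplete TYPE('b)" by (simp add: complete_UNIV)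
      fix T assume "T \<in> range F"
      then obtain n where "T = F n" by blast
      then show "closedin Met_TC.mtopology T \<and> Met_TC.mtopology interior_of T = {}"
        using * by (simp add: mtopology_is_euclidean interior_of_eq F_def flip: closed_closedin)
    qed simp
    then show False
      using \<open>(\<Union>n. F n) = UNIV\<close> by (simp add: mtopology_is_euclidean)
  qed
  then obtain n y0 where "y0 \<in> interior (F n)" by blast
  then obtain r where r: "r > 0" "ball y0 r \<subseteq> F n"
    by (meson interior_subset open_contains_ball open_interior subset_trans)
  \<comment> \<open>Both \<open>y0 + y\<close> and \<open>y0 - y\<close> lie in the ball; half the
    difference of their approximate preimages removes the unknown center \<open>y0\<close>.\<close>
  have small: "\<exists>x\<in>X. norm x \<le> real n \<and> norm (y - f x) < e" if "norm y < r" "e > 0" for y e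
  proof -
    have "y0 + y \<in> F n" "y0 - y \<in> F n"
      using that r by (auto simp: dist_norm subset_iff)
    then have "\<exists>x\<in>X \<inter> cball 0 (real n). dist (f x) (y0 + y) < e"
        "\<exists>x\<in>X \<inter> cball 0 (real n). dist (f x) (y0 - y) < e"
      unfolding F_def closure_approachable using \<open>e > 0\<close> by auto
    then obtain x1 x2 where x: "x1 \<in> X" "norm x1 \<le> real n" "dist (f x1) (y0 + y) < e"
        "x2 \<in> X" "norm x2 \<le> real n" "dist (f x2) (y0 - y) < e"
      by auto
    define x where "x = (1/2) *\<^sub>R (x1 - x2)"
    have xX: "x \<in> X" using x X(1) by (auto simp: x_def intro!: subspace_scale subspace_diff)
    have nx: "norm x \<le> real n"
      using norm_triangle_ineq4[of x1 x2] x by (simp add: x_def)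
    have "y - f x = (1/2) *\<^sub>R ((y0 + y - f x1) - (y0 - y - f x2))"
      by (simp add: x_def f.scaleR f.diff algebra_simps flip: scaleR_add_left)
    then have "norm (y - f x) \<le> (1/2) * (norm (y0 + y - f x1) + norm (y0 - y - f x2))"
      using norm_triangle_ineq4[of "y0 + y - f x1" "y0 - y - f x2"] by simp
    also have "\<dots> < e"
      using x by (simp add: dist_norm norm_minus_commute)
    finally show ?thesis using xX nx by blast
  qed
  \<comment> \<open>Scaling y to norm r/2 costs the factor 2/r; the summand 1 keeps K positive when
    n = 0.\<close>
  define K where "K = 2 * (real n + 1) / r"
  have K: "K > 0" using r by (simp add: K_def)
  have "\<exists>x\<in>X. norm x \<le> K * norm y \<and> norm (y - f x) \<le> norm y / 2" for y
  proof (cases "y = 0")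
    case True
    then show ?thesis using subspace_0[OF X(1)] by (intro bexI[of _ 0]) (auto simp: f.zero)
  next
    case False
    define c where "c = r / (2 * norm y)"
    have c: "c > 0" using False r by (simp add: c_def)
    have "norm (c *\<^sub>R y) < r" using False r by (simp add: c_def)
    moreover have "c * (norm y / 2) > 0" using c False by simp
    ultimately obtain x where x: "x \<in> X" "norm x \<le> real n" "norm (c *\<^sub>R y - f x) < c * (norm y / 2)"
      using small by blast
    show ?thesis
    proof (intro bexI conjI)
      show "(1/c) *\<^sub>R x \<in> X" using x X(1) by (simp add: subspace_scale)
      have "norm ((1/c) *\<^sub>R x) \<le> (1/c) * (real n + 1)"
        using x(2) c by (simp add: divide_right_mono)
      also have "\<dots> = K * norm y" using False r by (simp add: K_def c_def)
      finally show "norm ((1/c) *\<^sub>R x) \<le> K * norm y" .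
      have "y - f ((1/c) *\<^sub>R x) = (1/c) *\<^sub>R (c *\<^sub>R y - f x)"
        using c by (simp add: f.scaleR scaleR_diff_right)
      then have "norm (y - f ((1/c) *\<^sub>R x)) = (1/c) * norm (c *\<^sub>R y - f x)"
        using c by simp
      also have "\<dots> \<le> (1/c) * (c * (norm y / 2))"
        using x(3) c by (intro mult_left_mono) auto
      finally show "norm (y - f ((1/c) *\<^sub>R x)) \<le> norm y / 2" using c by simp
    qed
  qed
  then obtain g where g: "\<And>y. g y \<in> X" "\<And>y. norm (g y) \<le> K * norm y"
      "\<And>y. norm (y - f (g y)) \<le> norm y / 2" by metis
  show ?thesis
  proof (rule that[of "2 * K"])
    show "2 * K > 0" using K by simp
    fix y
    \<comment> \<open>The residual after k corrections. It at least halves at each step, so the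
      corrections are dominated by a geometric series with sum 2 K norm y.\<close>
    define Y where "Y k = ((\<lambda>y. y - f (g y)) ^^ k) y" for k
    have Y0: "Y 0 = y" and YS: "Y (Suc k) = Y k - f (g (Y k))" for k by (simp_all add: Y_def)
    have nY: "norm (Y k) \<le> norm y * (1/2)^k" for k
    proof (induction k)
      case (Suc k)
      have "norm (Y (Suc k)) \<le> norm (Y k) / 2" unfolding YS by (rule g)
      with Suc show ?case by simp
    qed (simp add: Y0)
    have ng: "norm (g (Y k)) \<le> K * norm y * (1/2)^k" for k
    proof -
      have "norm (g (Y k)) \<le> K * norm (Y k)" by (rule g)
      also have "\<dots> \<le> K * (norm y * (1/2)^k)" using nY K by (intro mult_left_mono) auto
      finally show ?thesis by (simp add: mult_ac)
    qed
    have geo: "(\<lambda>k. K * norm y * (1/2)^k) sums (K * norm y * 2)"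
      using geometric_sums[of "1/2::real"] by (intro sums_mult) auto
    have sn: "summable (\<lambda>k. norm (g (Y k)))"
      by (rule summable_comparison_test'[OF sums_summable[OF geo]]) (simp add: ng)
    define x where "x = (\<Sum>k. g (Y k))"
    have sx: "(\<lambda>k. g (Y k)) sums x"
      unfolding x_def by (rule summable_sums[OF summable_norm_cancel[OF sn]])
    have "x \<in> X"
    proof (rule closed_sequentially[OF X(2)])
      show "(\<lambda>n. \<Sum>k<n. g (Y k)) \<longlonglongrightarrow> x" using sx by (simp add: sums_def)
      show "(\<Sum>k<m. g (Y k)) \<in> X" for m using g X(1) by (intro subspace_sum) auto
    qed
    moreover have "f x = y"
    proof -
      have "(\<lambda>k. f (g (Y k))) sums f x" by (rule f.sums[OF sx])
      moreover have "(\<lambda>k. Y k - Y (Suc k)) sums (Y 0 - 0)"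
      proof (rule telescope_sums')
        show "Y \<longlonglongrightarrow> 0"
        proof (rule tendsto_norm_zero_cancel, rule tendsto_sandwich[of "\<lambda>_. 0"])
          show "(\<lambda>k. norm y * (1/2)^k) \<longlonglongrightarrow> 0"
            using tendsto_mult[OF tendsto_const LIMSEQ_realpow_zero[of "1/2::real"]] by auto
        qed (use nY in auto)
      qed
      ultimately show ?thesis
        by (simp add: YS Y0) (metis sums_unique2)
    qed
    moreover have "norm x \<le> 2 * K * norm y"
    proof -
      have "norm x \<le> (\<Sum>k. norm (g (Y k)))" unfolding x_def by (rule summable_norm[OF sn])
      also have "\<dots> \<le> (\<Sum>k. K * norm y * (1/2)^k)"
        using ng sn sums_summable[OF geo] by (intro suminf_le) auto
      finally show ?thesis using sums_unique[OF geo] by simp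
    qed
    ultimately show "\<exists>x\<in>X. f x = y \<and> norm x \<le> 2 * K * norm y" by blast
  qed
qed

text \<open>The map is linear everywhere but controlled only on the dense subspace E, as for
  operators prescribed on polynomials and continued arbitrarily; agreement with the extension is
  claimed on E only.\<close>

lemma extend_bounded_linear:
  fixes f :: "'a::real_normed_vector \<Rightarrow> 'b::banach"
  assumes f: "linear f" and E: "subspace E" "closure E = UNIV"
    and C: "\<And>x. x \<in> E \<Longrightarrow> norm (f x) \<le> C * norm x"
  obtains g where "bounded_linear g" "\<And>x. x \<in> E \<Longrightarrow> g x = f x" "\<And>x. norm (g x) \<le> C * norm x"
proof -
  interpret f: linear f by fact
  have "C-lipschitz_on E f" if "C \<ge> 0"
    using that E(1) C by (intro lipschitz_onI) (auto simp: dist_norm subspace_diff simp flip: f.diff)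
  moreover have "\<bar>C\<bar>-lipschitz_on E f"
    using E(1) by (intro lipschitz_onI)
      (auto simp: dist_norm simp flip: f.diff intro!: order_trans[OF C] mult_right_mono subspace_diff)
  ultimately have "uniformly_continuous_on E f"
    using lipschitz_on_uniformly_continuous by blast
  then obtain g where g: "uniformly_continuous_on (closure E) g" "\<And>x. x \<in> E \<Longrightarrow> f x = g x"
    by (rule uniformly_continuous_on_extension_on_closure) blast
  have cont: "isCont g x" for x
    using uniformly_continuous_imp_continuous[OF g(1)] E(2) by (simp add: continuous_on_eq_continuous_at)
  have seq: "\<exists>s. (\<forall>n. s n \<in> E) \<and> s \<longlonglongrightarrow> x" for x
    using E(2) closure_sequential[of x E] by auto
  have lim: "(\<lambda>n. f (s n)) \<longlonglongrightarrow> g x" if "\<And>n. s n \<in> E" "s \<longlonglongrightarrow> x" for s x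
    using isCont_tendsto_compose[OF cont that(2)] that(1) g(2) by simp
  have bd: "norm (g x) \<le> C * norm x" for x
  proof -
    obtain s where s: "\<And>n. s n \<in> E" "s \<longlonglongrightarrow> x" using seq by metis
    show ?thesis
      by (rule LIMSEQ_le[OF tendsto_norm[OF lim[OF s]] tendsto_mult[OF tendsto_const tendsto_norm[OF s(2)]]])
        (use C s in auto)
  qed
  have "bounded_linear g"
  proof (rule bounded_linear_intro[of _ C])
    show "g (x + y) = g x + g y" for x y
    proof -
      obtain s where s: "\<And>n. s n \<in> E" "s \<longlonglongrightarrow> x" using seq by metis
      obtain t where t: "\<And>n. t n \<in> E" "t \<longlonglongrightarrow> y" using seq by metis
      have "(\<lambda>n. f (s n + t n)) \<longlonglongrightarrow> g (x + y)"
        using s t E(1) by (intro lim tendsto_add) (auto intro: subspace_add)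
      moreover have "(\<lambda>n. f (s n + t n)) \<longlonglongrightarrow> g x + g y"
        unfolding f.add by (intro tendsto_add lim s t)
      ultimately show ?thesis by (rule LIMSEQ_unique)
    qed
    show "g (r *\<^sub>R x) = r *\<^sub>R g x" for r x
    proof -
      obtain s where s: "\<And>n. s n \<in> E" "s \<longlonglongrightarrow> x" using seq by metis
      have "(\<lambda>n. f (r *\<^sub>R s n)) \<longlonglongrightarrow> g (r *\<^sub>R x)"
        using s E(1) by (intro lim tendsto_intros) (auto intro: subspace_scale)
      moreover have "(\<lambda>n. f (r *\<^sub>R s n)) \<longlonglongrightarrow> r *\<^sub>R g x"
        unfolding f.scaleR by (intro tendsto_intros lim s)
      ultimately show ?thesis by (rule LIMSEQ_unique)
    qed
    show "norm (g x) \<le> norm x * C" for x using bd[of x] by (simp add: mult.commute)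
  qed
  with g(2) bd that show ?thesis by metis
qed

text \<open>Solving x - f x = y is a fixed point problem for the contraction x |-> y + f x, which
  takes the place of a Neumann series.\<close>

lemma bij_diff_small:
  fixes f :: "'a::banach \<Rightarrow> 'a"
  assumes "linear f" "\<And>x. norm (f x) \<le> c * norm x" "c < 1"
  shows "bij (\<lambda>x. x - f x)"
proof -
  interpret f: linear f by fact
  have "\<exists>!x. x - f x = y" for y
  proof -
    have "\<exists>!x. y + f x = x"
    \<comment> \<open>A contraction constant has to be nonnegative, which c itself need not
      be.\<close>
    proof (rule banach_fix_type[of "max 0 c"])
      show "\<forall>x x'. dist (y + f x) (y + f x') \<le> max 0 c * dist x x'"
      proof (intro allI)
        fix x x'
        have "norm (f (x - x')) \<le> c * norm (x - x')" by (rule assms)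
        also have "\<dots> \<le> max 0 c * norm (x - x')" by (intro mult_right_mono) auto
        finally show "dist (y + f x) (y + f x') \<le> max 0 c * dist x x'"
          by (simp add: dist_norm f.diff)
      qed
    qed (use assms in auto)
    moreover have "(y + f x = x) = (x - f x = y)" for x by (auto simp: algebra_simps)
    ultimately show ?thesis by simp
  qed
  then show ?thesis unfolding bij_iff by blast
qed

text \<open>Commutators are estimated only as forms on polynomials. Continuity carries such a bound
  first to all x and then to all y, after which y = T x gives the norm.\<close>

lemma norm_le_of_inner_le_dense:
  fixes T :: "'a::real_inner \<Rightarrow> 'b::real_inner"
  assumes T: "bounded_linear T" and "C \<ge> 0" and E: "closure E = UNIV" "closure E' = UNIV"
    and le: "\<And>x y. x \<in> E \<Longrightarrow> y \<in> E' \<Longrightarrow> T x \<bullet> y \<le> C * norm x * norm y"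
  shows "norm (T x) \<le> C * norm x"
proof -
  interpret T: bounded_linear T by fact
  have 1: "T x \<bullet> y \<le> C * norm x * norm y" if y: "y \<in> E'" for x y
  proof -
    have "closed {x. T x \<bullet> y \<le> C * norm x * norm y}"
      by (intro closed_Collect_le continuous_intros T.continuous_on)
    moreover have "E \<subseteq> {x. T x \<bullet> y \<le> C * norm x * norm y}" using le y by blast
    ultimately have "closure E \<subseteq> {x. T x \<bullet> y \<le> C * norm x * norm y}" by (rule closure_minimal[rotated])
    then show ?thesis using E by blast
  qed
  have "T x \<bullet> y \<le> C * norm x * norm y" for y
  proof -
    have "closed {y. T x \<bullet> y \<le> C * norm x * norm y}"
      by (intro closed_Collect_le continuous_intros)
    moreover have "E' \<subseteq> {y. T x \<bullet> y \<le> C * norm x * norm y}" using 1 by blast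
    ultimately have "closure E' \<subseteq> {y. T x \<bullet> y \<le> C * norm x * norm y}" by (rule closure_minimal[rotated])
    then show ?thesis using E by blast
  qed
  from this[of "T x"] have "norm (T x) * norm (T x) \<le> (C * norm x) * norm (T x)"
    by (simp add: power2_norm_eq_inner flip: power2_eq_square)
  then show ?thesis
    using \<open>C \<ge> 0\<close> by (cases "T x = 0") auto
qed

section \<open>Gaussian integrals of entire functions\<close>

lemma nn_integral_lborel_shift:
  fixes f :: "'a::euclidean_space \<Rightarrow> ennreal"
  assumes [measurable]: "f \<in> borel_measurable borel"
  shows "(\<integral>\<^sup>+x. f (x + c) \<partial>lborel) = (\<integral>\<^sup>+x. f x \<partial>lborel)"
proof -
  have "(\<integral>\<^sup>+x. f x \<partial>lborel) = (\<integral>\<^sup>+x. f x \<partial>distr lborel borel ((+) c))"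
    by (simp add: lborel_distr_plus)
  also have "\<dots> = (\<integral>\<^sup>+x. f (c + x) \<partial>lborel)"
    by (subst nn_integral_distr) auto
  finally show ?thesis by (simp add: add.commute)
qed

text \<open>Haar-type uniqueness: convolving with the ball, which the isometry preserves, identifies
  the image measure with Lebesgue measure.\<close>

lemma nn_integral_lborel_isometry:
  fixes T :: "'a::euclidean_space \<Rightarrow> 'a" and f :: "'a \<Rightarrow> ennreal"
  assumes T: "orthogonal_transformation T" and f [measurable]: "f \<in> borel_measurable borel"
  shows "(\<integral>\<^sup>+x. f (T x) \<partial>lborel) = (\<integral>\<^sup>+x. f x \<partial>lborel)"
proof -
  have lin: "linear T" and nT: "norm (T x) = norm x" for x
    using T by (auto simp: orthogonal_transformation)
  then have "bounded_linear T" by (simp add: linear_conv_bounded_linear)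
  then have [measurable]: "T \<in> borel_measurable borel"
    by (intro borel_measurable_continuous_onI linear_continuous_on)
  obtain S where S: "T (S x) = x" for x
    using orthogonal_transformation_surj[OF T] by (metis surj_def)
  define g :: "'a \<Rightarrow> ennreal" where "g = indicator (ball 0 1)"
  have [measurable]: "g \<in> borel_measurable borel" unfolding g_def by (rule borel_measurable_indicator) simp
  have gT: "g (T y) = g y" for y by (simp add: g_def indicator_def nT)
  have g_minus: "g (a - b) = g (b - a)" for a b by (simp add: g_def indicator_def norm_minus_commute)
  define m where "m = (\<integral>\<^sup>+x. g x \<partial>lborel)"
  have m: "m \<noteq> 0" "m \<noteq> top"
  proof -
    have "m = emeasure lborel (ball 0 1 :: 'a set)" by (simp add: m_def g_def)
    moreover have "emeasure lborel (ball (0::'a) 1) \<noteq> 0"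
      using content_ball_pos[of 1 "0::'a"] by (auto simp: measure_def)
    ultimately show "m \<noteq> 0" "m \<noteq> top"
      using emeasure_lborel_ball_finite[of "0::'a" 1] by auto
  qed
  have "(\<integral>\<^sup>+x. f x \<partial>lborel) * m = (\<integral>\<^sup>+y. (\<integral>\<^sup>+x. f x * g y \<partial>lborel) \<partial>lborel)"
    by (simp add: m_def nn_integral_cmult nn_integral_multc)
  also have "\<dots> = (\<integral>\<^sup>+y. (\<integral>\<^sup>+x. f (x + T y) * g y \<partial>lborel) \<partial>lborel)"
    by (simp add: nn_integral_multc nn_integral_lborel_shift)
  also have "\<dots> = (\<integral>\<^sup>+x. (\<integral>\<^sup>+y. f (x + T y) * g y \<partial>lborel) \<partial>lborel)"
    by (rule lborel_pair.Fubini') measurable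
  also have "\<dots> = (\<integral>\<^sup>+x. (\<integral>\<^sup>+y. f (T y) * g (T y - x) \<partial>lborel) \<partial>lborel)"
  proof (rule nn_integral_cong)
    fix x
    have "(\<integral>\<^sup>+y. f (T y) * g (T y - x) \<partial>lborel) = (\<integral>\<^sup>+y. f (T (y + S x)) * g (T (y + S x) - x) \<partial>lborel)"
      by (rule nn_integral_lborel_shift[symmetric]) measurable
    also have "\<dots> = (\<integral>\<^sup>+y. f (x + T y) * g y \<partial>lborel)"
      by (simp add: linear_add[OF lin] S gT add.commute)
    finally show "(\<integral>\<^sup>+y. f (x + T y) * g y \<partial>lborel) = (\<integral>\<^sup>+y. f (T y) * g (T y - x) \<partial>lborel)" ..
  qed
  also have "\<dots> = (\<integral>\<^sup>+y. (\<integral>\<^sup>+x. f (T y) * g (T y - x) \<partial>lborel) \<partial>lborel)"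
    by (rule lborel_pair.Fubini') measurable
  also have "\<dots> = (\<integral>\<^sup>+y. f (T y) * m \<partial>lborel)"
  proof (rule nn_integral_cong)
    fix y
    have "(\<integral>\<^sup>+x. g (T y - x) \<partial>lborel) = (\<integral>\<^sup>+x. g (x + (- T y)) \<partial>lborel)"
      by (subst g_minus) simp
    also have "\<dots> = m" unfolding m_def by (rule nn_integral_lborel_shift) measurable
    finally show "(\<integral>\<^sup>+x. f (T y) * g (T y - x) \<partial>lborel) = f (T y) * m"
      by (simp add: nn_integral_cmult)
  qed
  also have "\<dots> = (\<integral>\<^sup>+y. f (T y) \<partial>lborel) * m"
    by (simp add: nn_integral_multc)
  finally show ?thesis
    using m by (metis ennreal_mult_cancel_left mult.commute)
qed

lemma orthogonal_transformation_unimodular: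
  fixes c :: complex
  assumes "norm c = 1"
  shows "orthogonal_transformation (\<lambda>z::complex^'n. c *s z)"
  unfolding orthogonal_transformation
proof
  show "linear (\<lambda>z::complex^'n. c *s z)"
    by (rule linearI) (auto simp: vec_eq_iff algebra_simps)
  show "\<forall>z::complex^'n. norm (c *s z) = norm z"
    using assms by (auto simp: norm_vec_def norm_mult)
qed

lemma measurable_scalar [measurable]:
  "(\<lambda>z::complex^'n. c *s z) \<in> borel_measurable borel"
proof (intro borel_measurable_continuous_onI linear_continuous_on)
  have "linear (\<lambda>z::complex^'n. c *s z)"
    by (rule linearI) (auto simp: vec_eq_iff algebra_simps)
  then show "bounded_linear (\<lambda>z::complex^'n. c *s z)"
    by (simp add: linear_conv_bounded_linear)
qed

lemma distr_gauss_unimodular: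
  fixes c :: complex
  assumes "norm c = 1"
  shows "distr gauss borel (\<lambda>z::complex^'n. c *s z) = gauss"
proof (rule measure_eqI)
  fix A assume "A \<in> sets (distr gauss borel (\<lambda>z::complex^'n. c *s z))"
  then have [measurable]: "A \<in> sets borel" by simp
  have d: "gauss_density (c *s z) = gauss_density z" for z :: "complex^'n"
    using orthogonal_transformation_unimodular[OF assms, where 'n = 'n]
    by (simp add: gauss_density_def orthogonal_transformation)
  have "emeasure (distr gauss borel (\<lambda>z. c *s z)) A = (\<integral>\<^sup>+z. indicator A z \<partial>distr gauss borel (\<lambda>z. c *s z))"
    by simp
  also have "\<dots> = (\<integral>\<^sup>+z. indicator A (c *s z) \<partial>gauss)"
    by (subst nn_integral_distr) auto
  also have "\<dots> = (\<integral>\<^sup>+z. ennreal (gauss_density (c *s z)) * indicator A (c *s z) \<partial>lborel)"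
    unfolding gauss_def d by (subst nn_integral_density) auto
  also have "\<dots> = (\<integral>\<^sup>+z. ennreal (gauss_density z) * indicator A z \<partial>lborel)"
    by (rule nn_integral_lborel_isometry[OF orthogonal_transformation_unimodular[OF assms]]) measurable
  also have "\<dots> = (\<integral>\<^sup>+z. indicator A z \<partial>gauss)"
    unfolding gauss_def by (subst nn_integral_density) auto
  finally show "emeasure (distr gauss borel (\<lambda>z. c *s z)) A = emeasure gauss A"
    by simp
qed simp

lemma nn_integral_exp_quadratic:
  "(\<integral>\<^sup>+z. ennreal (exp (- (norm z)\<^sup>2 / 4)) \<partial>(lborel :: 'a::euclidean_space measure)) < \<infinity>"
proof -
  have "ennreal (exp (- (norm z)\<^sup>2 / 4)) = (\<Prod>b\<in>Basis. ennreal (exp (- (z \<bullet> b)\<^sup>2 / 4)))" for z :: 'a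
  proof -
    have "(norm z)\<^sup>2 = (\<Sum>b\<in>Basis. (z \<bullet> b)\<^sup>2)"
      by (subst power2_norm_eq_inner, subst euclidean_inner) (simp add: power2_eq_square)
    then have "exp (- (norm z)\<^sup>2 / 4) = (\<Prod>b\<in>Basis. exp (- (z \<bullet> b)\<^sup>2 / 4))"
      by (simp add: sum_divide_distrib sum_negf flip: exp_sum)
    then show ?thesis by (simp add: prod_ennreal)
  qed
  then have "(\<integral>\<^sup>+z. ennreal (exp (- (norm z)\<^sup>2 / 4)) \<partial>(lborel :: 'a measure))
      = (\<Prod>b\<in>(Basis::'a set). (\<integral>\<^sup>+x. ennreal (exp (- x\<^sup>2 / 4)) \<partial>lborel))"
    by (simp only:) (subst nn_integral_lborel_prod, auto)
  also have "\<dots> < \<infinity>"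
  proof -
    \<comment> \<open>Variance 2 turns the normal density into a multiple of exp (-x^2/4); the
      moment of order 0 is the integral required.\<close>
    have "integrable lborel (\<lambda>x. normal_density 0 (sqrt 2) x * (x - 0) ^ 0)"
      by (rule integrable_normal_moment) simp
    then have "integrable lborel (\<lambda>x. sqrt (2 * pi * 2) * (normal_density 0 (sqrt 2) x))"
      by simp
    also have "(\<lambda>x. sqrt (2 * pi * 2) * (normal_density 0 (sqrt 2) x)) = (\<lambda>x. exp (- x\<^sup>2 / 4))"
      by (auto simp: normal_density_def)
    finally have "(\<integral>\<^sup>+x. ennreal (exp (- x\<^sup>2 / 4)) \<partial>lborel) < \<infinity>"
      by (subst (asm) integrable_iff_bounded) auto
    then show ?thesis by (simp add: power_eq_top_ennreal less_top[symmetric])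
  qed
  finally show ?thesis .
qed

lemma integrable_gauss_exp: "integrable gauss (\<lambda>z::complex^'n. exp (c * norm z))"
proof -
  have le: "gauss_density z * exp (c * norm z) \<le> exp (c\<^sup>2) * exp (- (norm z)\<^sup>2 / 4)" for z :: "complex^'n"
  proof -
    \<comment> \<open>Completing the square: half of the Gaussian exponent absorbs the linear
      term.\<close>
    have "(c - norm z / 2)\<^sup>2 \<ge> 0" by simp
    then have "- (norm z)\<^sup>2 / 2 + c * norm z \<le> c\<^sup>2 - (norm z)\<^sup>2 / 4"
      by (simp add: power2_eq_square algebra_simps)
    then have "exp (- (norm z)\<^sup>2 / 2) * exp (c * norm z) \<le> exp (c\<^sup>2) * exp (- (norm z)\<^sup>2 / 4)"
      by (simp flip: exp_add)
    moreover have "exp (- (norm z)\<^sup>2 / 2) / (2 * pi) ^ CARD('n) \<le> exp (- (norm z)\<^sup>2 / 2)"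
    proof -
      have "1 \<le> (2 * pi) ^ CARD('n)" using pi_ge_two by (intro one_le_power) auto
      then show ?thesis by (simp add: divide_le_eq mult_left_le)
    qed
    then have "gauss_density z * exp (c * norm z) \<le> exp (- (norm z)\<^sup>2 / 2) * exp (c * norm z)"
      unfolding gauss_density_def by (intro mult_right_mono) auto
    ultimately show ?thesis by linarith
  qed
  have i: "integrable lborel (\<lambda>z::complex^'n. exp (- (norm z)\<^sup>2 / 4))"
    using nn_integral_exp_quadratic[where 'a = "complex^'n"] by (subst integrable_iff_bounded) auto
  have "integrable lborel (\<lambda>z::complex^'n. gauss_density z * exp (c * norm z))"
  proof (rule Bochner_Integration.integrable_bound[OF integrable_mult_right[OF i, of "exp (c\<^sup>2)"]])
    show "AE z::complex^'n in lborel. norm (gauss_density z * exp (c * norm z))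
        \<le> norm (exp (c\<^sup>2) * exp (- (norm z)\<^sup>2 / 4))"
    proof (intro AE_I2)
      fix z :: "complex^'n"
      show "norm (gauss_density z * exp (c * norm z)) \<le> norm (exp (c\<^sup>2) * exp (- (norm z)\<^sup>2 / 4))"
        using le[of z] less_imp_le[OF gauss_density_pos, of z] by (simp add: abs_mult)
    qed
  qed measurable
  then show ?thesis
    by (subst integrable_gauss) auto
qed

lemma finite_measure_gauss: "finite_measure (gauss :: (complex^'n) measure)"
proof -
  have "integrable gauss (\<lambda>z::complex^'n. exp (0 * norm z))" by (rule integrable_gauss_exp)
  then have "integrable gauss (\<lambda>z::complex^'n. 1 :: real)" by simp
  then show ?thesis
    by (intro finite_measureI) (auto simp: integrable_iff_bounded top_unique)
qed

lemma space_gauss [simp]: "space gauss = UNIV"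
  by (simp add: gauss_def)

lemma measure_gauss_pos: "measure (gauss :: (complex^'n) measure) UNIV > 0"
proof -
  interpret finite_measure "gauss :: (complex^'n) measure" by (rule finite_measure_gauss)
  have "emeasure (gauss :: (complex^'n) measure) UNIV \<noteq> 0"
  proof
    assume "emeasure (gauss :: (complex^'n) measure) UNIV = 0"
    then have "(\<integral>\<^sup>+z. ennreal (gauss_density z) \<partial>(lborel :: (complex^'n) measure)) = 0"
      unfolding gauss_def by (subst (asm) emeasure_density) auto
    then have "AE z in (lborel :: (complex^'n) measure). ennreal (gauss_density z) = 0"
      by (subst (asm) nn_integral_0_iff_AE) auto
    then have "AE z in (lborel :: (complex^'n) measure). False"
      by (rule AE_mp) (intro AE_I2, metis ennreal_eq_0_iff gauss_density_pos not_le)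
    then have "emeasure (lborel :: (complex^'n) measure) UNIV = 0"
      by (subst (asm) AE_iff_measurable[of UNIV]) auto
    then show False by simp
  qed
  then have "measure (gauss :: (complex^'n) measure) UNIV \<noteq> 0"
    by (metis emeasure_eq_measure ennreal_0)
  then show ?thesis
    using measure_nonneg[of "gauss :: (complex^'n) measure" UNIV] by linarith
qed

section \<open>Mean value properties of entire functions\<close>

lemma entire_line:
  fixes f :: "complex^'n \<Rightarrow> complex"
  assumes "entire f"
  shows "(\<lambda>l. f (a + l *s h)) holomorphic_on S"
  unfolding holomorphic_on_def field_differentiable_def
proof (intro ballI)
  fix l
  obtain D where D: "(f has_derivative D) (at (a + l *s h))" "\<forall>c v. D (c *s v) = c * D v"
    using assms unfolding entire_def by metis
  have "bounded_linear (\<lambda>l::complex. l *s h)"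
    by (rule linear_conv_bounded_linear[THEN iffD1], rule linearI) (auto simp: vec_eq_iff algebra_simps)
  then have "((\<lambda>l. a + l *s h) has_derivative (\<lambda>l. l *s h)) (at l)"
    by (auto intro!: derivative_eq_intros bounded_linear_imp_has_derivative)
  from has_derivative_compose[OF this D(1)]
  have "((\<lambda>l. f (a + l *s h)) has_derivative (\<lambda>l. D (l *s h))) (at l)" .
  moreover have "(*) (D h) = (\<lambda>l. D (l *s h))"
    using D(2) by (auto simp: mult.commute)
  ultimately have "((\<lambda>l. f (a + l *s h)) has_field_derivative D h) (at l)"
    unfolding has_field_derivative_def by simp
  then show "\<exists>f'. ((\<lambda>l. f (a + l *s h)) has_field_derivative f') (at l within S)"
    using has_field_derivative_at_within by blast
qed

lemma entire_circle_mean: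
  fixes f :: "complex^'n \<Rightarrow> complex"
  assumes "entire f"
  shows "set_integrable lborel {0..2*pi} (\<lambda>t. f (cis t *s z))"
    and "(LINT t:{0..2*pi}|lborel. f (cis t *s z)) = 2 * pi * f 0"
proof -
  let ?g = "\<lambda>l. f (0 + l *s z)"
  have "continuous_on UNIV ?g"
    using entire_line[OF assms] by (rule holomorphic_on_imp_continuous_on)
  then have c: "continuous_on {0..2*pi} (\<lambda>t. f (cis t *s z))"
    using continuous_on_compose2[of UNIV ?g "{0..2*pi}" cis] continuous_on_cis[OF continuous_on_id] by simp
  then show si: "set_integrable lborel {0..2*pi} (\<lambda>t. f (cis t *s z))"
    by (rule borel_integrable_atLeastAtMost')
  have "((\<lambda>u. ?g u / (u - 0)) has_contour_integral (2 * of_real pi * \<i> * ?g 0)) (circlepath 0 1)"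
    by (rule Cauchy_integral_circlepath_simple[OF entire_line[OF assms]]) simp
  then have "((\<lambda>t. f (cis t *s z) / cis t * \<i> * cis t) has_integral (2 * of_real pi * \<i> * f 0)) {0..2*pi}"
    unfolding circlepath_def by (subst (asm) has_contour_integral_part_circlepath_iff) auto
  then have "((\<lambda>t. \<i> * f (cis t *s z)) has_integral (\<i> * (2 * of_real pi * f 0))) {0..2*pi}"
    by (simp add: mult_ac)
  from has_integral_mult_right[OF this, of "-\<i>"]
  have "((\<lambda>t. f (cis t *s z)) has_integral (2 * of_real pi * f 0)) {0..2*pi}"
    by (simp flip: mult.assoc)
  then show "(LINT t:{0..2*pi}|lborel. f (cis t *s z)) = 2 * pi * f 0"
    using set_borel_integral_eq_integral(2)[OF si] by (simp add: integral_unique)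
qed

text \<open>\<open>gauss\<close> is invariant under multiplication by unimodular numbers, so f may
  be replaced by its circle average, which is the constant f 0. This represents evaluation at 0 as
  an inner product with the constant 1 and is the source of all bounds on point evaluations.\<close>

lemma gauss_mean_value:
  fixes f :: "complex^'n \<Rightarrow> complex"
  assumes f: "entire f" "integrable gauss f"
  shows "(LINT z|gauss. f z) = f 0 * measure (gauss :: (complex^'n) measure) UNIV"
proof -
  interpret G: finite_measure "gauss :: (complex^'n) measure" by (rule finite_measure_gauss)
  interpret P: pair_sigma_finite lborel "gauss :: (complex^'n) measure" ..
  have [measurable]: "f \<in> borel_measurable borel" by (rule entire_borel[OF f(1)])
  have rot: "integrable gauss (\<lambda>z. h (cis t *s z))" "(LINT z|gauss. h (cis t *s z)) = (LINT z|gauss. h z)"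
    if h: "integrable gauss h" for h :: "complex^'n \<Rightarrow> 'c::{banach,second_countable_topology}" and t
  proof -
    have [measurable]: "h \<in> borel_measurable borel"
      using borel_measurable_integrable[OF h] by (simp cong: measurable_cong_sets)
    have "integrable (distr gauss borel ((*s) (cis t))) h"
      using h by (simp add: distr_gauss_unimodular)
    then show "integrable gauss (\<lambda>z. h (cis t *s z))"
      by (subst (asm) integrable_distr_eq) auto
    have "(LINT z|distr gauss borel ((*s) (cis t)). h z) = (LINT z|gauss. h (cis t *s z))"
      by (subst integral_distr) auto
    then show "(LINT z|gauss. h (cis t *s z)) = (LINT z|gauss. h z)"
      by (simp add: distr_gauss_unimodular)
  qed
  define F where "F t z = indicat_real {0..2*pi} t *\<^sub>R f (cis t *s z)" for t and z :: "complex^'n"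
  have cont: "continuous_on UNIV (\<lambda>x::real \<times> (complex^'n). cis (fst x) *s snd x)"
    unfolding vector_scalar_mult_def by (intro continuous_intros)
  have [measurable]: "(\<lambda>x::real \<times> (complex^'n). cis (fst x) *s snd x) \<in> borel_measurable (borel \<Otimes>\<^sub>M borel)"
    using borel_measurable_continuous_onI[OF cont] by (simp add: borel_prod)
  have Fm: "case_prod F \<in> borel_measurable (lborel \<Otimes>\<^sub>M gauss)"
    unfolding F_def case_prod_beta by measurable
  have "integrable (lborel \<Otimes>\<^sub>M gauss) (case_prod F)"
  proof (rule P.Fubini_integrable[OF Fm])
    have "(LINT z|gauss. norm (F t z)) = indicator {0..2*pi} t * (LINT z|gauss. norm (f z))" for t
      using rot(2)[OF integrable_norm[OF f(2)], of t] by (simp add: F_def)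
    then show "integrable lborel (\<lambda>t. LINT z|gauss. norm (case_prod F (t, z)))"
      by (simp add: integrable_mult_left)
    show "AE t in lborel. integrable gauss (\<lambda>z. case_prod F (t, z))"
      using rot(1)[OF f(2)] by (intro AE_I2) (simp add: F_def)
  qed
  from P.Fubini_integral[OF this]
  have "(LINT z|gauss. LINT t|lborel. F t z) = (LINT t|lborel. LINT z|gauss. F t z)" .
  moreover have "(LINT t|lborel. F t z) = 2 * pi * f 0" for z
    using entire_circle_mean(2)[OF f(1), of z] by (simp add: F_def set_lebesgue_integral_def)
  moreover have "(LINT z|gauss. F t z) = indicator {0..2*pi} t *\<^sub>R (LINT z|gauss. f z)" for t
    using rot(2)[OF f(2), of t] by (simp add: F_def)
  ultimately have "measure (gauss :: (complex^'n) measure) UNIV *\<^sub>R (2 * pi * f 0) = (2 * pi) *\<^sub>R (LINT z|gauss. f z)"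
    by (simp add: integral_const)
  then have "(2 * pi) * (LINT z|gauss. f z) = (2 * pi) * (f 0 * measure (gauss :: (complex^'n) measure) UNIV)"
    by (simp add: scaleR_conv_of_real mult_ac)
  then show ?thesis by simp
qed

section \<open>The Fock space\<close>

interpretation fock_ts: trace_space "(*\<^sub>C) :: complex \<Rightarrow> 'n::finite fock \<Rightarrow> 'n fock"
  by unfold_locales

text \<open>The projection theorem: a minimizing sequence for the distance from x to E is Cauchy by
  the parallelogram law, and x minus its limit is orthogonal to E. Density thus becomes a uniqueness
  statement.\<close>

lemma closure_subspace_eq_UNIV:
  fixes E :: "'a::{real_inner,banach} set"
  assumes E: "subspace E" and perp: "\<And>x. (\<And>p. p \<in> E \<Longrightarrow> x \<bullet> p = 0) \<Longrightarrow> x = 0"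
  shows "closure E = UNIV"
proof -
  have "x \<in> closure E" for x
  proof -
    have ne: "E \<noteq> {}" using subspace_0[OF E] by auto
    define d where "d = infdist x E"
    have d: "d \<le> norm (x - p)" if "p \<in> E" for p
      using infdist_le[OF that] by (simp add: d_def dist_norm)
    have "\<exists>p\<in>E. norm (x - p) < d + 1 / real (Suc n)" for n
    proof -
      have "infdist x E < d + 1 / real (Suc n)" by (simp add: d_def)
      moreover have "bdd_below (dist x ` E)" by (intro bdd_belowI2[of _ 0]) auto
      ultimately show ?thesis
        unfolding infdist_notempty[OF ne] using cINF_less_iff[OF ne] by (auto simp: dist_norm)
    qed
    then obtain p where p: "\<And>n. p n \<in> E" "\<And>n. norm (x - p n) < d + 1 / real (Suc n)"
      by metis
    have d0: "d \<ge> 0" by (simp add: d_def infdist_nonneg)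
    \<comment> \<open>Parallelogram law for x - p m and x - p n, whose average again has norm at
      least d.\<close>
    have par: "(norm (p m - p n))\<^sup>2 \<le> 2 * ((norm (x - p m))\<^sup>2 + (norm (x - p n))\<^sup>2) - 4 * d\<^sup>2" for m n
    proof -
      have "(1/2) *\<^sub>R (p m + p n) \<in> E" using p E by (auto intro: subspace_add subspace_scale)
      then have "d \<le> norm (x - (1/2) *\<^sub>R (p m + p n))" by (rule d)
      also have "x - (1/2) *\<^sub>R (p m + p n) = (1/2) *\<^sub>R ((x - p m) + (x - p n))"
        by (simp add: algebra_simps flip: scaleR_add_left)
      finally have "2 * d \<le> norm ((x - p m) + (x - p n))" by simp
      then have "(2 * d)\<^sup>2 \<le> (norm ((x - p m) + (x - p n)))\<^sup>2" using d0 by (intro power_mono) auto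
      moreover have "(norm (p m - p n))\<^sup>2 + (norm ((x - p m) + (x - p n)))\<^sup>2
          = 2 * ((norm (x - p m))\<^sup>2 + (norm (x - p n))\<^sup>2)"
        by (simp add: power2_norm_eq_inner algebra_simps inner_commute)
      ultimately show ?thesis by (simp add: power2_eq_square)
    qed
    have lim_d: "(\<lambda>n. norm (x - p n)) \<longlonglongrightarrow> d"
    proof (rule tendsto_sandwich[of "\<lambda>_. d"])
      show "(\<lambda>n. d + 1 / real (Suc n)) \<longlonglongrightarrow> d"
        using tendsto_add[OF tendsto_const LIMSEQ_inverse_real_of_nat, of d] by (simp add: field_simps)
    qed (use p d in \<open>auto intro!: always_eventually less_imp_le\<close>)
    have "Cauchy p"
    proof (rule metric_CauchyI)
      fix e :: real assume e: "e > 0"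
      have "(\<lambda>n. (norm (x - p n))\<^sup>2) \<longlonglongrightarrow> d\<^sup>2" by (intro tendsto_intros lim_d)
      moreover have "d\<^sup>2 < d\<^sup>2 + e\<^sup>2 / 4" using e by simp
      ultimately have "eventually (\<lambda>n. (norm (x - p n))\<^sup>2 < d\<^sup>2 + e\<^sup>2 / 4) sequentially"
        by (rule order_tendstoD(2))
      then obtain N where N: "\<And>n. n \<ge> N \<Longrightarrow> (norm (x - p n))\<^sup>2 < d\<^sup>2 + e\<^sup>2 / 4"
        by (auto simp: eventually_sequentially)
      have "dist (p m) (p n) < e" if "m \<ge> N" "n \<ge> N" for m n
      proof -
        have "A < F" if "A \<le> 2 * (B + C) - 4 * D" "B < D + F / 4" "C < D + F / 4" for A B C D F :: real
          using that by (simp add: field_simps)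
        from this[OF par N[OF that(1)] N[OF that(2)]] have "(norm (p m - p n))\<^sup>2 < e\<^sup>2" .
        then show ?thesis using e by (simp add: dist_norm power_less_imp_less_base)
      qed
      then show "\<exists>M. \<forall>m\<ge>M. \<forall>n\<ge>M. dist (p m) (p n) < e" by blast
    qed
    then obtain q where q: "p \<longlonglongrightarrow> q" using Cauchy_convergent convergent_def by blast
    have nq: "norm (x - q) = d"
      using tendsto_unique[OF _ tendsto_norm[OF tendsto_diff[OF tendsto_const q]] lim_d] by simp
    have "x - q = 0"
    proof (rule perp)
      fix r assume r: "r \<in> E"
      have le: "d \<le> norm (x - q - t *\<^sub>R r)" for t
      proof (rule LIMSEQ_le_const)
        show "(\<lambda>n. norm (x - (p n + t *\<^sub>R r))) \<longlonglongrightarrow> norm (x - q - t *\<^sub>R r)"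
          by (rule tendsto_eq_intros q refl | simp add: algebra_simps)+
        show "\<exists>N. \<forall>n\<ge>N. d \<le> norm (x - (p n + t *\<^sub>R r))"
          using d p E r by (auto intro: subspace_add subspace_scale)
      qed
      show "(x - q) \<bullet> r = 0"
      proof (rule ccontr)
        assume ne: "(x - q) \<bullet> r \<noteq> 0"
        then have r0: "r \<bullet> r > 0" by auto
        \<comment> \<open>The minimizer of the squared norm of x - q - t r, a quadratic polynomial
          in t.\<close>
        define t where "t = ((x - q) \<bullet> r) / (r \<bullet> r)"
        have "d\<^sup>2 \<le> (norm (x - q - t *\<^sub>R r))\<^sup>2" using le d0 by (intro power_mono) auto
        also have "\<dots> = d\<^sup>2 - 2 * t * ((x - q) \<bullet> r) + t\<^sup>2 * (r \<bullet> r)"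
        proof -
          have "(norm (y - t *\<^sub>R r))\<^sup>2 = (norm y)\<^sup>2 - 2 * t * (y \<bullet> r) + t\<^sup>2 * (r \<bullet> r)" for y
            unfolding power2_norm_eq_inner by (simp add: inner_commute power2_eq_square algebra_simps)
          then show ?thesis unfolding nq[symmetric] .
        qed
        also have "\<dots> = d\<^sup>2 - ((x - q) \<bullet> r)\<^sup>2 / (r \<bullet> r)"
          using r0 by (simp add: t_def field_simps power2_eq_square)
        finally have "((x - q) \<bullet> r)\<^sup>2 / (r \<bullet> r) \<le> 0" by simp
        then show False using ne r0 by (simp add: divide_le_0_iff)
      qed
    qed
    then have "q = x" by simp
    then show ?thesis
      using q p closure_sequential by blast
  qed
  then show ?thesis by blast
qed

subsection \<open>Weyl operators\<close>

lemma fock_eqI: "(\<And>z. fun_of f z = fun_of g z) \<Longrightarrow> f = g"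
  by (metis ext fun_of_inject)

lemma fun_of_sum: "fun_of (\<Sum>i\<in>I. f i) z = (\<Sum>i\<in>I. fun_of (f i) z)"
  by (induction I rule: infinite_finite_induct) (simp_all add: zero_fock.rep_eq plus_fock.rep_eq)

lemma fun_of_diff: "fun_of (f - g) z = fun_of f z - fun_of g z"
  unfolding minus_fock_def plus_fock.rep_eq uminus_fock.rep_eq by simp

lemma scaleR_eq_scaleC: "r *\<^sub>R f = complex_of_real r *\<^sub>C f"
  by (rule fock_eqI) (simp add: scaleR_fock.rep_eq fock_scale.rep_eq)

lemma fun_of_integrable: "integrable gauss (fun_of f)"
  using fock_fun_integrable[OF fock_fun_fun_of[of f], of "\<lambda>_. 1"]
  by (simp add: fock_fun_def entire_const finite_measure.integrable_const[OF finite_measure_gauss])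

lemma fun_of_borel [measurable]: "fun_of f \<in> borel_measurable borel"
  using fock_fun_fun_of[of f] by (auto simp: fock_fun_def entire_borel)

lemma kern_borel [measurable]: "kern z \<in> borel_measurable borel"
  using entire_kern by (rule entire_borel)

lemma fock_inner_scale: "fock_inner (c *\<^sub>C f) g = c * fock_inner f g"
  by (simp add: fock_inner_def fock_scale.rep_eq mult.assoc)

lemma norm_scaleC: "norm (c *\<^sub>C f) = cmod c * norm f"
  by (simp add: norm_fock_def fock_scale.rep_eq norm_mult power_mult_distrib real_sqrt_mult)

lemma inner_ii_scale: "(\<i> *\<^sub>C f) \<bullet> (\<i> *\<^sub>C g) = f \<bullet> g"
proof -
  have "\<i> * a * cnj (\<i> * b) = a * cnj b" for a b by (simp add: complex_eq_iff)
  then show ?thesis by (simp only: inner_fock_def fock_inner_def fock_scale.rep_eq)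
qed

lemma scale_i_i: "\<i> *\<^sub>C (\<i> *\<^sub>C f) = - f"
  by (rule fock_eqI) (simp add: fock_scale.rep_eq uminus_fock.rep_eq)

text \<open>The inner product at hand is real; skewness of multiplication by the imaginary unit is
  how complex orthogonality and adjoints are recovered from it.\<close>

lemma inner_i_scale: "(\<i> *\<^sub>C f) \<bullet> g = - (f \<bullet> (\<i> *\<^sub>C g))"
  using inner_ii_scale[of "\<i> *\<^sub>C f" g] by (simp add: scale_i_i)

lemma power2_norm_fock: "(norm f)\<^sup>2 = (LINT z|gauss. (cmod (fun_of f z))\<^sup>2)"
  by (simp add: norm_fock_def)

lemma power2_norm_fock_nn: "ennreal ((norm f)\<^sup>2) = (\<integral>\<^sup>+z. ennreal ((cmod (fun_of f z))\<^sup>2) \<partial>gauss)"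
  unfolding power2_norm_fock
  using fock_fun_fun_of[of f] by (intro nn_integral_eq_integral[symmetric]) (auto simp: fock_fun_def)

lemma weyl_add: "weyl z (f + g) = weyl z f + weyl z g"
  by (rule fock_eqI) (simp add: weyl.rep_eq plus_fock.rep_eq algebra_simps)

lemma weyl_scale: "weyl z (c *\<^sub>C f) = c *\<^sub>C weyl z f"
  by (rule fock_eqI) (simp add: weyl.rep_eq fock_scale.rep_eq algebra_simps)

lemma linear_weyl: "linear (weyl z)"
  by (rule linearI) (simp_all add: weyl_add weyl_scale scaleR_eq_scaleC)

lemma norm_weyl: "norm (weyl z f) = norm f"
proof -
  have d: "(\<integral>\<^sup>+w. ennreal (h w) \<partial>gauss) = (\<integral>\<^sup>+w. ennreal (gauss_density w * h w) \<partial>lborel)"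
    if [measurable]: "h \<in> borel_measurable borel" and "\<And>w. h w \<ge> 0" for h :: "complex^'n \<Rightarrow> real"
    unfolding gauss_def using less_imp_le[OF gauss_density_pos] that
    by (subst nn_integral_density) (auto intro!: nn_integral_cong ennreal_mult[symmetric])
  have "ennreal ((norm (weyl z f))\<^sup>2) = (\<integral>\<^sup>+w. ennreal (gauss_density w * (cmod (kern z w * fun_of f (w - z)))\<^sup>2) \<partial>lborel)"
    unfolding power2_norm_fock_nn by (subst d) (auto simp: weyl.rep_eq)
  also have "\<dots> = (\<integral>\<^sup>+w. ennreal (gauss_density (w + (- z)) * (cmod (fun_of f (w + (- z))))\<^sup>2) \<partial>lborel)"
    by (simp add: norm_mult power_mult_distrib mult_ac flip: norm_kern_density)
  also have "\<dots> = (\<integral>\<^sup>+w. ennreal (gauss_density w * (cmod (fun_of f w))\<^sup>2) \<partial>lborel)"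
    by (rule nn_integral_lborel_shift) measurable
  also have "\<dots> = ennreal ((norm f)\<^sup>2)"
    unfolding power2_norm_fock_nn by (subst d) auto
  finally show ?thesis by simp
qed

lemma inner_weyl_weyl: "weyl z f \<bullet> weyl z g = f \<bullet> g"
proof -
  have "norm (weyl z (f + g)) = norm (f + g)" by (rule norm_weyl)
  then have "(norm (weyl z f + weyl z g))\<^sup>2 = (norm (f + g))\<^sup>2" by (simp add: weyl_add)
  moreover have "(norm (x + y))\<^sup>2 = (norm x)\<^sup>2 + 2 * (x \<bullet> y) + (norm y)\<^sup>2" for x y :: "'a fock"
    by (simp add: power2_norm_eq_inner algebra_simps inner_commute)
  ultimately show ?thesis by (simp add: norm_weyl)
qed

text \<open>The cocycle of the Weyl relations: the real part of \<open>cdot z y\<close> is absorbed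
  by the norm of z + y, and the imaginary part survives as a phase.\<close>

lemma kern_mult:
  "kern z w * kern y (w - z) = exp (- \<i> * Im (cdot z y) / 2) * kern (z + y) w"
proof -
  have 1: "cdot (w - z) y = cdot w y - cdot z y" "cdot w (z + y) = cdot w z + cdot w y"
    by (simp_all add: cdot_def algebra_simps sum_subtractf sum.distrib)
  have "(norm (z + y))\<^sup>2 = (norm z)\<^sup>2 + 2 * Re (cdot z y) + (norm y)\<^sup>2"
    by (simp add: Re_cdot power2_norm_eq_inner algebra_simps inner_commute)
  then have 2: "complex_of_real ((norm (z + y))\<^sup>2) = of_real ((norm z)\<^sup>2) + 2 * of_real (Re (cdot z y)) + of_real ((norm y)\<^sup>2)"
    by (simp del: of_real_power)
  have 3: "cdot z y = of_real (Re (cdot z y)) + \<i> * of_real (Im (cdot z y))"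
    by (simp add: complex_eq_iff)
  have 4: "X / 2 - P / 4 + ((Y - (a + \<i> * b)) / 2 - Q / 4) = (- \<i> * b / 2) + ((X + Y) / 2 - (P + 2 * a + Q) / 4)"
    for X Y P Q a b :: complex by (simp add: field_simps)
  have "cdot w z / 2 - of_real ((norm z)\<^sup>2 / 4) + (cdot (w - z) y / 2 - of_real ((norm y)\<^sup>2 / 4))
     = (- \<i> * Im (cdot z y) / 2) + (cdot w (z + y) / 2 - of_real ((norm (z + y))\<^sup>2 / 4))"
    using 4[of "cdot w z" "of_real ((norm z)\<^sup>2)" "cdot w y" "of_real (Re (cdot z y))" "of_real (Im (cdot z y))"
        "of_real ((norm y)\<^sup>2)", folded 3]
    unfolding 1 of_real_divide 2 by (simp del: of_real_power)
  then show ?thesis unfolding kern_def by (simp flip: exp_add)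
qed

lemma weyl_weyl: "weyl z (weyl y f) = exp (- \<i> * Im (cdot z y) / 2) *\<^sub>C weyl (z + y) f"
  by (rule fock_eqI)
     (simp only: weyl.rep_eq fock_scale.rep_eq diff_diff_eq mult.assoc[symmetric] kern_mult)

lemma Im_cdot_self: "Im (cdot z z) = 0"
  by (simp add: cdot_def)

lemma weyl_0: "weyl 0 f = f"
  by (rule fock_eqI) (simp add: weyl.rep_eq kern_def cdot_def)

lemma cdot_minus: "cdot z (- y) = - cdot z y" "cdot (- z) y = - cdot z y"
  by (simp_all add: cdot_def sum_negf)

lemma weyl_minus: "weyl z (weyl (- z) f) = f" "weyl (- z) (weyl z f) = f"
  by (simp_all add: weyl_weyl weyl_0 cdot_minus Im_cdot_self)

lemma inner_weyl: "weyl z f \<bullet> g = f \<bullet> weyl (- z) g"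
  using inner_weyl_weyl[of z f "weyl (- z) g"] by (simp add: weyl_minus)

subsection \<open>Point evaluations and completeness\<close>

lift_definition fock_one :: "'n::finite fock" is "\<lambda>_. 1"
  by (simp add: fock_fun_def entire_const finite_measure.integrable_const[OF finite_measure_gauss])

abbreviation gmass :: "'n::finite itself \<Rightarrow> real" where
  "gmass _ \<equiv> measure (gauss :: (complex^'n) measure) UNIV"

lemma inner_one: "(f :: 'n::finite fock) \<bullet> fock_one = Re (fun_of f 0) * gmass TYPE('n)"
  using gauss_mean_value[OF _ fun_of_integrable, of f] fock_fun_fun_of[of f]
  by (simp add: inner_fock_def fock_inner_def fock_one.rep_eq fock_fun_def)

text \<open>Evaluation at 0 is bounded by \<open>inner_one\<close>, and \<open>weyl (- z)\<close>
  moves z to the origin isometrically, at the price of the factor exp (|z|^2/4).\<close>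

lemma eval_bound:
  obtains C where "C > 0" "\<And>(f :: 'n::finite fock) z. cmod (fun_of f z) \<le> C * exp ((norm z)\<^sup>2 / 4) * norm f"
proof -
  let ?m = "gmass TYPE('n)"
  have m: "?m > 0" by (rule measure_gauss_pos)
  \<comment> \<open>The factor 2 covers real and imaginary part; the summand 1 makes C strictly
    positive at once.\<close>
  define C where "C = 2 * norm (fock_one :: 'n fock) / ?m + 1"
  have C: "C > 0" using m by (simp add: C_def add_nonneg_pos)
  have Re0: "\<bar>Re (fun_of f 0)\<bar> \<le> norm (fock_one :: 'n fock) / ?m * norm f" for f :: "'n fock"
    using Cauchy_Schwarz_ineq2[of f fock_one] m by (simp add: inner_one abs_mult field_simps)
  have at0: "cmod (fun_of f 0) \<le> C * norm f" for f :: "'n fock"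
  proof -
    have "cmod (fun_of f 0) \<le> \<bar>Re (fun_of f 0)\<bar> + \<bar>Im (fun_of f 0)\<bar>" by (rule cmod_le)
    moreover have "\<bar>Im (fun_of f 0)\<bar> \<le> norm (fock_one :: 'n fock) / ?m * norm f"
      using Re0[of "\<i> *\<^sub>C f"] by (simp add: fock_scale.rep_eq norm_scaleC)
    ultimately have "cmod (fun_of f 0) \<le> 2 * norm (fock_one :: 'n fock) / ?m * norm f" using Re0[of f] by linarith
    also have "\<dots> \<le> C * norm f" by (intro mult_right_mono) (auto simp: C_def)
    finally show ?thesis .
  qed
  have "cmod (fun_of f z) \<le> C * exp ((norm z)\<^sup>2 / 4) * norm f" for f :: "'n fock" and z
  proof -
    have "fun_of (weyl (- z) f) 0 = exp (- of_real ((norm z)\<^sup>2 / 4)) * fun_of f z"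
      by (simp add: weyl.rep_eq kern_def cdot_def)
    then have "cmod (fun_of (weyl (- z) f) 0) = exp (- ((norm z)\<^sup>2 / 4)) * cmod (fun_of f z)"
      by (simp only: norm_mult norm_exp_eq_Re) (simp del: of_real_power)
    then have "cmod (fun_of f z) = exp ((norm z)\<^sup>2 / 4) * cmod (fun_of (weyl (- z) f) 0)"
      by (simp add: exp_minus)
    also have "\<dots> \<le> exp ((norm z)\<^sup>2 / 4) * (C * norm (weyl (- z) f))"
      by (intro mult_left_mono at0) auto
    finally show ?thesis by (simp add: norm_weyl mult_ac)
  qed
  with C that show ?thesis by blast
qed

text \<open>Cauchy's estimate on the unit disc of the complex line through z in the direction of
  h.\<close>

lemma entire_derivative_bound:
  fixes f :: "complex^'n \<Rightarrow> complex"
  assumes f: "entire f" and D: "(f has_derivative D) (at z)" "\<forall>c v. D (c *s v) = c * D v"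
    and B: "\<And>w. w \<in> cball z 1 \<Longrightarrow> cmod (f w) \<le> B"
  shows "cmod (D h) \<le> B * norm h"
proof (cases "h = 0")
  case True
  then show ?thesis using has_derivative_bounded_linear[OF D(1)] by (simp add: linear_simps)
next
  case False
  define u where "u = complex_of_real (1 / norm h) *s h"
  have scR: "complex_of_real r *s v = r *\<^sub>R v" for r :: real and v :: "complex^'n"
    by (simp add: vec_eq_iff) (simp add: scaleR_conv_of_real)
  have nu: "norm u = 1" unfolding u_def scR using False by simp
  let ?g = "\<lambda>l. f (z + l *s u)"
  have nl: "norm (l *s u) = cmod l" for l
  proof -
    have "norm (l *s u) = cmod l * norm u"
      by (simp add: norm_vec_def norm_mult L2_set_right_distrib)
    then show ?thesis using nu by simp
  qed
  have "norm ((deriv ^^ 1) ?g 0) \<le> fact 1 * B / 1 ^ 1"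
  proof (rule Cauchy_inequality)
    show "?g holomorphic_on ball 0 1" by (rule entire_line[OF f])
    show "continuous_on (cball 0 1) ?g" by (rule holomorphic_on_imp_continuous_on[OF entire_line[OF f]])
    show "norm (?g x) \<le> B" if "norm (0 - x) = 1" for x
      using that nl by (intro B) (simp add: dist_norm)
  qed auto
  moreover have "deriv ?g 0 = D u"
  proof -
    have "bounded_linear (\<lambda>l::complex. l *s u)"
      by (rule linear_conv_bounded_linear[THEN iffD1], rule linearI) (auto simp: vec_eq_iff algebra_simps)
    then have "((\<lambda>l. z + l *s u) has_derivative (\<lambda>l. l *s u)) (at 0)"
      by (auto intro!: derivative_eq_intros bounded_linear_imp_has_derivative)
    moreover have "(f has_derivative D) (at (z + 0 *s u))" using D(1) by simp
    ultimately have "(?g has_derivative (\<lambda>l. D (l *s u))) (at 0)" by (rule has_derivative_compose)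
    moreover have "(*) (D u) = (\<lambda>l. D (l *s u))" using D(2) by (auto simp: mult.commute)
    ultimately have "(?g has_field_derivative D u) (at 0)" unfolding has_field_derivative_def by simp
    then show ?thesis by (rule DERIV_imp_deriv)
  qed
  ultimately have "cmod (D u) \<le> B" by simp
  moreover have "D u = of_real (1 / norm h) * D h" unfolding u_def using D(2) by blast
  ultimately show ?thesis using False by (simp add: norm_divide field_simps)
qed

text \<open>Weierstrass' theorem in several variables: Cauchy estimates turn locally uniform
  convergence of the functions into that of their derivatives, and complex linearity passes to the
  limit.\<close>

lemma entire_limit:
  fixes F :: "nat \<Rightarrow> complex^'n \<Rightarrow> complex"
  assumes F: "\<And>n. entire (F n)"
    and C: "\<And>R e. e > 0 \<Longrightarrow> \<exists>N. \<forall>m\<ge>N. \<forall>n\<ge>N. \<forall>z\<in>cball 0 R. cmod (F m z - F n z) \<le> e"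
    and lim: "\<And>z. (\<lambda>n. F n z) \<longlonglongrightarrow> f z"
  shows "entire f"
proof -
  obtain D where D: "\<And>n z. (F n has_derivative D n z) (at z)" "\<And>n z c v. D n z (c *s v) = c * D n z v"
    using F unfolding entire_def by metis
  have diff: "cmod (D m z h - D n z h) \<le> e * norm h"
    if "\<forall>z\<in>cball 0 (R + 1). cmod (F m z - F n z) \<le> e" "z \<in> cball 0 R" for m n R e z h
  proof -
    have "entire (\<lambda>z. F m z - F n z)"
      using entire_add[OF F entire_mult[OF entire_const F], of m "-1" n] by simp
    moreover have "((\<lambda>z. F m z - F n z) has_derivative (\<lambda>h. D m z h - D n z h)) (at z)"
      by (intro has_derivative_diff D)
    moreover have "\<forall>c v. D m z (c *s v) - D n z (c *s v) = c * (D m z v - D n z v)"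
      by (simp add: D algebra_simps)
    moreover have "cmod (F m w - F n w) \<le> e" if "w \<in> cball z 1" for w
    proof -
      have "norm w \<le> norm z + norm (w - z)" by (metis norm_triangle_sub add.commute)
      then have "w \<in> cball 0 (R + 1)"
        using that \<open>z \<in> cball 0 R\<close> by (auto simp: dist_norm norm_minus_commute)
      then show ?thesis using \<open>\<forall>z\<in>cball 0 (R + 1). _\<close> by blast
    qed
    ultimately show ?thesis by (rule entire_derivative_bound)
  qed
  have cau: "Cauchy (\<lambda>n. D n z h)" for z h
  proof (rule metric_CauchyI)
    fix e :: real assume e: "e > 0"
    define e' where "e' = e / (norm h + 1) / 2"
    have e': "e' > 0" using e by (simp add: e'_def add_nonneg_pos)
    obtain N where N: "\<forall>m\<ge>N. \<forall>n\<ge>N. \<forall>z\<in>cball 0 (norm z + 1). cmod (F m z - F n z) \<le> e'"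
      using C[OF e'] by blast
    have "dist (D m z h) (D n z h) < e" if "m \<ge> N" "n \<ge> N" for m n
    proof -
      have "cmod (D m z h - D n z h) \<le> e' * norm h"
        using N that by (intro diff[of "norm z"]) auto
      also have "\<dots> \<le> e' * (norm h + 1)" using e' by simp
      also have "\<dots> = e / 2" using norm_ge_zero[of h] by (simp add: e'_def field_simps add_nonneg_eq_0_iff)
      also have "\<dots> < e" using e by simp
      finally show ?thesis by (simp add: dist_norm)
    qed
    then show "\<exists>M. \<forall>m\<ge>M. \<forall>n\<ge>M. dist (D m z h) (D n z h) < e" by blast
  qed
  define G where "G z h = lim (\<lambda>n. D n z h)" for z h
  have G: "(\<lambda>n. D n z h) \<longlonglongrightarrow> G z h" for z h
    using cau Cauchy_convergent convergent_LIMSEQ_iff unfolding G_def by blast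
  have "\<exists>E. (f has_derivative E) (at z) \<and> (\<forall>c v. E (c *s v) = c * E v)" for z
  proof (intro exI conjI allI)
    show "G z (c *s v) = c * G z v" for c v
    proof (rule LIMSEQ_unique[OF G])
      show "(\<lambda>n. D n z (c *s v)) \<longlonglongrightarrow> c * G z v"
        unfolding D by (intro tendsto_intros G)
    qed
    define S where "S = ball (0 :: complex^'n) (norm z + 1)"
    have zS: "z \<in> S" "open S" by (auto simp: S_def)
    have "\<exists>g. \<forall>x\<in>S. (\<lambda>n. F n x) \<longlonglongrightarrow> g x \<and> (g has_derivative G x) (at x within S)"
    proof (rule has_derivative_sequence)
      show "convex S" by (simp add: S_def)
      show "(F n has_derivative D n x) (at x within S)" for n x
        using D(1) has_derivative_at_withinI by blast
      show "\<forall>\<^sub>F n in sequentially. \<forall>x\<in>S. \<forall>h. cmod (D n x h - G x h) \<le> e * norm h" if e: "e > 0" for e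
      proof -
        \<comment> \<open>The radius of S already exceeds |z| by 1; the Cauchy estimate costs
          another unit.\<close>
        obtain N where N: "\<forall>m\<ge>N. \<forall>n\<ge>N. \<forall>x\<in>cball 0 (norm z + 1 + 1). cmod (F m x - F n x) \<le> e"
          using C[OF e] by blast
        have "cmod (D n x h - G x h) \<le> e * norm h" if "n \<ge> N" "x \<in> S" for n x h
        proof (rule LIMSEQ_le_const2)
          show "(\<lambda>m. cmod (D n x h - D m x h)) \<longlonglongrightarrow> cmod (D n x h - G x h)"
            by (intro tendsto_intros G)
          show "\<exists>M. \<forall>m\<ge>M. cmod (D n x h - D m x h) \<le> e * norm h"
            using N that by (intro exI[of _ N] allI impI diff[of "norm z + 1"]) (auto simp: S_def)
        qed
        then show ?thesis unfolding eventually_sequentially by blast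
      qed
      show "z \<in> S" by fact
      show "(\<lambda>n. F n z) \<longlonglongrightarrow> f z" by (rule lim)
    qed
    then obtain g where g: "\<And>x. x \<in> S \<Longrightarrow> (\<lambda>n. F n x) \<longlonglongrightarrow> g x"
      "\<And>x. x \<in> S \<Longrightarrow> (g has_derivative G x) (at x within S)" by blast
    have "g x = f x" if "x \<in> S" for x
      using g(1)[OF that] lim LIMSEQ_unique by blast
    moreover have "(g has_derivative G z) (at z)"
      using g(2)[OF zS(1)] at_within_open[OF zS] by simp
    ultimately show "(f has_derivative G z) (at z)"
      using has_derivative_transform_within_open[OF _ zS(2) zS(1)] by blast
  qed
  then show ?thesis unfolding entire_def by blast
qed

text \<open>By \<open>eval_bound\<close> a norm-Cauchy sequence is locally uniformly Cauchy, so it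
  has an entire pointwise limit; membership of the limit in the space and convergence in norm come
  from Fatou's lemma.\<close>

instance fock :: (finite) banach
proof
  fix X :: "nat \<Rightarrow> 'a fock"
  assume X: "Cauchy X"
  obtain C where C: "C > 0" "\<And>(f :: 'a fock) z. cmod (fun_of f z) \<le> C * exp ((norm z)\<^sup>2 / 4) * norm f"
    using eval_bound[where 'n = 'a] by blast
  have unif: "\<exists>N. \<forall>m\<ge>N. \<forall>n\<ge>N. \<forall>z\<in>cball 0 R. cmod (fun_of (X m) z - fun_of (X n) z) \<le> e"
    if e: "e > 0" for R e
  proof -
    define e' where "e' = e / (C * exp (R\<^sup>2 / 4))"
    have "e' > 0" using e C by (simp add: e'_def)
    then obtain N where N: "\<And>m n. m \<ge> N \<Longrightarrow> n \<ge> N \<Longrightarrow> norm (X m - X n) < e'"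
      using X unfolding Cauchy_def dist_norm by blast
    have "cmod (fun_of (X m) z - fun_of (X n) z) \<le> e" if "m \<ge> N" "n \<ge> N" "z \<in> cball 0 R" for m n z
    proof -
      have "cmod (fun_of (X m) z - fun_of (X n) z) \<le> C * exp ((norm z)\<^sup>2 / 4) * norm (X m - X n)"
        using C(2)[of "X m - X n" z] by (simp add: fun_of_diff)
      also have "\<dots> \<le> C * exp (R\<^sup>2 / 4) * e'"
        using that C(1) less_imp_le[OF N[OF that(1,2)]]
        by (intro mult_mono) (auto intro: power_mono)
      also have "\<dots> = e" using C by (simp add: e'_def)
      finally show ?thesis .
    qed
    then show ?thesis by blast
  qed
  have "Cauchy (\<lambda>n. fun_of (X n) z)" for z
  proof (rule metric_CauchyI)
    fix e :: real assume e: "e > 0"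
    obtain N where "\<forall>m\<ge>N. \<forall>n\<ge>N. \<forall>x\<in>cball 0 (norm z). cmod (fun_of (X m) x - fun_of (X n) x) \<le> e / 2"
      using unif[OF half_gt_zero[OF e]] by blast
    then have "\<forall>m\<ge>N. \<forall>n\<ge>N. cmod (fun_of (X m) z - fun_of (X n) z) \<le> e / 2" by auto
    then show "\<exists>M. \<forall>m\<ge>M. \<forall>n\<ge>M. dist (fun_of (X m) z) (fun_of (X n) z) < e"
      using e unfolding dist_norm by (intro exI[of _ N]) fastforce
  qed
  then have "convergent (\<lambda>n. fun_of (X n) z)" for z by (rule Cauchy_convergent)
  then obtain f where f: "\<And>z. (\<lambda>n. fun_of (X n) z) \<longlonglongrightarrow> f z" unfolding convergent_def by metis
  have entX: "entire (fun_of (X n))" for n using fock_fun_fun_of[of "X n"] by (simp add: fock_fun_def)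
  have ent: "entire f" by (rule entire_limit[OF entX unif f])
  have [measurable]: "f \<in> borel_measurable borel" by (rule entire_borel[OF ent])
  have key: "(\<integral>\<^sup>+z. ennreal ((cmod (fun_of (X n) z - f z))\<^sup>2) \<partial>gauss) \<le> ennreal (e\<^sup>2)"
    if N: "\<And>m. m \<ge> N \<Longrightarrow> norm (X n - X m) \<le> e" for n N e
  proof -
    have "ennreal ((cmod (fun_of (X n) z - f z))\<^sup>2)
        = liminf (\<lambda>m. ennreal ((cmod (fun_of (X n) z - fun_of (X m) z))\<^sup>2))" for z
      by (rule lim_imp_Liminf[symmetric]) (auto intro!: tendsto_intros f)
    then have "(\<integral>\<^sup>+z. ennreal ((cmod (fun_of (X n) z - f z))\<^sup>2) \<partial>gauss)
        = (\<integral>\<^sup>+z. liminf (\<lambda>m. ennreal ((cmod (fun_of (X n) z - fun_of (X m) z))\<^sup>2)) \<partial>gauss)" by simp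
    also have "\<dots> \<le> liminf (\<lambda>m. \<integral>\<^sup>+z. ennreal ((cmod (fun_of (X n) z - fun_of (X m) z))\<^sup>2) \<partial>gauss)"
      by (rule nn_integral_liminf) measurable
    also have "\<dots> = liminf (\<lambda>m. ennreal ((norm (X n - X m))\<^sup>2))"
      by (simp add: power2_norm_fock_nn fun_of_diff)
    also have "\<dots> \<le> ennreal (e\<^sup>2)"
    proof (rule Liminf_le)
      show "\<forall>\<^sub>F m in sequentially. ennreal ((norm (X n - X m))\<^sup>2) \<le> ennreal (e\<^sup>2)"
        unfolding eventually_sequentially using N by (intro exI[of _ N]) (auto intro!: ennreal_leI power_mono)
    qed simp
    finally show ?thesis .
  qed
  have fockd: "fock_fun (\<lambda>z. fun_of (X n) z - f z)"
    if N: "\<And>m. m \<ge> N \<Longrightarrow> norm (X n - X m) \<le> e" for n N e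
    unfolding fock_fun_def
  proof
    show "entire (\<lambda>z. fun_of (X n) z - f z)"
      using entire_add[OF entX entire_mult[OF entire_const ent], of n "-1"] by simp
    show "integrable gauss (\<lambda>z. (cmod (fun_of (X n) z - f z))\<^sup>2)"
      unfolding integrable_iff_bounded
    proof
      show "(\<integral>\<^sup>+ z. ennreal (norm ((cmod (fun_of (X n) z - f z))\<^sup>2)) \<partial>gauss) < \<infinity>"
        using key[of N n e] N by (auto intro: le_less_trans)
    qed measurable
  qed
  obtain N1 where N1: "\<And>m n. m \<ge> N1 \<Longrightarrow> n \<ge> N1 \<Longrightarrow> norm (X m - X n) \<le> 1"
    using X unfolding Cauchy_def dist_norm by (meson less_imp_le zero_less_one)
  have "fock_fun (\<lambda>z. fun_of (X N1) z - f z)"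
    by (rule fockd[of N1 N1 1]) (simp add: N1)
  from fock_fun_add[OF fock_fun_fun_of[of "X N1"] fock_fun_scale[OF this, of "-1"]]
  have ff: "fock_fun f" by simp
  define L where "L = Fock f"
  have L: "fun_of L = f" by (simp add: L_def Fock_inverse ff)
  have "X \<longlonglongrightarrow> L"
  proof (rule metric_LIMSEQ_I)
    fix e :: real assume e: "e > 0"
    then obtain N where N: "\<And>m n. m \<ge> N \<Longrightarrow> n \<ge> N \<Longrightarrow> norm (X m - X n) < e / 2"
      using X unfolding Cauchy_def dist_norm by (meson half_gt_zero)
    have "dist (X n) L < e" if "n \<ge> N" for n
    proof -
      have "ennreal ((norm (X n - L))\<^sup>2) \<le> ennreal ((e / 2)\<^sup>2)"
        unfolding power2_norm_fock_nn fun_of_diff L using less_imp_le[OF N[OF that]] by (intro key[of N])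
      then have "(norm (X n - L))\<^sup>2 \<le> (e / 2)\<^sup>2" by simp
      then have "norm (X n - L) \<le> e / 2" by (rule power2_le_imp_le) (use e in simp)
      then show ?thesis using e by (simp add: dist_norm)
    qed
    then show "\<exists>no. \<forall>n\<ge>no. dist (X n) L < e" by blast
  qed
  then show "convergent X" unfolding convergent_def by blast
qed

subsection \<open>Monomials\<close>

lemma power_le_exp: "t \<ge> 0 \<Longrightarrow> t ^ k \<le> exp (real k * t)"
proof -
  assume "t \<ge> (0::real)"
  moreover have "t \<le> exp t" using exp_ge_add_one_self[of t] by linarith
  ultimately have "t ^ k \<le> exp t ^ k" by (intro power_mono) auto
  then show ?thesis by (simp add: exp_of_nat_mult)
qed

lemma fock_fun_exp_bound:
  assumes "entire f" "\<And>z. cmod (f z) \<le> K * exp (c * norm z)"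
  shows "fock_fun f"
  unfolding fock_fun_def
proof
  have [measurable]: "f \<in> borel_measurable borel" by (rule entire_borel[OF assms(1)])
  show "integrable gauss (\<lambda>z. (cmod (f z))\<^sup>2)"
  proof (rule integrable_dominated)
    show "integrable gauss (\<lambda>z::complex^'a. K\<^sup>2 * exp ((2 * c) * norm z))"
      by (rule integrable_mult_right) (rule integrable_gauss_exp)
    show "norm ((cmod (f z))\<^sup>2) \<le> K\<^sup>2 * exp (2 * c * norm z)" for z
    proof -
      have "(cmod (f z))\<^sup>2 \<le> (K * exp (c * norm z))\<^sup>2" using assms(2) by (intro power_mono) auto
      then show ?thesis by (simp add: power_mult_distrib mult_ac flip: exp_of_nat_mult)
    qed
  qed measurable
qed fact

lemma entire_prod: "(\<And>i. i \<in> I \<Longrightarrow> entire (f i)) \<Longrightarrow> entire (\<lambda>z. \<Prod>i\<in>I. f i z)"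
  by (induction I rule: infinite_finite_induct) (auto intro: entire_const entire_mult)

lemma entire_power: "entire f \<Longrightarrow> entire (\<lambda>z. f z ^ k)"
  by (induction k) (auto intro: entire_const entire_mult)

lemma entire_component: "entire (\<lambda>z. z $ i)"
  unfolding entire_def
  by (intro allI exI[of _ "\<lambda>h. h $ i"]) (auto intro!: bounded_linear_imp_has_derivative bounded_linear_vec_nth)

definition monom_fun :: "('n \<Rightarrow> nat) \<Rightarrow> complex^'n \<Rightarrow> complex" where
  "monom_fun \<alpha> z = (\<Prod>i\<in>UNIV. z $ i ^ \<alpha> i)"

lemma entire_monom_fun: "entire (monom_fun \<alpha>)"
  unfolding monom_fun_def by (intro entire_prod entire_power entire_component)

lemma cmod_monom_fun: "cmod (monom_fun \<alpha> z) \<le> norm z ^ (\<Sum>i\<in>UNIV. \<alpha> i)"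
proof -
  have "cmod (monom_fun \<alpha> z) = (\<Prod>i\<in>UNIV. cmod (z $ i) ^ \<alpha> i)"
    by (simp add: monom_fun_def prod_norm[symmetric] norm_power)
  also have "\<dots> \<le> (\<Prod>i\<in>UNIV. norm z ^ \<alpha> i)"
    by (intro prod_mono) (auto intro!: power_mono Finite_Cartesian_Product.norm_nth_le)
  finally show ?thesis by (simp add: power_sum)
qed

lift_definition monomial :: "('n::finite \<Rightarrow> nat) \<Rightarrow> 'n fock" is monom_fun
proof -
  fix \<alpha> :: "'n \<Rightarrow> nat"
  show "fock_fun (monom_fun \<alpha>)"
  proof (rule fock_fun_exp_bound[OF entire_monom_fun])
    show "cmod (monom_fun \<alpha> z) \<le> 1 * exp (real (\<Sum>i\<in>UNIV. \<alpha> i) * norm z)" for z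
      using order_trans[OF cmod_monom_fun power_le_exp] by simp
  qed
qed

definition polys :: "'n::finite fock set" where
  "polys = fock.span (range monomial)"

lemma subspace_polys: "fock.subspace polys" by (simp add: polys_def)

lemma real_subspace: "fock.subspace E \<Longrightarrow> subspace E"
  unfolding fock.subspace_def subspace_def by (simp add: scaleR_eq_scaleC)

lemma monom_fun_upd: "monom_fun (\<alpha>(i := Suc (\<alpha> i))) z = z $ i * monom_fun \<alpha> z"
  unfolding monom_fun_def
  by (subst (1 2) prod.remove[of UNIV i]) (auto intro!: prod.cong simp: mult.assoc)

text \<open>Up to constants these powers are the terms of the exponential series of the reproducing
  kernel at \<open>\<zeta>\<close>.\<close>

lemma polys_cdot_power:
  "\<exists>p\<in>(polys :: 'n::finite fock set). \<forall>w. fun_of p w = (cdot w \<zeta> / 2) ^ k"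
proof (induction k)
  case 0
  have "fun_of (monomial (\<lambda>_. 0)) w = 1" for w :: "complex^'n" by (simp add: monomial.rep_eq monom_fun_def)
  then show ?case by (auto simp: polys_def intro!: bexI[of _ "monomial (\<lambda>_. 0)"] fock.span_base)
next
  case (Suc k)
  have *: "\<exists>q\<in>polys. \<forall>w. fun_of q w = cdot w \<zeta> / 2 * fun_of p w" if "p \<in> polys" for p :: "'n fock"
    using that unfolding polys_def
  proof (induction rule: fock.span_induct_alt)
    case base
    then show ?case by (intro bexI[of _ 0]) (auto simp: zero_fock.rep_eq fock.span_zero)
  next
    case (step c x y)
    then obtain \<alpha> q where x: "x = monomial \<alpha>" and q: "q \<in> fock.span (range monomial)" "\<And>w. fun_of q w = cdot w \<zeta> / 2 * fun_of y w"
      by auto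
    let ?r = "\<Sum>i\<in>UNIV. (c * cnj (\<zeta> $ i) / 2) *\<^sub>C monomial (\<alpha>(i := Suc (\<alpha> i)))"
    have "fun_of ?r w = cdot w \<zeta> / 2 * (c * fun_of x w)" for w
      by (simp add: fun_of_sum fock_scale.rep_eq x monomial.rep_eq monom_fun_upd cdot_def sum_distrib_right sum_distrib_left
          sum_divide_distrib mult_ac)
    then have "\<forall>w. fun_of (?r + q) w = cdot w \<zeta> / 2 * fun_of (c *\<^sub>C x + y) w"
      by (simp add: plus_fock.rep_eq fock_scale.rep_eq q algebra_simps)
    moreover have "?r + q \<in> fock.span (range monomial)"
      by (intro fock.span_add fock.span_sum fock.span_scale q) (auto intro: fock.span_base)
    ultimately show ?case by blast
  qed
  from Suc obtain p where "p \<in> polys" "\<And>w. fun_of p w = (cdot w \<zeta> / 2) ^ k" by blast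
  with *[of p] show ?case by auto
qed

lemma cmod_cdot: "cmod (cdot w z) \<le> of_nat CARD('n) * (norm w * norm (z :: complex^'n))"
proof -
  have "cmod (cdot w z) \<le> (\<Sum>i\<in>UNIV. cmod (w $ i * cnj (z $ i)))"
    unfolding cdot_def by (rule norm_sum)
  also have "\<dots> \<le> (\<Sum>i\<in>(UNIV::'n set). norm w * norm z)"
    by (intro sum_mono) (auto simp: norm_mult intro!: mult_mono Finite_Cartesian_Product.norm_nth_le)
  finally show ?thesis by simp
qed

text \<open>A function orthogonal to all polynomials is orthogonal to the partial sums of each
  kernel function and, by dominated convergence, to \<open>weyl \<zeta> fock_one\<close>; this
  forces it to vanish at \<open>\<zeta>\<close>.\<close>

lemma polys_dense: "closure (polys :: 'n::finite fock set) = UNIV"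
proof (rule closure_subspace_eq_UNIV[OF real_subspace[OF subspace_polys]])
  fix f :: "'n fock" assume perp: "\<And>p. p \<in> polys \<Longrightarrow> f \<bullet> p = 0"
  \<comment> \<open>Real orthogonality to both p and i p amounts to complex orthogonality to
    p.\<close>
  have perp': "fock_inner f p = 0" if "p \<in> polys" for p
  proof -
    have "f \<bullet> (\<i> *\<^sub>C p) = 0" by (intro perp fock.subspace_scale[OF subspace_polys that])
    moreover have "f \<bullet> (\<i> *\<^sub>C p) = Im (fock_inner f p)"
    proof -
      have "f \<bullet> (\<i> *\<^sub>C p) = - ((\<i> *\<^sub>C f) \<bullet> p)" by (simp add: inner_i_scale)
      then show ?thesis by (simp add: inner_fock_def fock_inner_scale)
    qed
    ultimately show ?thesis using perp[OF that] by (simp add: inner_fock_def complex_eq_iff)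
  qed
  have "fun_of f \<zeta> = 0" for \<zeta>
  proof -
    define u where "u w = cdot w \<zeta> / 2" for w
    have [measurable]: "u \<in> borel_measurable borel"
    proof -
      have "bounded_linear u"
        unfolding u_def cdot_def by (intro bounded_linear_divide[THEN bounded_linear_compose]
          bounded_linear_sum bounded_linear_mult_left[THEN bounded_linear_compose] bounded_linear_vec_nth)
      then show ?thesis by (intro borel_measurable_continuous_onI linear_continuous_on)
    qed
    define c where "c = real CARD('n) * norm \<zeta>"
    have cu: "cmod (u w) \<le> c * norm w" for w
    proof -
      have "cmod (u w) \<le> cmod (cdot w \<zeta>)" by (simp add: u_def norm_divide)
      also have "\<dots> \<le> c * norm w" using cmod_cdot[of w \<zeta>] by (simp add: c_def mult_ac)
      finally show ?thesis .
    qed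
    have sumc: "(LINT w|gauss. fun_of f w * cnj (exp (u w))) = 0"
    proof (rule LIMSEQ_unique)
      let ?S = "\<lambda>N w. \<Sum>k<N. inverse (fact k) *\<^sub>R u w ^ k"
      show "(\<lambda>N. LINT w|gauss. fun_of f w * cnj (?S N w)) \<longlonglongrightarrow> (LINT w|gauss. fun_of f w * cnj (exp (u w)))"
      \<comment> \<open>The dominating function comes from a b \<le> a^2 + b^2 with a = |f w| and b
        = exp (c |w|), which bounds all partial sums.\<close>
      proof (rule integral_dominated_convergence[where w = "\<lambda>w. (cmod (fun_of f w))\<^sup>2 + exp (2 * c * norm w)"])
        show "integrable gauss (\<lambda>w. (cmod (fun_of f w))\<^sup>2 + exp (2 * c * norm w))"
          using fock_fun_fun_of[of f] by (intro Bochner_Integration.integrable_add integrable_gauss_exp) (simp add: fock_fun_def)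
        show "AE w in gauss. (\<lambda>N. fun_of f w * cnj (?S N w)) \<longlonglongrightarrow> fun_of f w * cnj (exp (u w))"
          using exp_converges[of "u w" for w] by (intro AE_I2 tendsto_intros) (simp add: sums_def)
        show "AE w in gauss. norm (fun_of f w * cnj (?S N w)) \<le> (cmod (fun_of f w))\<^sup>2 + exp (2 * c * norm w)" for N
        proof (intro AE_I2)
          fix w
          have "cmod (?S N w) \<le> (\<Sum>k<N. inverse (fact k) *\<^sub>R cmod (u w) ^ k)"
            by (rule order_trans[OF norm_sum]) (simp add: norm_power)
          also have "\<dots> \<le> exp (cmod (u w))"
            unfolding exp_def by (intro sum_le_suminf summable_exp_generic) auto
          also have "\<dots> \<le> exp (c * norm w)" using cu by simp
          finally have "cmod (?S N w) \<le> exp (c * norm w)" .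
          then have "cmod (fun_of f w) * cmod (?S N w) \<le> cmod (fun_of f w) * exp (c * norm w)"
            by (intro mult_left_mono) auto
          also have "\<dots> \<le> (cmod (fun_of f w))\<^sup>2 + (exp (c * norm w))\<^sup>2"
          proof -
            have "2 * cmod (fun_of f w) * exp (c * norm w) \<le> (cmod (fun_of f w))\<^sup>2 + (exp (c * norm w))\<^sup>2"
              by (rule sum_squares_bound)
            moreover have "0 \<le> cmod (fun_of f w) * exp (c * norm w)" by simp
            ultimately show ?thesis by linarith
          qed
          finally show "norm (fun_of f w * cnj (?S N w)) \<le> (cmod (fun_of f w))\<^sup>2 + exp (2 * c * norm w)"
            unfolding norm_mult complex_mod_cnj by (simp add: mult.assoc flip: exp_of_nat_mult)
        qed
      qed measurable
      have "(LINT w|gauss. fun_of f w * cnj (?S N w)) = 0" for N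
      proof -
        obtain p where p: "\<And>k. p k \<in> polys" "\<And>k w. fun_of (p k) w = u w ^ k"
          using polys_cdot_power[of \<zeta>] unfolding u_def by metis
        let ?q = "\<Sum>k<N. inverse (fact k) *\<^sub>R p k"
        have "?q \<in> polys" using p real_subspace[OF subspace_polys] by (intro subspace_sum subspace_scale) auto
        moreover have "fun_of ?q w = ?S N w" for w
          by (simp add: fun_of_sum scaleR_fock.rep_eq p scaleR_conv_of_real)
        ultimately show ?thesis using perp'[of ?q] by (simp add: fock_inner_def)
      qed
      then show "(\<lambda>N. LINT w|gauss. fun_of f w * cnj (?S N w)) \<longlonglongrightarrow> 0" by simp
    qed
    have 0: "fock_inner f (weyl \<zeta> fock_one) = 0"
      using sumc
      unfolding fock_inner_def weyl.rep_eq fock_one.rep_eq kern_def u_def exp_diff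
      by (simp add: exp_minus field_simps del: of_real_power)
    have "(weyl (- \<zeta>) f) \<bullet> fock_one = 0" "(weyl (- \<zeta>) (\<i> *\<^sub>C f)) \<bullet> fock_one = 0"
      using 0 inner_weyl[of "- \<zeta>" f fock_one] inner_weyl[of "- \<zeta>" "\<i> *\<^sub>C f" fock_one]
      by (simp_all add: inner_fock_def fock_inner_scale)
    then have "fun_of (weyl (- \<zeta>) f) 0 = 0"
      using measure_gauss_pos[where 'n = 'n]
      by (simp add: inner_one weyl_scale fock_scale.rep_eq complex_eq_iff)
    then show ?thesis by (simp add: weyl.rep_eq kern_def)
  qed
  then show "f = 0" by (intro fock_eqI) (simp add: zero_fock.rep_eq)
qed

section \<open>The generators of the Weyl operators\<close>

text \<open>Around points of the disc of radius 1/2, circles of radius 1/2 stay in the unit disc,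
  and Cauchy's inequality bounds the second derivative by 2! M / (1/2)^2 = 8 M. The restriction of t
  to [-1/2, 1/2] below originates here.\<close>

lemma taylor_bound:
  assumes g: "g holomorphic_on UNIV" and M: "\<And>s. cmod s \<le> 1 \<Longrightarrow> cmod (g s) \<le> M"
    and t: "cmod t \<le> 1/2"
  shows "cmod (g t - g 0 - t * deriv g 0) \<le> 8 * M * (cmod t)\<^sup>2"
proof -
  have "cmod ((deriv ^^ 0) g t - (\<Sum>i\<le>1. (deriv ^^ i) g 0 * (t - 0) ^ i / fact i))
      \<le> 8 * M * cmod (t - 0) ^ Suc 1 / fact 1"
  proof (rule complex_Taylor[where S = "cball 0 (1/2)"])
    show "((deriv ^^ i) g has_field_derivative (deriv ^^ Suc i) g x) (at x within cball 0 (1/2))" for i x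
      using holomorphic_higher_deriv[OF g, of i] by (auto intro: holomorphic_derivI has_field_derivative_at_within)
    show "cmod ((deriv ^^ Suc 1) g x) \<le> 8 * M" if "x \<in> cball 0 (1/2)" for x
    proof -
      have "cmod ((deriv ^^ 2) g x) \<le> fact 2 * M / (1/2) ^ 2"
      proof (rule Cauchy_inequality)
        show "g holomorphic_on ball x (1/2)" using g by (rule holomorphic_on_subset) simp
        show "continuous_on (cball x (1/2)) g"
          using holomorphic_on_imp_continuous_on[OF g] continuous_on_subset by blast
        show "cmod (g y) \<le> M" if "cmod (x - y) = 1/2" for y
        proof (rule M)
          have "cmod y \<le> cmod x + cmod (x - y)" using norm_triangle_ineq4[of x "x - y"] by simp
          then show "cmod y \<le> 1" using that \<open>x \<in> _\<close> by simp
        qed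
      qed simp
      then show ?thesis by (simp add: numeral_2_eq_2 field_simps)
    qed
  qed (use t in auto)
  then show ?thesis by (simp add: power2_eq_square algebra_simps)
qed

definition inc :: "'n \<Rightarrow> ('n \<Rightarrow> nat) \<Rightarrow> 'n \<Rightarrow> nat" where "inc j \<alpha> = \<alpha>(j := Suc (\<alpha> j))"
definition dec :: "'n \<Rightarrow> ('n \<Rightarrow> nat) \<Rightarrow> 'n \<Rightarrow> nat" where "dec j \<alpha> = \<alpha>(j := \<alpha> j - 1)"

lemma inc_dec [simp]: "inc j \<alpha> j = Suc (\<alpha> j)" "dec j \<alpha> j = \<alpha> j - 1"
    "i \<noteq> j \<Longrightarrow> inc j \<alpha> i = \<alpha> i" "i \<noteq> j \<Longrightarrow> dec j \<alpha> i = \<alpha> i" "dec j (inc j \<alpha>) = \<alpha>"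
  and inc_dec_same: "\<alpha> j > 0 \<Longrightarrow> inc j (dec j \<alpha>) = \<alpha>"
  by (auto simp: inc_def dec_def fun_eq_iff)

text \<open>The derivative at t = 0 of \<open>weyl\<close> along t c e_j: multiplication by cnj c
  z_j / 2 minus c times the j-th derivative. For \<open>\<alpha> j = 0\<close> the exponent
  \<open>dec j \<alpha>\<close> is a dummy with coefficient 0.\<close>

definition gen_mono :: "complex \<Rightarrow> 'n::finite \<Rightarrow> ('n \<Rightarrow> nat) \<Rightarrow> 'n fock" where
  "gen_mono c j \<alpha> = (cnj c / 2) *\<^sub>C monomial (inc j \<alpha>) - (c * of_nat (\<alpha> j)) *\<^sub>C monomial (dec j \<alpha>)"

lemma norm_fock_le:
  assumes "\<And>w. cmod (fun_of f w) \<le> r * exp (L * norm w)" "r \<ge> 0"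
  shows "norm (f :: 'n::finite fock) \<le> r * sqrt (LINT w|gauss. exp (2 * L * norm (w::complex^'n)))"
proof -
  have "(LINT w|gauss. (cmod (fun_of f w))\<^sup>2) \<le> (LINT w|gauss. r\<^sup>2 * exp (2 * L * norm (w::complex^'n)))"
  proof (rule integral_mono)
    show "integrable gauss (\<lambda>w. (cmod (fun_of f w))\<^sup>2)" using fock_fun_fun_of[of f] by (simp add: fock_fun_def)
    show "integrable gauss (\<lambda>w::complex^'n. r\<^sup>2 * exp (2 * L * norm w))" by (intro integrable_mult_right integrable_gauss_exp)
    show "(cmod (fun_of f w))\<^sup>2 \<le> r\<^sup>2 * exp (2 * L * norm w)" for w
    proof -
      have "(cmod (fun_of f w))\<^sup>2 \<le> (r * exp (L * norm w))\<^sup>2" using assms(1) by (intro power_mono) auto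
      then show ?thesis by (simp add: power_mult_distrib mult.assoc flip: exp_of_nat_mult)
    qed
  qed
  then have "(norm f)\<^sup>2 \<le> r\<^sup>2 * (LINT w|gauss. exp (2 * L * norm (w::complex^'n)))"
    by (simp add: power2_norm_fock)
  then have "norm f \<le> sqrt (r\<^sup>2 * (LINT w|gauss. exp (2 * L * norm (w::complex^'n))))"
    by (rule real_le_rsqrt)
  then show ?thesis using assms(2) by (simp add: real_sqrt_mult)
qed

text \<open>For fixed w the translated monomial extends to an entire function
  \<open>\<phi> w\<close> of a complex parameter s, bounded for |s| \<le> 1 by a constant times exp
  (L |w|). The one-variable Taylor bound then holds pointwise in w, and the exponential majorant is
  square integrable.\<close>

lemma weyl_mono_expansion:
  fixes c :: complex and j :: "'n::finite"
  obtains C where "\<And>t::real. \<bar>t\<bar> \<le> 1/2 \<Longrightarrow>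
    norm (weyl (t *\<^sub>R axis j c) (monomial \<alpha>) - monomial \<alpha> - t *\<^sub>R gen_mono c j \<alpha>) \<le> C * t\<^sup>2"
proof -
  define k where "k = \<alpha> j"
  define P where "P w = (\<Prod>i\<in>UNIV-{j}. w $ i ^ \<alpha> i)" for w :: "complex^'n"
  define b where "b = (cmod c)\<^sup>2 / 4"
  define \<phi> where "\<phi> w s = exp (s * (w $ j * cnj c / 2) - s\<^sup>2 * of_real b) * (w $ j - s * c) ^ k * P w"
    for w :: "complex^'n" and s :: complex
  define d where "d = real (\<Sum>i\<in>UNIV. \<alpha> i)"
  define L where "L = cmod c + 2 * d"
  define K where "K = exp b * exp (d * cmod c)"
  have mf: "monom_fun \<beta> w = w $ j ^ \<beta> j * P w" if "\<And>i. i \<noteq> j \<Longrightarrow> \<beta> i = \<alpha> i" for \<beta> w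
    unfolding monom_fun_def P_def by (subst prod.remove[of UNIV j]) (auto intro!: prod.cong simp: that)
  have W: "fun_of (weyl (t *\<^sub>R axis j c) (monomial \<alpha>)) w = \<phi> w (of_real t)" for t w
  proof -
    have comp: "(t *\<^sub>R axis j c) $ i = (if i = j then of_real t * c else 0)" for i
      by (simp add: axis_def) (simp add: scaleR_conv_of_real)
    have "cdot w (t *\<^sub>R axis j c) = (\<Sum>i\<in>UNIV. if i = j then of_real t * (w $ j * cnj c) else 0)"
      unfolding cdot_def comp by (intro sum.cong) auto
    then have 1: "cdot w (t *\<^sub>R axis j c) = of_real t * (w $ j * cnj c)" by simp
    have 2: "(norm (t *\<^sub>R axis j c))\<^sup>2 / 4 = t\<^sup>2 * b"
    proof -
      have "(\<Sum>i\<in>UNIV. (cmod (axis j c $ i))\<^sup>2) = (\<Sum>i\<in>UNIV. if i = j then (cmod c)\<^sup>2 else 0)"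
        by (intro sum.cong) (auto simp: axis_def)
      then have "norm (axis j c) = cmod c" by (simp add: norm_vec_def L2_set_def)
      then show ?thesis by (simp add: b_def power_mult_distrib)
    qed
    have "monom_fun \<alpha> (w - t *\<^sub>R axis j c) = (w $ j - of_real t * c) ^ k * P w"
      unfolding monom_fun_def P_def k_def
      by (subst prod.remove[of UNIV j]) (auto intro!: prod.cong simp: comp simp del: vector_scaleR_component)
    then show ?thesis
      unfolding weyl.rep_eq monomial.rep_eq kern_def 1 2 \<phi>_def by (simp add: mult.assoc)
  qed
  have \<phi>0: "\<phi> w 0 = fun_of (monomial \<alpha>) w" for w
    by (simp add: \<phi>_def monomial.rep_eq mf k_def)
  have hol: "\<phi> w holomorphic_on UNIV" for w unfolding \<phi>_def by (intro holomorphic_intros)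
  have d\<phi>: "deriv (\<phi> w) 0 = fun_of (gen_mono c j \<alpha>) w" for w
  proof -
    have "(\<phi> w has_field_derivative ((w $ j * cnj c / 2) * w $ j ^ k - of_nat k * c * w $ j ^ (k - 1)) * P w) (at 0)"
      unfolding \<phi>_def by (auto intro!: derivative_eq_intros simp: algebra_simps)
    moreover have "fun_of (gen_mono c j \<alpha>) w = ((w $ j * cnj c / 2) * w $ j ^ k - of_nat k * c * w $ j ^ (k - 1)) * P w"
      by (simp add: gen_mono_def fun_of_diff fock_scale.rep_eq monomial.rep_eq mf k_def algebra_simps)
    ultimately show ?thesis by (simp add: DERIV_imp_deriv)
  qed
  have bound: "cmod (\<phi> w s) \<le> K * exp (L * norm w)" if s: "cmod s \<le> 1" for w s
  proof -
    have wj: "cmod (w $ j) \<le> norm w" by (rule Finite_Cartesian_Product.norm_nth_le)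
    have b0: "b \<ge> 0" by (simp add: b_def)
    have "Re (s * (w $ j * cnj c / 2) - s\<^sup>2 * of_real b) \<le> cmod (s * (w $ j * cnj c / 2) - s\<^sup>2 * of_real b)"
      by (rule complex_Re_le_cmod)
    also have "\<dots> \<le> cmod (s * (w $ j * cnj c / 2)) + cmod (s\<^sup>2 * of_real b)" by (rule norm_triangle_ineq4)
    also have "\<dots> \<le> cmod c * norm w + b"
    proof (rule add_mono)
      have "cmod (s * (w $ j * cnj c / 2)) \<le> 1 * (norm w * cmod c)"
        unfolding norm_mult norm_divide using s wj
        by (intro mult_mono) (auto simp: field_simps intro!: mult_mono order_trans[OF _ mult_right_mono[OF wj]])
      then show "cmod (s * (w $ j * cnj c / 2)) \<le> cmod c * norm w" by (simp add: mult.commute)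
      show "cmod (s\<^sup>2 * of_real b) \<le> b"
        using s b0 by (simp add: norm_mult norm_power mult_left_le_one_le power_le_one)
    qed
    finally have e: "cmod (exp (s * (w $ j * cnj c / 2) - s\<^sup>2 * of_real b)) \<le> exp b * exp (cmod c * norm w)"
      by (simp add: norm_exp_eq_Re flip: exp_add)
    have kd: "real k \<le> d" and kd': "real (\<Sum>i\<in>UNIV-{j}. \<alpha> i) \<le> d"
      unfolding k_def d_def of_nat_le_iff by (auto intro!: member_le_sum sum_mono2)
    have "cmod ((w $ j - s * c) ^ k) \<le> (norm w + cmod c) ^ k"
      unfolding norm_power
    proof (rule power_mono)
      have "cmod (w $ j - s * c) \<le> cmod (w $ j) + cmod s * cmod c"
        using norm_triangle_ineq4[of "w $ j" "s * c"] by (simp add: norm_mult)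
      also have "\<dots> \<le> norm w + 1 * cmod c" using s wj by (intro add_mono mult_right_mono) auto
      finally show "cmod (w $ j - s * c) \<le> norm w + cmod c" by simp
    qed simp
    also have "\<dots> \<le> exp (real k * (norm w + cmod c))" by (rule power_le_exp) simp
    also have "\<dots> \<le> exp (d * (norm w + cmod c))" using kd by (auto intro!: mult_right_mono)
    finally have p: "cmod ((w $ j - s * c) ^ k) \<le> exp (d * norm w) * exp (d * cmod c)"
      by (simp add: distrib_left flip: exp_add)
    have "cmod (P w) = (\<Prod>i\<in>UNIV-{j}. cmod (w $ i) ^ \<alpha> i)"
      by (simp add: P_def prod_norm[symmetric] norm_power)
    also have "\<dots> \<le> (\<Prod>i\<in>UNIV-{j}. norm w ^ \<alpha> i)"
      by (intro prod_mono) (auto intro!: power_mono Finite_Cartesian_Product.norm_nth_le)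
    also have "\<dots> = norm w ^ (\<Sum>i\<in>UNIV-{j}. \<alpha> i)" by (simp add: power_sum)
    also have "\<dots> \<le> exp (real (\<Sum>i\<in>UNIV-{j}. \<alpha> i) * norm w)" by (rule power_le_exp) simp
    also have "\<dots> \<le> exp (d * norm w)" using kd' by (auto intro!: mult_right_mono simp del: of_nat_sum)
    finally have q: "cmod (P w) \<le> exp (d * norm w)" .
    have "cmod (\<phi> w s) \<le> (exp b * exp (cmod c * norm w)) * (exp (d * norm w) * exp (d * cmod c)) * exp (d * norm w)"
      unfolding \<phi>_def norm_mult by (intro mult_mono e p q) auto
    also have "\<dots> = K * exp (L * norm w)"
      by (simp add: K_def L_def algebra_simps flip: exp_add)
    finally show ?thesis .
  qed
  define C where "C = 8 * K * sqrt (LINT w|gauss. exp (2 * L * norm (w::complex^'n)))"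
  show ?thesis
  proof (rule that)
    fix t :: real assume t: "\<bar>t\<bar> \<le> 1/2"
    have "norm (weyl (t *\<^sub>R axis j c) (monomial \<alpha>) - monomial \<alpha> - t *\<^sub>R gen_mono c j \<alpha>)
        \<le> (8 * K * t\<^sup>2) * sqrt (LINT w|gauss. exp (2 * L * norm (w::complex^'n)))"
    proof (rule norm_fock_le)
      fix w
      have "fun_of (weyl (t *\<^sub>R axis j c) (monomial \<alpha>) - monomial \<alpha> - t *\<^sub>R gen_mono c j \<alpha>) w
          = \<phi> w (of_real t) - \<phi> w 0 - of_real t * deriv (\<phi> w) 0"
        by (simp add: fun_of_diff W \<phi>0 d\<phi> scaleR_fock.rep_eq)
      also have "cmod \<dots> \<le> 8 * (K * exp (L * norm w)) * (cmod (of_real t))\<^sup>2"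
        by (rule taylor_bound[OF hol bound]) (use t in auto)
      finally show "cmod (fun_of (weyl (t *\<^sub>R axis j c) (monomial \<alpha>) - monomial \<alpha> - t *\<^sub>R gen_mono c j \<alpha>) w)
          \<le> 8 * K * t\<^sup>2 * exp (L * norm w)" by (simp add: mult_ac)
    qed (simp add: K_def)
    then show "norm (weyl (t *\<^sub>R axis j c) (monomial \<alpha>) - monomial \<alpha> - t *\<^sub>R gen_mono c j \<alpha>) \<le> C * t\<^sup>2"
      by (simp add: C_def mult_ac)
  qed
qed

lemma inner_scale_right: "f \<bullet> (c *\<^sub>C g) = (cnj c *\<^sub>C f) \<bullet> g"
proof -
  have "c *\<^sub>C g = Re c *\<^sub>R g + Im c *\<^sub>R (\<i> *\<^sub>C g)" "cnj c *\<^sub>C f = Re c *\<^sub>R f - Im c *\<^sub>R (\<i> *\<^sub>C f)"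
    by (rule fock_eqI, simp add: fock_scale.rep_eq plus_fock.rep_eq fun_of_diff scaleR_fock.rep_eq complex_eq_iff)+
  then show ?thesis by (simp add: inner_add_right inner_diff_left inner_i_scale)
qed

text \<open>Dividing by t and letting t tend to 0 isolates the first-order coefficient; this stands
  in for differentiating inner products along Weyl operators.\<close>

lemma first_order_bound:
  fixes x B K :: real
  assumes "\<And>t. 0 < t \<Longrightarrow> t \<le> 1/2 \<Longrightarrow> \<bar>t * x\<bar> \<le> B * t + K * t\<^sup>2"
  shows "\<bar>x\<bar> \<le> B"
proof (rule field_le_epsilon)
  fix e :: real assume e: "e > 0"
  define t where "t = min (1/2) (e / (\<bar>K\<bar> + 1))"
  have t: "0 < t" "t \<le> 1/2" unfolding t_def using e by (simp, intro min.cobounded1)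
  have "t * \<bar>x\<bar> \<le> t * (B + K * t)"
    using assms[OF t] t by (simp add: abs_mult power2_eq_square algebra_simps)
  then have "\<bar>x\<bar> \<le> B + K * t" using t by simp
  moreover have "K * t \<le> (\<bar>K\<bar> + 1) * (e / (\<bar>K\<bar> + 1))"
    using t by (intro mult_mono) (auto simp: t_def)
  ultimately show "\<bar>x\<bar> \<le> B + e" by (simp split: if_splits)
qed

text \<open>The product rule for the inner product, with an explicit remainder of second
  order.\<close>

lemma form_expansion_bound:
  fixes p q wp wq gp gq :: "'a::real_inner"
  assumes "norm (wp - p - t *\<^sub>R gp) \<le> C * t\<^sup>2" "norm (wq - q - t *\<^sub>R gq) \<le> D * t\<^sup>2" "\<bar>t\<bar> \<le> 1"
    "C \<ge> 0" "D \<ge> 0"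
  shows "\<bar>wp \<bullet> wq - p \<bullet> q - t * (gp \<bullet> q + p \<bullet> gq)\<bar>
     \<le> (C * (norm q + norm gq + D) + (norm p + norm gp) * D + norm gp * norm gq) * t\<^sup>2"
proof -
  define r where "r = wp - p - t *\<^sub>R gp"
  define s where "s = wq - q - t *\<^sub>R gq"
  have w: "wp = p + t *\<^sub>R gp + r" "wq = q + t *\<^sub>R gq + s" by (simp_all add: r_def s_def)
  have t2: "t\<^sup>2 \<le> 1" using assms(3) by (simp add: abs_square_le_1)
  have rs: "norm r \<le> C * t\<^sup>2" "norm s \<le> D * t\<^sup>2" using assms by (simp_all add: r_def s_def)
  have nq: "norm (q + t *\<^sub>R gq + s) \<le> norm q + norm gq + D"
  proof -
    have "norm (q + t *\<^sub>R gq + s) \<le> norm q + \<bar>t\<bar> * norm gq + norm s"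
      by (intro order_trans[OF norm_triangle_ineq] add_mono norm_triangle_le) auto
    moreover have "\<bar>t\<bar> * norm gq \<le> 1 * norm gq" using assms(3) by (intro mult_right_mono) auto
    moreover have "D * t\<^sup>2 \<le> D * 1" using t2 assms by (intro mult_left_mono) auto
    ultimately show ?thesis using rs by linarith
  qed
  have np: "norm (p + t *\<^sub>R gp) \<le> norm p + norm gp"
  proof -
    have "norm (p + t *\<^sub>R gp) \<le> norm p + \<bar>t\<bar> * norm gp"
      by (intro norm_triangle_le) auto
    moreover have "\<bar>t\<bar> * norm gp \<le> 1 * norm gp" using assms(3) by (intro mult_right_mono) auto
    ultimately show ?thesis by linarith
  qed
  have "wp \<bullet> wq - p \<bullet> q - t * (gp \<bullet> q + p \<bullet> gq)
      = r \<bullet> (q + t *\<^sub>R gq + s) + (p + t *\<^sub>R gp) \<bullet> s + t\<^sup>2 * (gp \<bullet> gq)"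
    unfolding w by (simp add: algebra_simps power2_eq_square)
  also have "\<bar>\<dots>\<bar> \<le> norm r * norm (q + t *\<^sub>R gq + s) + norm (p + t *\<^sub>R gp) * norm s + t\<^sup>2 * (norm gp * norm gq)"
    by (intro order_trans[OF abs_triangle_ineq] add_mono Cauchy_Schwarz_ineq2)
       (auto simp: abs_mult intro!: mult_left_mono Cauchy_Schwarz_ineq2)
  also have "\<dots> \<le> (C * t\<^sup>2) * (norm q + norm gq + D) + (norm p + norm gp) * (D * t\<^sup>2) + t\<^sup>2 * (norm gp * norm gq)"
    using assms by (intro add_mono mult_mono rs nq np) auto
  finally show ?thesis by (simp add: algebra_simps)
qed

lemma expansion_coeff_nonneg:
  fixes F :: "real \<Rightarrow> 'a::real_normed_vector"
  assumes "\<And>t::real. \<bar>t\<bar> \<le> 1/2 \<Longrightarrow> norm (F t) \<le> C * t\<^sup>2"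
  shows "C \<ge> 0"
proof -
  have "norm (F (1/2)) \<le> C * (1/2)\<^sup>2" by (rule assms) simp
  then have "0 \<le> C * (1/2)\<^sup>2" using norm_ge_zero[of "F (1/2)"] by linarith
  then show ?thesis by (simp add: power2_eq_square)
qed

text \<open>Weyl operators preserve the inner product, so the first-order term of its expansion must
  vanish. The free scalar d lets the real identity carry the full complex one.\<close>

lemma gen_mono_skew:
  "gen_mono c j \<alpha> \<bullet> (d *\<^sub>C monomial \<beta>) + monomial \<alpha> \<bullet> (d *\<^sub>C gen_mono c j \<beta>) = 0"
proof -
  obtain C where C: "\<And>t. \<bar>t\<bar> \<le> 1/2 \<Longrightarrow> norm (weyl (t *\<^sub>R axis j c) (monomial \<alpha>) - monomial \<alpha> - t *\<^sub>R gen_mono c j \<alpha>) \<le> C * t\<^sup>2"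
    using weyl_mono_expansion by blast
  obtain D where D: "\<And>t. \<bar>t\<bar> \<le> 1/2 \<Longrightarrow> norm (weyl (t *\<^sub>R axis j c) (monomial \<beta>) - monomial \<beta> - t *\<^sub>R gen_mono c j \<beta>) \<le> D * t\<^sup>2"
    using weyl_mono_expansion by blast
  have D': "norm (weyl (t *\<^sub>R axis j c) (d *\<^sub>C monomial \<beta>) - d *\<^sub>C monomial \<beta> - t *\<^sub>R (d *\<^sub>C gen_mono c j \<beta>)) \<le> (cmod d * D) * t\<^sup>2"
    if "\<bar>t\<bar> \<le> 1/2" for t
  proof -
    have "weyl (t *\<^sub>R axis j c) (d *\<^sub>C monomial \<beta>) - d *\<^sub>C monomial \<beta> - t *\<^sub>R (d *\<^sub>C gen_mono c j \<beta>)
        = d *\<^sub>C (weyl (t *\<^sub>R axis j c) (monomial \<beta>) - monomial \<beta> - t *\<^sub>R gen_mono c j \<beta>)"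
      by (simp add: weyl_scale fock.scale_right_diff_distrib scaleR_eq_scaleC mult.commute)
    then show ?thesis
      using mult_left_mono[OF D[OF that], of "cmod d"] by (simp add: norm_scaleC mult.assoc)
  qed
  have "C \<ge> 0" "cmod d * D \<ge> 0" using expansion_coeff_nonneg[OF C] expansion_coeff_nonneg[OF D'] by auto
  let ?X = "gen_mono c j \<alpha> \<bullet> (d *\<^sub>C monomial \<beta>) + monomial \<alpha> \<bullet> (d *\<^sub>C gen_mono c j \<beta>)"
  obtain K where K: "\<And>t. 0 < t \<Longrightarrow> t \<le> 1/2 \<Longrightarrow> \<bar>t * ?X\<bar> \<le> 0 * t + K * t\<^sup>2"
  proof
    fix t :: real assume t: "0 < t" "t \<le> 1/2"
    then have a: "\<bar>t\<bar> \<le> 1/2" "\<bar>t\<bar> \<le> 1" by auto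
    from form_expansion_bound[OF C[OF a(1)] D'[OF a(1)] a(2) \<open>C \<ge> 0\<close> \<open>cmod d * D \<ge> 0\<close>]
    show "\<bar>t * ?X\<bar> \<le> 0 * t + (C * (norm (d *\<^sub>C monomial \<beta>) + norm (d *\<^sub>C gen_mono c j \<beta>) + cmod d * D)
       + (norm (monomial \<alpha>) + norm (gen_mono c j \<alpha>)) * (cmod d * D) + norm (gen_mono c j \<alpha>) * norm (d *\<^sub>C gen_mono c j \<beta>)) * t\<^sup>2"
      by (simp add: inner_weyl_weyl)
  qed
  from first_order_bound[of ?X 0 K, OF K] show ?thesis by simp
qed

lemma scaleC_scaleR: "d *\<^sub>C (r *\<^sub>R f) = r *\<^sub>R (d *\<^sub>C f)"
  by (simp add: scaleR_eq_scaleC mult.commute)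

text \<open>Skewness of the generators for c = 1 and c = i yields two linear relations; eliminating
  between them shows that 2 d/dz_j is adjoint to multiplication by z_j, without integration by
  parts.\<close>

lemma mono_adjoint:
  "monomial (inc j \<alpha>) \<bullet> (d *\<^sub>C monomial \<beta>) = 2 * real (\<beta> j) * (monomial \<alpha> \<bullet> (d *\<^sub>C monomial (dec j \<beta>)))"
proof -
  let ?X = "\<lambda>\<alpha>. monomial (inc j \<alpha>)" and ?Y = "\<lambda>\<alpha>. monomial (dec j \<alpha>)"
  have A: "gen_mono 1 j \<alpha> = (1/2) *\<^sub>R ?X \<alpha> - real (\<alpha> j) *\<^sub>R ?Y \<alpha>" for \<alpha>
    by (simp add: gen_mono_def scaleR_eq_scaleC)
  have B: "gen_mono \<i> j \<alpha> = - (\<i> *\<^sub>C ((1/2) *\<^sub>R ?X \<alpha> + real (\<alpha> j) *\<^sub>R ?Y \<alpha>))" for \<alpha>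
    by (rule fock_eqI)
       (simp add: gen_mono_def scaleR_fock.rep_eq fun_of_diff plus_fock.rep_eq fock_scale.rep_eq uminus_fock.rep_eq algebra_simps)
  have 1: "(1/2) * (?X \<alpha> \<bullet> (d *\<^sub>C monomial \<beta>)) - real (\<alpha> j) * (?Y \<alpha> \<bullet> (d *\<^sub>C monomial \<beta>))
     + ((1/2) * (monomial \<alpha> \<bullet> (d *\<^sub>C ?X \<beta>)) - real (\<beta> j) * (monomial \<alpha> \<bullet> (d *\<^sub>C ?Y \<beta>))) = 0"
    using gen_mono_skew[of 1 j \<alpha> d \<beta>] unfolding A
    by (simp add: inner_diff_left inner_diff_right fock.scale_right_diff_distrib scaleC_scaleR)
  have i2: "(\<i> *\<^sub>C f) \<bullet> ((\<i> * d) *\<^sub>C g) = f \<bullet> (d *\<^sub>C g)" for f g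
    using inner_ii_scale[of f "d *\<^sub>C g"] by simp
  have i3: "(\<i> * d) *\<^sub>C (- (\<i> *\<^sub>C g)) = d *\<^sub>C g" for g
  proof (rule fock_eqI)
    have "\<i> * d * - (\<i> * x) = d * x" for x by (simp add: complex_eq_iff algebra_simps)
    then show "fun_of ((\<i> * d) *\<^sub>C (- (\<i> *\<^sub>C g))) z = fun_of (d *\<^sub>C g) z" for z
      by (simp only: fock_scale.rep_eq uminus_fock.rep_eq)
  qed
  have 2: "- ((1/2) * (?X \<alpha> \<bullet> (d *\<^sub>C monomial \<beta>)) + real (\<alpha> j) * (?Y \<alpha> \<bullet> (d *\<^sub>C monomial \<beta>)))
     + ((1/2) * (monomial \<alpha> \<bullet> (d *\<^sub>C ?X \<beta>)) + real (\<beta> j) * (monomial \<alpha> \<bullet> (d *\<^sub>C ?Y \<beta>))) = 0"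
    using gen_mono_skew[of \<i> j \<alpha> "\<i> * d" \<beta>] unfolding B i3 inner_minus_left i2
    by (simp add: inner_add_left inner_add_right fock.scale_right_distrib scaleC_scaleR)
  from 1 2 show ?thesis by (simp add: algebra_simps)
qed

lemma mono_nonzero: "monomial \<alpha> \<noteq> 0"
proof
  assume "monomial \<alpha> = 0"
  then have "fun_of (monomial \<alpha>) (\<chi> i. 1) = 0" by (simp add: zero_fock.rep_eq)
  then show False by (simp add: monomial.rep_eq monom_fun_def)
qed

text \<open>Removing a factor z_j from the left or from the right by \<open>mono_adjoint\<close>
  leaves the same inner product with the different coefficients 2 \<open>\<beta> j\<close> and 2
  \<open>\<alpha> j\<close>, so no Gaussian integral has to be computed.\<close>

lemma mono_orthogonal:
  assumes "\<alpha> \<noteq> \<beta>" shows "monomial \<alpha> \<bullet> (d *\<^sub>C monomial \<beta>) = 0"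
proof -
  obtain j where j: "\<alpha> j \<noteq> \<beta> j" using assms by (auto simp: fun_eq_iff)
  let ?I = "monomial (dec j \<alpha>) \<bullet> (d *\<^sub>C monomial (dec j \<beta>))"
  have 1: "monomial \<alpha> \<bullet> (d *\<^sub>C monomial \<beta>) = 2 * real (\<beta> j) * ?I" if "\<alpha> j > 0"
    using mono_adjoint[of j "dec j \<alpha>" d \<beta>] that by (simp add: inc_dec_same)
  have 2: "monomial \<alpha> \<bullet> (d *\<^sub>C monomial \<beta>) = 2 * real (\<alpha> j) * ?I" if "\<beta> j > 0"
  proof -
    have "monomial \<alpha> \<bullet> (d *\<^sub>C monomial \<beta>) = monomial (inc j (dec j \<beta>)) \<bullet> (cnj d *\<^sub>C monomial \<alpha>)"
      using that by (simp add: inc_dec_same inner_scale_right[of _ d] inner_commute)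
    also have "\<dots> = 2 * real (\<alpha> j) * (monomial (dec j \<beta>) \<bullet> (cnj d *\<^sub>C monomial (dec j \<alpha>)))"
      by (rule mono_adjoint)
    also have "\<dots> = 2 * real (\<alpha> j) * ?I"
      by (simp add: inner_scale_right[of _ d] inner_commute)
    finally show ?thesis .
  qed
  show ?thesis
  proof (cases "\<alpha> j > 0 \<and> \<beta> j > 0")
    case True
    then have "real (\<alpha> j) * ?I = real (\<beta> j) * ?I" using 1 2 by simp
    then have "?I = 0" using j by simp
    then show ?thesis using 1 True by simp
  next
    case False
    then show ?thesis using 1 2 j by (metis bot_nat_0.not_eq_extremum mult_zero_left mult_zero_right of_nat_0)
  qed
qed

lemma inj_mono: "inj monomial"
proof (rule injI, rule ccontr)
  fix \<alpha> \<beta> assume "monomial \<alpha> = monomial \<beta>" "\<alpha> \<noteq> \<beta>"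
  then have "monomial \<alpha> \<bullet> (1 *\<^sub>C monomial \<alpha>) = 0" using mono_orthogonal by metis
  then show False using mono_nonzero[of \<alpha>] by simp
qed

lemma independent_mono: "fock.independent (range monomial)"
  unfolding fock.independent_explicit_module
proof (intro allI impI)
  fix T u v assume T: "finite T" "T \<subseteq> range monomial" "(\<Sum>v\<in>T. u v *\<^sub>C v) = 0" "v \<in> T"
  obtain \<beta> where v: "v = monomial \<beta>" using T by blast
  have "0 = (u v *\<^sub>C v) \<bullet> (\<Sum>x\<in>T. u x *\<^sub>C x)" using T by simp
  also have "\<dots> = (\<Sum>x\<in>T. (u v *\<^sub>C v) \<bullet> (u x *\<^sub>C x))" by (simp add: inner_sum_right)
  also have "\<dots> = (\<Sum>x\<in>T. if x = v then (u v *\<^sub>C v) \<bullet> (u v *\<^sub>C v) else 0)"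
  proof (intro sum.cong refl)
    fix x assume "x \<in> T"
    then obtain \<alpha> where x: "x = monomial \<alpha>" using T by blast
    have "(u v *\<^sub>C v) \<bullet> (u x *\<^sub>C x) = monomial \<beta> \<bullet> ((cnj (u v) * u x) *\<^sub>C monomial \<alpha>)"
      using inner_scale_right[of "monomial \<beta>" "cnj (u v)" "u x *\<^sub>C monomial \<alpha>"] by (simp add: v x)
    then show "(u v *\<^sub>C v) \<bullet> (u x *\<^sub>C x) = (if x = v then (u v *\<^sub>C v) \<bullet> (u v *\<^sub>C v) else 0)"
      using mono_orthogonal[of \<beta> \<alpha>] by (auto simp: v x)
  qed
  also have "\<dots> = (u v *\<^sub>C v) \<bullet> (u v *\<^sub>C v)" using T by simp
  finally have "u v *\<^sub>C v = 0" by simp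
  then show "u v = 0" using mono_nonzero[of \<beta>] by (simp add: v)
qed

subsection \<open>Linear maps on polynomials\<close>

interpretation fock_pair: vector_space_pair
  "(*\<^sub>C) :: complex \<Rightarrow> 'n::finite fock \<Rightarrow> 'n fock" "(*\<^sub>C) :: complex \<Rightarrow> 'n::finite fock \<Rightarrow> 'n fock"
  by unfold_locales

abbreviation clinear :: "('n::finite fock \<Rightarrow> 'n fock) \<Rightarrow> bool" where
  "clinear \<equiv> Vector_Spaces.linear (*\<^sub>C) (*\<^sub>C)"

text \<open>Outside the polynomials the values are junk determined by the choice of a Hamel basis.\<close>

definition lin_ext :: "(('n::finite \<Rightarrow> nat) \<Rightarrow> 'n fock) \<Rightarrow> 'n fock \<Rightarrow> 'n fock" where
  "lin_ext F = fock_pair.construct (range monomial) (\<lambda>m. F (inv monomial m))"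

lemma clinear_lin_ext: "clinear (lin_ext F)"
  unfolding lin_ext_def by (rule fock_pair.linear_construct[OF independent_mono])

lemma lin_ext_mono [simp]: "lin_ext F (monomial \<alpha>) = F \<alpha>"
  unfolding lin_ext_def by (subst fock_pair.construct_basis[OF independent_mono]) (auto simp: inj_mono)

lemma clinearD:
  assumes "clinear F"
  shows "F (x + y) = F x + F y" "F (c *\<^sub>C x) = c *\<^sub>C F x" "F (x - y) = F x - F y" "F 0 = 0"
    "F (- x) = - F x" "F (r *\<^sub>R x) = r *\<^sub>R F x"
proof -
  interpret Vector_Spaces.linear "(*\<^sub>C)" "(*\<^sub>C)" F by fact
  show "F (x + y) = F x + F y" "F (c *\<^sub>C x) = c *\<^sub>C F x" "F (x - y) = F x - F y" "F 0 = 0"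
    "F (- x) = - F x" by (rule add scale diff zero neg)+
  show "F (r *\<^sub>R x) = r *\<^sub>R F x" unfolding scaleR_eq_scaleC by (rule scale)
qed

lemma mono_in_polys [simp]: "monomial \<alpha> \<in> polys"
  by (auto simp: polys_def intro: fock.span_base)

lemma polys_induct [consumes 1, case_names zero step]:
  assumes "p \<in> polys" "Q 0" "\<And>c \<alpha> p. p \<in> polys \<Longrightarrow> Q p \<Longrightarrow> Q (c *\<^sub>C monomial \<alpha> + p)"
  shows "Q p"
proof -
  have "Q p \<and> p \<in> polys"
    using assms(1) unfolding polys_def
  proof (induction rule: fock.span_induct_alt)
    case (step c x y)
    then show ?case
      using assms(3) by (auto simp: polys_def intro!: fock.span_add fock.span_scale intro: fock.span_base)
  qed (auto simp: assms(2) fock.span_zero)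
  then show ?thesis ..
qed

lemma polys_closed [intro]:
  "0 \<in> polys" "p \<in> polys \<Longrightarrow> q \<in> polys \<Longrightarrow> p + q \<in> polys" "p \<in> polys \<Longrightarrow> q \<in> polys \<Longrightarrow> p - q \<in> polys"
  "p \<in> polys \<Longrightarrow> c *\<^sub>C p \<in> polys" "p \<in> polys \<Longrightarrow> r *\<^sub>R p \<in> polys" "p \<in> polys \<Longrightarrow> - p \<in> polys"
  by (auto simp: polys_def scaleR_eq_scaleC intro: fock.span_zero fock.span_add fock.span_diff fock.span_scale fock.span_neg)

lemma polys_sum [intro]: "(\<And>i. i \<in> I \<Longrightarrow> f i \<in> polys) \<Longrightarrow> (\<Sum>i\<in>I. f i) \<in> polys"
  by (auto simp: polys_def intro: fock.span_sum)

lemma polys_eqI: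
  assumes "clinear F" "clinear G" "\<And>\<alpha>. F (monomial \<alpha>) = G (monomial \<alpha>)" "p \<in> polys"
  shows "F p = G p"
  using assms(4) by (induction rule: polys_induct) (simp_all add: clinearD[OF assms(1)] clinearD[OF assms(2)] assms(3))

lemma polys_inner_eqI:
  assumes F: "clinear F" and G: "clinear G" and eq: "\<And>\<alpha> \<beta> d. F (monomial \<alpha>) \<bullet> (d *\<^sub>C monomial \<beta>) = monomial \<alpha> \<bullet> (d *\<^sub>C G (monomial \<beta>))"
    and p: "p \<in> polys" and q: "q \<in> polys"
  shows "F p \<bullet> q = p \<bullet> G q"
proof -
  have 1: "F (c *\<^sub>C monomial \<alpha>) \<bullet> q = (c *\<^sub>C monomial \<alpha>) \<bullet> G q" for c \<alpha>
    using q
  proof (induction rule: polys_induct)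
    case (step d \<beta> q)
    have "F (c *\<^sub>C monomial \<alpha>) \<bullet> (d *\<^sub>C monomial \<beta>) = (c *\<^sub>C monomial \<alpha>) \<bullet> (G (d *\<^sub>C monomial \<beta>))"
      using eq[of \<alpha> "cnj c * d" \<beta>] inner_scale_right[of "F (monomial \<alpha>)" "cnj c" "d *\<^sub>C monomial \<beta>"]
        inner_scale_right[of "monomial \<alpha>" "cnj c" "d *\<^sub>C G (monomial \<beta>)"]
      by (simp add: clinearD[OF F] clinearD[OF G])
    with step show ?case by (simp add: clinearD[OF G] inner_add_right)
  qed (simp add: clinearD[OF G])
  show ?thesis
    using p
  proof (induction rule: polys_induct)
    case (step c \<alpha> p)
    then show ?case by (simp only: clinearD(1)[OF F] inner_add_left 1)
  qed (simp add: clinearD[OF F])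
qed

lemma clinear_iff: "clinear F \<longleftrightarrow> (\<forall>x y. F (x + y) = F x + F y) \<and> (\<forall>c x. F (c *\<^sub>C x) = c *\<^sub>C F x)"
  by (rule fock_ts.linear_iff_scale)

lemma clinear_comp: "clinear F \<Longrightarrow> clinear G \<Longrightarrow> clinear (\<lambda>x. F (G x))"
  by (simp add: clinear_iff)

lemma clinear_add: "clinear F \<Longrightarrow> clinear G \<Longrightarrow> clinear (\<lambda>x. F x + G x)"
  by (simp add: clinear_iff fock.scale_right_distrib)

lemma clinear_scale: "clinear F \<Longrightarrow> clinear (\<lambda>x. c *\<^sub>C F x)"
  by (simp add: clinear_iff fock.scale_right_distrib mult.commute)

lemma clinear_id: "clinear (\<lambda>x. x)"
  by (simp add: clinear_iff)

section \<open>Ladder operators and Weyl generators on polynomials\<close>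

definition up :: "'n::finite \<Rightarrow> 'n fock \<Rightarrow> 'n fock" where "up j = lin_ext (\<lambda>\<alpha>. monomial (inc j \<alpha>))"
definition dn :: "'n::finite \<Rightarrow> 'n fock \<Rightarrow> 'n fock" where "dn j = lin_ext (\<lambda>\<alpha>. (2 * real (\<alpha> j)) *\<^sub>R monomial (dec j \<alpha>))"
definition diagop :: "(('n::finite \<Rightarrow> nat) \<Rightarrow> real) \<Rightarrow> 'n fock \<Rightarrow> 'n fock" where
  "diagop \<psi> = lin_ext (\<lambda>\<alpha>. \<psi> \<alpha> *\<^sub>R monomial \<alpha>)"

lemma up_dn_mono [simp]: "up j (monomial \<alpha>) = monomial (inc j \<alpha>)" "dn j (monomial \<alpha>) = (2 * real (\<alpha> j)) *\<^sub>R monomial (dec j \<alpha>)"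
  "diagop \<psi> (monomial \<alpha>) = \<psi> \<alpha> *\<^sub>R monomial \<alpha>"
  by (simp_all add: up_def dn_def diagop_def)

lemma clinear_ops: "clinear (up j)" "clinear (dn j)" "clinear (diagop \<psi>)"
  by (simp_all add: up_def dn_def diagop_def clinear_lin_ext)

lemma polys_ops_aux:
  assumes "clinear F" "\<And>\<alpha>. F (monomial \<alpha>) \<in> polys" "p \<in> polys"
  shows "F p \<in> polys"
  using assms(3) by (induction rule: polys_induct) (auto simp: clinearD[OF assms(1)] intro: assms(2))

lemma polys_ops [intro]: "p \<in> polys \<Longrightarrow> up j p \<in> polys" "p \<in> polys \<Longrightarrow> dn j p \<in> polys" "p \<in> polys \<Longrightarrow> diagop \<psi> p \<in> polys"
  using polys_ops_aux[OF clinear_ops(1)] polys_ops_aux[OF clinear_ops(2)] polys_ops_aux[OF clinear_ops(3)]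
  by (simp_all add: polys_closed)

lemma up_dn_adjoint:
  assumes "p \<in> polys" "q \<in> polys" shows "up j p \<bullet> q = p \<bullet> dn j q"
  by (rule polys_inner_eqI[OF clinear_ops(1,2) _ assms])
     (simp add: mono_adjoint scaleC_scaleR)

definition gen :: "complex \<Rightarrow> 'n::finite \<Rightarrow> 'n fock \<Rightarrow> 'n fock" where
  "gen c j p = (cnj c / 2) *\<^sub>C up j p - (c / 2) *\<^sub>C dn j p"

lemma clinear_diff: "clinear F \<Longrightarrow> clinear G \<Longrightarrow> clinear (\<lambda>x. F x - G x)"
  by (simp add: clinear_iff fock.scale_right_diff_distrib)

lemma clinear_gen: "clinear (gen c j)"
  using clinear_diff[OF clinear_scale[OF clinear_ops(1)] clinear_scale[OF clinear_ops(2)], of "cnj c / 2" j "c / 2" j]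
  by (simp add: gen_def[abs_def])

lemma gen_mono: "gen c j (monomial \<alpha>) = gen_mono c j \<alpha>"
  by (rule fock_eqI) (simp add: gen_def gen_mono_def fun_of_diff fock_scale.rep_eq scaleR_fock.rep_eq)

lemma weyl_expansion:
  assumes "p \<in> polys"
  obtains C where "C \<ge> 0" "\<And>t::real. \<bar>t\<bar> \<le> 1/2 \<Longrightarrow>
    norm (weyl (t *\<^sub>R axis j c) p - p - t *\<^sub>R gen c j p) \<le> C * t\<^sup>2"
proof -
  have "\<exists>C. \<forall>t::real. \<bar>t\<bar> \<le> 1/2 \<longrightarrow> norm (weyl (t *\<^sub>R axis j c) p - p - t *\<^sub>R gen c j p) \<le> C * t\<^sup>2"
    using assms
  proof (induction rule: polys_induct)
    case zero
    have "weyl z 0 = 0" for z :: "complex^'a" using linear_0[OF linear_weyl] .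
    then show ?case by (intro exI[of _ 0]) (simp add: clinearD[OF clinear_gen])
  next
    case (step d \<alpha> p)
    obtain C where C: "\<And>t. \<bar>t\<bar> \<le> 1/2 \<Longrightarrow> norm (weyl (t *\<^sub>R axis j c) p - p - t *\<^sub>R gen c j p) \<le> C * t\<^sup>2"
      using step by blast
    obtain D where D: "\<And>t. \<bar>t\<bar> \<le> 1/2 \<Longrightarrow> norm (weyl (t *\<^sub>R axis j c) (monomial \<alpha>) - monomial \<alpha> - t *\<^sub>R gen_mono c j \<alpha>) \<le> D * t\<^sup>2"
      using weyl_mono_expansion by blast
    show ?case
    proof (intro exI[of _ "cmod d * D + C"] allI impI)
      fix t :: real assume t: "\<bar>t\<bar> \<le> 1/2"
      have "weyl (t *\<^sub>R axis j c) (d *\<^sub>C monomial \<alpha> + p) - (d *\<^sub>C monomial \<alpha> + p) - t *\<^sub>R gen c j (d *\<^sub>C monomial \<alpha> + p)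
         = d *\<^sub>C (weyl (t *\<^sub>R axis j c) (monomial \<alpha>) - monomial \<alpha> - t *\<^sub>R gen_mono c j \<alpha>)
           + (weyl (t *\<^sub>R axis j c) p - p - t *\<^sub>R gen c j p)"
        by (simp add: weyl_add weyl_scale clinearD[OF clinear_gen] gen_mono fock.scale_right_diff_distrib
            scaleC_scaleR scaleR_add_right)
      then have "norm (weyl (t *\<^sub>R axis j c) (d *\<^sub>C monomial \<alpha> + p) - (d *\<^sub>C monomial \<alpha> + p) - t *\<^sub>R gen c j (d *\<^sub>C monomial \<alpha> + p))
         \<le> cmod d * norm (weyl (t *\<^sub>R axis j c) (monomial \<alpha>) - monomial \<alpha> - t *\<^sub>R gen_mono c j \<alpha>)
           + norm (weyl (t *\<^sub>R axis j c) p - p - t *\<^sub>R gen c j p)"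
        using norm_triangle_ineq by (metis norm_scaleC)
      also have "\<dots> \<le> cmod d * (D * t\<^sup>2) + C * t\<^sup>2"
        by (intro add_mono mult_left_mono C D t) auto
      finally show "norm (weyl (t *\<^sub>R axis j c) (d *\<^sub>C monomial \<alpha> + p) - (d *\<^sub>C monomial \<alpha> + p) - t *\<^sub>R gen c j (d *\<^sub>C monomial \<alpha> + p))
        \<le> (cmod d * D + C) * t\<^sup>2" by (simp add: algebra_simps)
    qed
  qed
  then obtain C where C: "\<And>t::real. \<bar>t\<bar> \<le> 1/2 \<Longrightarrow> norm (weyl (t *\<^sub>R axis j c) p - p - t *\<^sub>R gen c j p) \<le> C * t\<^sup>2"
    by blast
  have "C \<ge> 0" by (rule expansion_coeff_nonneg[OF C])
  with C that show ?thesis by blast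
qed

text \<open>Conjugation by the unitary \<open>weyl z\<close>, with its adjoint already written as
  \<open>weyl (- z)\<close>.\<close>

definition weyl_conj :: "complex^'n \<Rightarrow> ('n::finite fock \<Rightarrow> 'n fock) \<Rightarrow> 'n fock \<Rightarrow> 'n fock" where
  "weyl_conj z A x = weyl z (A (weyl (- z) x))"

text \<open>Moving the Weyl operator to the other side turns the increment of
  \<open>weyl z p \<bullet> A (weyl z q)\<close> into p against a conjugate of A minus A, so the
  Lipschitz bound limits its first-order coefficient. The commutator is stated as a form because A q
  need not be a polynomial.\<close>

lemma gen_commutator_bound:
  assumes A: "bounded_linear A"
    and Lip: "\<And>t x. norm (weyl_conj (t *\<^sub>R axis j c) A x - A x) \<le> L * \<bar>t\<bar> * norm x"
    and p: "p \<in> polys" and q: "q \<in> polys"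
  shows "\<bar>gen c j p \<bullet> A q + p \<bullet> A (gen c j q)\<bar> \<le> L * norm p * norm q"
proof -
  interpret A: bounded_linear A by fact
  obtain K where K: "K \<ge> 0" "\<And>x. norm (A x) \<le> norm x * K" using A.nonneg_bounded by blast
  obtain C where C: "C \<ge> 0" "\<And>t::real. \<bar>t\<bar> \<le> 1/2 \<Longrightarrow> norm (weyl (t *\<^sub>R axis j c) p - p - t *\<^sub>R gen c j p) \<le> C * t\<^sup>2"
    using weyl_expansion[OF p] by metis
  obtain D where D: "D \<ge> 0" "\<And>t::real. \<bar>t\<bar> \<le> 1/2 \<Longrightarrow> norm (weyl (t *\<^sub>R axis j c) q - q - t *\<^sub>R gen c j q) \<le> D * t\<^sup>2"
    using weyl_expansion[OF q] by metis
  have AD: "norm (A (weyl (t *\<^sub>R axis j c) q) - A q - t *\<^sub>R A (gen c j q)) \<le> (D * K) * t\<^sup>2" if "\<bar>t\<bar> \<le> 1/2" for t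
  proof -
    have "norm (A (weyl (t *\<^sub>R axis j c) q - q - t *\<^sub>R gen c j q)) \<le> norm (weyl (t *\<^sub>R axis j c) q - q - t *\<^sub>R gen c j q) * K"
      by (rule K)
    also have "\<dots> \<le> (D * t\<^sup>2) * K" by (intro mult_right_mono D that K)
    finally show ?thesis by (simp add: A.diff A.scaleR mult_ac)
  qed
  let ?X = "gen c j p \<bullet> A q + p \<bullet> A (gen c j q)"
  let ?M = "(C * (norm (A q) + norm (A (gen c j q)) + D * K) + (norm p + norm (gen c j p)) * (D * K)
     + norm (gen c j p) * norm (A (gen c j q)))"
  have "\<bar>t * ?X\<bar> \<le> (L * norm p * norm q) * t + ?M * t\<^sup>2" if t: "0 < t" "t \<le> 1/2" for t
  proof -
    have a: "\<bar>t\<bar> \<le> 1/2" "\<bar>t\<bar> \<le> 1" using t by auto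
    let ?z = "t *\<^sub>R axis j c"
    have "D * K \<ge> 0" using D K by simp
    from form_expansion_bound[OF C(2)[OF a(1)] AD[OF a(1)] a(2) C(1) this]
    have 1: "\<bar>weyl ?z p \<bullet> A (weyl ?z q) - p \<bullet> A q - t * ?X\<bar> \<le> ?M * t\<^sup>2" .
    have "weyl ?z p \<bullet> A (weyl ?z q) - p \<bullet> A q = p \<bullet> (weyl_conj ((- t) *\<^sub>R axis j c) A q - A q)"
      by (simp add: inner_weyl weyl_conj_def inner_diff_right)
    also have "\<bar>\<dots>\<bar> \<le> norm p * norm (weyl_conj ((- t) *\<^sub>R axis j c) A q - A q)"
      by (rule Cauchy_Schwarz_ineq2)
    also have "\<dots> \<le> norm p * (L * \<bar>- t\<bar> * norm q)" by (intro mult_left_mono Lip) auto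
    finally have "\<bar>weyl ?z p \<bullet> A (weyl ?z q) - p \<bullet> A q\<bar> \<le> (L * norm p * norm q) * t"
      using t by (simp add: mult_ac)
    with 1 show ?thesis by linarith
  qed
  then show ?thesis by (rule first_order_bound)
qed

text \<open>\<open>up\<close> and \<open>dn\<close> are i times the generator for c = i, plus or
  minus the generator for c = 1; the two bounds add up to the factor 2.\<close>

lemma up_dn_commutator_bound:
  assumes A: "bounded_linear A" "clinear A"
    and L1: "\<And>t x. norm (weyl_conj (t *\<^sub>R axis j 1) A x - A x) \<le> L * \<bar>t\<bar> * norm x"
    and Li: "\<And>t x. norm (weyl_conj (t *\<^sub>R axis j \<i>) A x - A x) \<le> L * \<bar>t\<bar> * norm x"
    and p: "p \<in> polys" and q: "q \<in> polys"
  shows "\<bar>up j p \<bullet> A q - p \<bullet> A (dn j q)\<bar> \<le> 2 * L * norm p * norm q"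
    and "\<bar>dn j p \<bullet> A q - p \<bullet> A (up j q)\<bar> \<le> 2 * L * norm p * norm q"
proof -
  have up: "up j p = gen 1 j p + \<i> *\<^sub>C gen \<i> j p" and dn: "dn j p = \<i> *\<^sub>C gen \<i> j p - gen 1 j p" for p :: "'a fock"
    by (rule fock_eqI, simp add: gen_def fun_of_diff fock_scale.rep_eq plus_fock.rep_eq field_simps)+
  have 1: "\<bar>gen 1 j p \<bullet> A q + p \<bullet> A (gen 1 j q)\<bar> \<le> L * norm p * norm q"
    by (rule gen_commutator_bound[OF A(1) L1 p q])
  have "\<i> *\<^sub>C q \<in> polys" using q by auto
  from gen_commutator_bound[OF A(1) Li p this]
  have 2: "\<bar>gen \<i> j p \<bullet> A (\<i> *\<^sub>C q) + p \<bullet> A (gen \<i> j (\<i> *\<^sub>C q))\<bar> \<le> L * norm p * norm q"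
    by (simp add: norm_scaleC)
  have e: "(\<i> *\<^sub>C gen \<i> j p) \<bullet> A q - p \<bullet> A (\<i> *\<^sub>C gen \<i> j q) = - (gen \<i> j p \<bullet> A (\<i> *\<^sub>C q) + p \<bullet> A (gen \<i> j (\<i> *\<^sub>C q)))"
    by (simp add: inner_i_scale clinearD[OF A(2)] clinearD[OF clinear_gen])
  have "up j p \<bullet> A q - p \<bullet> A (dn j q) = (gen 1 j p \<bullet> A q + p \<bullet> A (gen 1 j q))
      + ((\<i> *\<^sub>C gen \<i> j p) \<bullet> A q - p \<bullet> A (\<i> *\<^sub>C gen \<i> j q))"
    unfolding up dn by (simp add: clinearD(1,3)[OF A(2)] inner_add_left inner_diff_right)
  then show "\<bar>up j p \<bullet> A q - p \<bullet> A (dn j q)\<bar> \<le> 2 * L * norm p * norm q"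
    unfolding e using 1 2 by linarith
  have "dn j p \<bullet> A q - p \<bullet> A (up j q) = - (gen 1 j p \<bullet> A q + p \<bullet> A (gen 1 j q))
      + ((\<i> *\<^sub>C gen \<i> j p) \<bullet> A q - p \<bullet> A (\<i> *\<^sub>C gen \<i> j q))"
    unfolding up dn by (simp add: clinearD(1,3)[OF A(2)] inner_diff_left inner_add_right)
  then show "\<bar>dn j p \<bullet> A q - p \<bullet> A (up j q)\<bar> \<le> 2 * L * norm p * norm q"
    unfolding e using 1 2 by linarith
qed

subsection \<open>Diagonal operators\<close>

lemma diagop_diagop: "p \<in> polys \<Longrightarrow> diagop \<psi> (diagop \<xi> p) = diagop (\<lambda>\<alpha>. \<psi> \<alpha> * \<xi> \<alpha>) p"
  by (rule polys_eqI[OF clinear_comp[OF clinear_ops(3) clinear_ops(3)] clinear_ops(3)])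
     (simp_all add: clinearD[OF clinear_ops(3)] mult.commute)

lemma diagop_add: "p \<in> polys \<Longrightarrow> diagop \<psi> p + diagop \<xi> p = diagop (\<lambda>\<alpha>. \<psi> \<alpha> + \<xi> \<alpha>) p"
  by (rule polys_eqI[OF clinear_add[OF clinear_ops(3) clinear_ops(3)] clinear_ops(3)])
     (simp_all add: scaleR_add_left)

lemma diagop_const: "p \<in> polys \<Longrightarrow> diagop (\<lambda>_. r) p = r *\<^sub>R p"
  unfolding scaleR_eq_scaleC
  by (rule polys_eqI[OF clinear_ops(3) clinear_scale[OF clinear_id]]) (simp_all add: scaleR_eq_scaleC)

lemma diagop_symmetric:
  assumes "p \<in> polys" "q \<in> polys" shows "diagop \<psi> p \<bullet> q = p \<bullet> diagop \<psi> q"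
proof (rule polys_inner_eqI[OF clinear_ops(3) clinear_ops(3) _ assms])
  show "diagop \<psi> (monomial \<alpha>) \<bullet> (d *\<^sub>C monomial \<beta>) = monomial \<alpha> \<bullet> (d *\<^sub>C diagop \<psi> (monomial \<beta>))" for \<alpha> \<beta> d
    using mono_orthogonal[of \<alpha> \<beta> d] by (cases "\<alpha> = \<beta>") (auto simp: scaleC_scaleR)
qed

text \<open>The difference of the two forms is that of the square of a symmetric diagonal operator,
  with square roots taken entrywise.\<close>

lemma diagop_form_mono:
  assumes p: "p \<in> polys" and le: "\<And>\<alpha>. \<psi> \<alpha> \<le> \<xi> \<alpha>"
  shows "p \<bullet> diagop \<psi> p \<le> p \<bullet> diagop \<xi> p"
proof -
  let ?r = "\<lambda>\<alpha>. sqrt (\<xi> \<alpha> - \<psi> \<alpha>)"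
  have "p \<bullet> diagop \<xi> p = p \<bullet> diagop \<psi> p + p \<bullet> diagop (\<lambda>\<alpha>. ?r \<alpha> * ?r \<alpha>) p"
    using diagop_add[OF p, of \<psi> "\<lambda>\<alpha>. ?r \<alpha> * ?r \<alpha>"] le by (simp flip: inner_add_right)
  also have "p \<bullet> diagop (\<lambda>\<alpha>. ?r \<alpha> * ?r \<alpha>) p = diagop ?r p \<bullet> diagop ?r p"
    using diagop_symmetric[OF p polys_ops(3)[OF p]] diagop_diagop[OF p] by metis
  finally show ?thesis by simp
qed

section \<open>The amplified space and the Dirac operator\<close>

type_synonym 'n famp = "('n fock, 'n set) vec"

definition amp :: "('n::finite fock \<Rightarrow> 'n fock) \<Rightarrow> 'n famp \<Rightarrow> 'n famp" where
  "amp F x = (\<chi> S. F (x $ S))"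

definition polysK :: "'n::finite famp set" where
  "polysK = {x. \<forall>S. x $ S \<in> polys}"

text \<open>An arbitrary numbering of the coordinates, which serves only to fix signs.\<close>

definition idx :: "'n::finite \<Rightarrow> nat" where "idx = (SOME f. inj f)"

lemma inj_idx: "inj (idx :: 'n::finite \<Rightarrow> nat)"
proof -
  have "\<exists>f :: 'n \<Rightarrow> nat. inj f" using finite_imp_inj_to_nat_seg[of "UNIV :: 'n set"] by auto
  then show ?thesis unfolding idx_def by (rule someI_ex)
qed

definition flip :: "'n \<Rightarrow> 'n set \<Rightarrow> 'n set" where
  "flip j S = (if j \<in> S then S - {j} else insert j S)"

text \<open>The sign from moving e_j past the basis vectors of smaller number in the wedge product
  over S.\<close>

definition sg :: "'n::finite \<Rightarrow> 'n set \<Rightarrow> real" where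
  "sg j S = (-1) ^ card {i \<in> S. idx i < idx j}"

definition bop :: "'n::finite \<Rightarrow> bool \<Rightarrow> 'n fock \<Rightarrow> 'n fock" where
  "bop j b = (if b then up j else dn j)"

text \<open>The Koszul-type operator on the exterior algebra: the coordinates of \<open>x\<close> are indexed by the
  subsets of the index set, \<open>up\<close> is multiplication by a coordinate and \<open>dn\<close> twice the
  derivative, its adjoint. Being of odd degree, it exchanges even and odd functions.\<close>

definition dirac :: "'n::finite famp \<Rightarrow> 'n famp" where
  "dirac x = (\<chi> S. \<Sum>j\<in>UNIV. sg j S *\<^sub>R bop j (j \<in> S) (x $ flip j S))"

lemma flip_flip [simp]: "flip j (flip j S) = S"
  by (auto simp: flip_def)

lemma mem_flip [simp]: "j \<in> flip j S \<longleftrightarrow> j \<notin> S" "k \<noteq> j \<Longrightarrow> k \<in> flip j S \<longleftrightarrow> k \<in> S"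
  by (auto simp: flip_def)

lemma flip_commute: "flip j (flip k S) = flip k (flip j S)"
  by (auto simp: flip_def)

lemma bij_flip: "bij (flip j)"
  by (rule involuntory_imp_bij) simp

lemma sg_flip_same [simp]: "sg j (flip j S) = sg j S"
proof -
  have "{i \<in> flip j S. idx i < idx j} = {i \<in> S. idx i < idx j}"
    by (auto simp: flip_def split: if_splits)
  then show ?thesis by (simp add: sg_def)
qed

lemma sg_square [simp]: "sg j S * sg j S = 1"
  by (simp add: sg_def flip: power_add mult_2)

lemma abs_sg [simp]: "\<bar>sg j S\<bar> = 1"
  by (simp add: sg_def power_abs)

lemma sg_flip_less: "idx j < idx k \<Longrightarrow> sg k (flip j S) = - sg k S"
proof -
  assume jk: "idx j < idx k"
  define T where "T = {i \<in> S - {j}. idx i < idx k}"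
  have T: "finite T" "j \<notin> T" by (auto simp: T_def)
  show ?thesis
  proof (cases "j \<in> S")
    case True
    then have "{i \<in> S. idx i < idx k} = insert j T" "{i \<in> flip j S. idx i < idx k} = T"
      using jk by (auto simp: T_def flip_def)
    then show ?thesis using T by (simp add: sg_def)
  next
    case False
    then have "{i \<in> S. idx i < idx k} = T" "{i \<in> flip j S. idx i < idx k} = insert j T"
      using jk by (auto simp: T_def flip_def)
    then show ?thesis using T by (simp add: sg_def)
  qed
qed

lemma sg_flip_greater: "idx k < idx j \<Longrightarrow> sg k (flip j S) = sg k S"
proof -
  assume jk: "idx k < idx j"
  then have "{i \<in> flip j S. idx i < idx k} = {i \<in> S. idx i < idx k}"
    by (auto simp: flip_def)
  then show ?thesis by (simp add: sg_def)
qed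

text \<open>Flipping j changes the sign for k exactly when j precedes k, so just one of the two
  orders picks up a minus sign.\<close>

lemma sg_anticommute:
  assumes "j \<noteq> k" shows "sg j S * sg k (flip j S) = - (sg k S * sg j (flip k S))"
proof -
  have "idx j \<noteq> idx k" using assms inj_idx by (auto dest: injD)
  then show ?thesis
    by (cases "idx j < idx k") (auto simp: sg_flip_less sg_flip_greater not_less)
qed

lemma clinear_bop: "clinear (bop j b)"
  by (simp add: bop_def clinear_ops)

lemma polys_bop [intro]: "p \<in> polys \<Longrightarrow> bop j b p \<in> polys"
  by (auto simp: bop_def)

lemma inc_dec_commute: "j \<noteq> k \<Longrightarrow> inc j (inc k \<alpha>) = inc k (inc j \<alpha>)" "j \<noteq> k \<Longrightarrow> dec j (dec k \<alpha>) = dec k (dec j \<alpha>)"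
  "j \<noteq> k \<Longrightarrow> inc j (dec k \<alpha>) = dec k (inc j \<alpha>)"
  by (auto simp: inc_def dec_def fun_eq_iff)

lemma bop_commute:
  assumes "j \<noteq> k" "p \<in> polys" shows "bop j b (bop k b' p) = bop k b' (bop j b p)"
  by (rule polys_eqI[OF clinear_comp[OF clinear_bop clinear_bop] clinear_comp[OF clinear_bop clinear_bop] _ assms(2)])
     (use assms(1) in \<open>auto simp: bop_def clinearD[OF clinear_ops(1)] clinearD[OF clinear_ops(2)] inc_dec_commute mult.commute\<close>)

lemma bop_bop:
  assumes "p \<in> polys"
  shows "bop j b (bop j (\<not> b) p) = diagop (\<lambda>\<alpha>. 2 * real (\<alpha> j) + (if b then 0 else 2)) p"
  by (rule polys_eqI[OF clinear_comp[OF clinear_bop clinear_bop] clinear_ops(3) _ assms])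
     (auto simp: bop_def clinearD[OF clinear_ops(1)] clinearD[OF clinear_ops(2)] inc_dec_same algebra_simps)

lemma bop_adjoint: "p \<in> polys \<Longrightarrow> q \<in> polys \<Longrightarrow> bop j b p \<bullet> q = p \<bullet> bop j (\<not> b) q"
  using up_dn_adjoint[of p q j] up_dn_adjoint[of q p j] by (auto simp: bop_def inner_commute)

text \<open>Eigenvalues of the square of the Dirac operator.\<close>

definition lam :: "'n::finite set \<Rightarrow> ('n \<Rightarrow> nat) \<Rightarrow> real" where
  "lam S \<alpha> = (\<Sum>j\<in>UNIV. 2 * real (\<alpha> j) + (if j \<in> S then 0 else 2))"

definition diagK :: "('n::finite set \<Rightarrow> ('n \<Rightarrow> nat) \<Rightarrow> real) \<Rightarrow> 'n famp \<Rightarrow> 'n famp" where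
  "diagK \<Psi> x = (\<chi> S. diagop (\<Psi> S) (x $ S))"

abbreviation lamK :: "(real \<Rightarrow> real) \<Rightarrow> 'n::finite famp \<Rightarrow> 'n famp" where
  "lamK \<phi> \<equiv> diagK (\<lambda>S \<alpha>. \<phi> (lam S \<alpha>))"

lemma lam_nonneg: "lam S \<alpha> \<ge> 0"
  unfolding lam_def by (intro sum_nonneg) auto

lemma polysK_D: "x \<in> polysK \<Longrightarrow> x $ S \<in> polys"
  by (simp add: polysK_def)

lemma polysK_dirac [intro]: "x \<in> polysK \<Longrightarrow> dirac x \<in> polysK"
  unfolding polysK_def dirac_def by (auto intro!: polys_sum polys_closed(5) polys_bop)

lemma polysK_diagK [intro]: "x \<in> polysK \<Longrightarrow> diagK \<Psi> x \<in> polysK"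
  unfolding polysK_def diagK_def by auto

lemma subspace_polysK: "subspace polysK"
  unfolding subspace_def polysK_def by auto

lemma diagop_sum:
  assumes "p \<in> polys"
  shows "(\<Sum>i\<in>I. diagop (\<psi> i) p) = diagop (\<lambda>\<alpha>. \<Sum>i\<in>I. \<psi> i \<alpha>) p"
proof (induction I rule: infinite_finite_induct)
  case (insert i I)
  then show ?case using diagop_add[OF assms] by simp
qed (use diagop_const[OF assms, of 0] in simp_all)

text \<open>For distinct j and k the one-variable operators commute while the signs anticommute, so
  the mixed terms cancel in pairs. The diagonal terms have sign 1 and give number operators, shifted
  by 2 where the derivative acts last.\<close>

lemma dirac_dirac:
  assumes "x \<in> polysK" shows "dirac (dirac x) = lamK (\<lambda>l. l) x"
proof (rule vec_eq_iff[THEN iffD2], rule allI)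
  fix S :: "'a set"
  define g where "g j k = (sg j S * sg k (flip j S)) *\<^sub>R bop j (j \<in> S) (bop k (k \<in> flip j S) (x $ flip k (flip j S)))" for j k
  have xS: "x $ T \<in> polys" for T using assms by (rule polysK_D)
  have bs: "bop j b (\<Sum>k\<in>UNIV. r k *\<^sub>R f k) = (\<Sum>k\<in>UNIV. r k *\<^sub>R bop j b (f k))" for j b r f
  proof -
    interpret B: Vector_Spaces.linear "(*\<^sub>C)" "(*\<^sub>C)" "bop j b" by (rule clinear_bop)
    show ?thesis by (simp add: B.sum clinearD(6)[OF clinear_bop])
  qed
  have "dirac (dirac x) $ S = (\<Sum>j\<in>UNIV. \<Sum>k\<in>UNIV. g j k)"
    by (simp add: dirac_def bs g_def scaleR_sum_right)
  also have "\<dots> = (\<Sum>j\<in>UNIV. g j j + (\<Sum>k\<in>UNIV - {j}. g j k))"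
    by (intro sum.cong refl sum.remove) auto
  also have "\<dots> = (\<Sum>j\<in>UNIV. g j j) + (\<Sum>j\<in>UNIV. \<Sum>k\<in>UNIV - {j}. g j k)"
    by (rule sum.distrib)
  also have "(\<Sum>j\<in>UNIV. \<Sum>k\<in>UNIV - {j}. g j k) = 0"
  proof -
    have anti: "g j k = - g k j" if "j \<noteq> k" for j k
    proof -
      have m: "k \<in> flip j S \<longleftrightarrow> k \<in> S" "j \<in> flip k S \<longleftrightarrow> j \<in> S" using that by auto
      show ?thesis
        unfolding g_def m flip_commute[of k j S] sg_anticommute[OF that, of S] bop_commute[OF that xS, of "j \<in> S" "k \<in> S"]
        by simp
    qed
    let ?g = "\<lambda>j k. if k = j then 0 else g j k"
    have e: "(\<Sum>j\<in>UNIV. \<Sum>k\<in>UNIV - {j}. g j k) = (\<Sum>j\<in>UNIV. \<Sum>k\<in>UNIV. ?g j k)"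
      by (intro sum.cong refl sum.mono_neutral_cong_left) auto
    have "(\<Sum>j\<in>UNIV. \<Sum>k\<in>UNIV. ?g j k) = (\<Sum>k\<in>UNIV. \<Sum>j\<in>UNIV. ?g j k)" by (rule sum.swap)
    also have "\<dots> = (\<Sum>k\<in>UNIV. \<Sum>j\<in>UNIV. - ?g k j)"
      by (intro sum.cong refl) (auto dest: anti)
    also have "\<dots> = - (\<Sum>k\<in>UNIV. \<Sum>j\<in>UNIV. ?g k j)" by (simp add: sum_negf)
    finally have "2 *\<^sub>R (\<Sum>j\<in>UNIV. \<Sum>k\<in>UNIV. ?g j k) = 0"
      by (simp only: scaleR_2 eq_neg_iff_add_eq_0)
    then show ?thesis using e by simp
  qed
  also have "(\<Sum>j\<in>UNIV. g j j) = (\<Sum>j\<in>UNIV. diagop (\<lambda>\<alpha>. 2 * real (\<alpha> j) + (if j \<in> S then 0 else 2)) (x $ S))"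
    by (intro sum.cong refl) (simp add: g_def bop_bop[OF xS])
  also have "\<dots> = lamK (\<lambda>l. l) x $ S"
    unfolding diagop_sum[OF xS] by (simp add: diagK_def lam_def)
  finally show "dirac (dirac x) $ S = lamK (\<lambda>l. l) x $ S" by simp
qed

lemma sum_flip: "(\<Sum>S\<in>UNIV. f (flip j S)) = (\<Sum>S\<in>UNIV. f S)"
  by (rule sum.reindex_bij_betw[OF bij_flip[unfolded bij_betw_def[symmetric]]])

lemma dirac_form:
  "dirac x \<bullet> y = (\<Sum>j\<in>UNIV. \<Sum>S\<in>UNIV. sg j S * (bop j (j \<in> S) (x $ flip j S) \<bullet> (y $ S)))"
  unfolding inner_vec_def dirac_def by (subst sum.swap) (simp add: inner_sum_left)

text \<open>Reindexing by \<open>flip j\<close> produces the same components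
  \<open>x $ flip j S\<close> and \<open>y $ S\<close> as in \<open>dirac_form\<close>, so that the
  two expansions can be subtracted term by term.\<close>

lemma dirac_form':
  assumes F: "clinear F"
  shows "x \<bullet> amp F (dirac y) = (\<Sum>j\<in>UNIV. \<Sum>S\<in>UNIV. sg j S * (x $ flip j S \<bullet> F (bop j (j \<notin> S) (y $ S))))"
proof -
  interpret F: Vector_Spaces.linear "(*\<^sub>C)" "(*\<^sub>C)" F by fact
  have "x \<bullet> amp F (dirac y) = (\<Sum>S\<in>UNIV. \<Sum>j\<in>UNIV. sg j S * (x $ S \<bullet> F (bop j (j \<in> S) (y $ flip j S))))"
    unfolding inner_vec_def dirac_def amp_def by (simp add: F.sum clinearD(6)[OF F] inner_sum_right)
  also have "\<dots> = (\<Sum>j\<in>UNIV. \<Sum>S\<in>UNIV. sg j S * (x $ S \<bullet> F (bop j (j \<in> S) (y $ flip j S))))"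
    by (rule sum.swap)
  also have "\<dots> = (\<Sum>j\<in>UNIV. \<Sum>S\<in>UNIV. sg j S * (x $ flip j S \<bullet> F (bop j (j \<notin> S) (y $ S))))"
  proof (rule sum.cong[OF refl])
    fix j
    show "(\<Sum>S\<in>UNIV. sg j S * (x $ S \<bullet> F (bop j (j \<in> S) (y $ flip j S))))
        = (\<Sum>S\<in>UNIV. sg j S * (x $ flip j S \<bullet> F (bop j (j \<notin> S) (y $ S))))"
      using sum_flip[of "\<lambda>S. sg j S * (x $ S \<bullet> F (bop j (j \<in> S) (y $ flip j S)))" j] by simp
  qed
  finally show ?thesis .
qed

lemma dirac_symmetric:
  assumes "x \<in> polysK" "y \<in> polysK" shows "dirac x \<bullet> y = x \<bullet> dirac y"
proof -
  have a: "amp (\<lambda>x. x) y = y" for y :: "'a famp" by (simp add: amp_def vec_eq_iff)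
  have "x \<bullet> dirac y = (\<Sum>j\<in>UNIV. \<Sum>S\<in>UNIV. sg j S * (x $ flip j S \<bullet> bop j (j \<notin> S) (y $ S)))"
    using dirac_form'[OF clinear_id, of x y] by (simp add: a)
  also have "\<dots> = dirac x \<bullet> y"
    unfolding dirac_form using assms by (intro sum.cong refl) (simp add: bop_adjoint polysK_D)
  finally show ?thesis by simp
qed

lemma norm_component_le: "norm (x $ S) \<le> norm (x :: 'n::finite famp)"
  by (rule Finite_Cartesian_Product.norm_nth_le)

lemma dirac_commutator_bound:
  assumes A: "bounded_linear A" "clinear A" and L: "L \<ge> 0"
    and Lip: "\<And>j c t x. c \<in> {1, \<i>} \<Longrightarrow> norm (weyl_conj (t *\<^sub>R axis j c) A x - A x) \<le> L * \<bar>t\<bar> * norm x"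
    and x: "x \<in> polysK" and y: "(y :: 'n::finite famp) \<in> polysK"
  shows "\<bar>dirac x \<bullet> amp A y - x \<bullet> amp A (dirac y)\<bar> \<le> (2 * L * CARD('n) * CARD('n set)) * norm x * norm y"
proof -
  have "dirac x \<bullet> amp A y - x \<bullet> amp A (dirac y) = (\<Sum>j\<in>UNIV. \<Sum>S\<in>UNIV. sg j S *
     (bop j (j \<in> S) (x $ flip j S) \<bullet> A (y $ S) - x $ flip j S \<bullet> A (bop j (j \<notin> S) (y $ S))))"
    unfolding dirac_form dirac_form'[OF A(2)] sum_subtractf[symmetric]
    by (simp add: amp_def algebra_simps)
  also have "\<bar>\<dots>\<bar> \<le> (\<Sum>j\<in>(UNIV::'n set). \<Sum>S\<in>(UNIV::'n set set). 2 * L * norm x * norm y)"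
  proof (intro order_trans[OF sum_abs] sum_mono)
    fix j :: 'n and S :: "'n set"
    have p: "x $ flip j S \<in> polys" "y $ S \<in> polys" using x y by (auto simp: polysK_D)
    have "\<bar>bop j (j \<in> S) (x $ flip j S) \<bullet> A (y $ S) - x $ flip j S \<bullet> A (bop j (j \<notin> S) (y $ S))\<bar>
        \<le> 2 * L * norm (x $ flip j S) * norm (y $ S)"
      using up_dn_commutator_bound[OF A Lip Lip p, of j] by (auto simp: bop_def)
    also have "\<dots> \<le> 2 * L * norm x * norm y"
      using L by (intro mult_mono norm_component_le) auto
    finally show "\<bar>sg j S * (bop j (j \<in> S) (x $ flip j S) \<bullet> A (y $ S) - x $ flip j S \<bullet> A (bop j (j \<notin> S) (y $ S)))\<bar>
        \<le> 2 * L * norm x * norm y"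
      by (simp add: abs_mult)
  qed
  also have "\<dots> = (2 * L * CARD('n) * CARD('n set)) * norm x * norm y" by simp
  finally show ?thesis .
qed

lemma diagK_diagK: "x \<in> polysK \<Longrightarrow> diagK \<Psi> (diagK \<Xi> x) = diagK (\<lambda>S \<alpha>. \<Psi> S \<alpha> * \<Xi> S \<alpha>) x"
  by (simp add: diagK_def vec_eq_iff diagop_diagop polysK_D)

lemma diagK_add: "x \<in> polysK \<Longrightarrow> diagK \<Psi> x + diagK \<Xi> x = diagK (\<lambda>S \<alpha>. \<Psi> S \<alpha> + \<Xi> S \<alpha>) x"
  by (simp add: diagK_def vec_eq_iff diagop_add polysK_D)

lemma diagK_const: "x \<in> polysK \<Longrightarrow> diagK (\<lambda>S \<alpha>. r) x = r *\<^sub>R x"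
  by (simp add: diagK_def vec_eq_iff diagop_const polysK_D)

lemma diagK_symmetric: "x \<in> polysK \<Longrightarrow> y \<in> polysK \<Longrightarrow> diagK \<Psi> x \<bullet> y = x \<bullet> diagK \<Psi> y"
  by (simp add: diagK_def inner_vec_def diagop_symmetric polysK_D)

lemma diagK_form_mono:
  assumes "x \<in> polysK" "\<And>S \<alpha>. \<Psi> S \<alpha> \<le> \<Xi> S \<alpha>"
  shows "x \<bullet> diagK \<Psi> x \<le> x \<bullet> diagK \<Xi> x"
  unfolding inner_vec_def diagK_def
  using assms by (auto intro!: sum_mono diagop_form_mono polysK_D)

text \<open>Each elementary move preserves the eigenvalue: flipping j in S is compensated by raising
  or lowering the exponent of z_j. Hence the Dirac operator commutes with functions of its
  square.\<close>

lemma dirac_lamK: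
  assumes "x \<in> polysK" shows "dirac (lamK \<phi> x) = lamK \<phi> (dirac x)"
proof -
  have b: "bop j (j \<in> S) (diagop (\<lambda>\<alpha>. \<phi> (lam (flip j S) \<alpha>)) p) = diagop (\<lambda>\<alpha>. \<phi> (lam S \<alpha>)) (bop j (j \<in> S) p)"
    if "p \<in> polys" for j S p
  proof (rule polys_eqI[OF clinear_comp[OF clinear_bop clinear_ops(3)] clinear_comp[OF clinear_ops(3) clinear_bop] _ that])
    fix \<alpha>
    have split: "lam T \<beta> = 2 * real (\<beta> j) + (if j \<in> T then 0 else 2) + (\<Sum>i\<in>UNIV-{j}. 2 * real (\<beta> i) + (if i \<in> T then 0 else 2))" for T \<beta>
      unfolding lam_def by (rule sum.remove) auto
    have r: "(\<Sum>i\<in>UNIV-{j}. 2 * real (\<beta> i) + (if i \<in> flip j S then 0 else 2)) = (\<Sum>i\<in>UNIV-{j}. 2 * real (\<alpha> i) + (if i \<in> S then 0 else 2))"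
      "(\<Sum>i\<in>UNIV-{j}. 2 * real (\<beta> i) + (if i \<in> S then 0 else 2)) = (\<Sum>i\<in>UNIV-{j}. 2 * real (\<alpha> i) + (if i \<in> S then 0 else 2))"
      if "\<And>i. i \<noteq> j \<Longrightarrow> \<beta> i = \<alpha> i" for \<beta>
      using that by (auto intro!: sum.cong)
    show "bop j (j \<in> S) (diagop (\<lambda>\<alpha>. \<phi> (lam (flip j S) \<alpha>)) (monomial \<alpha>)) = diagop (\<lambda>\<alpha>. \<phi> (lam S \<alpha>)) (bop j (j \<in> S) (monomial \<alpha>))"
    proof (cases "j \<in> S")
      case True
      have "lam (flip j S) \<alpha> = lam S (inc j \<alpha>)"
        unfolding split[of "flip j S" \<alpha>] split[of S "inc j \<alpha>"] using True r(1)[of \<alpha>] r(2)[of "inc j \<alpha>"] by simp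
      then show ?thesis using True by (simp add: bop_def clinearD[OF clinear_ops(1)])
    next
      case False
      \<comment> \<open>For \<open>\<alpha> j = 0\<close> the equation fails, but then
        \<open>dn j\<close> kills the monomial on both sides.\<close>
      have "lam (flip j S) \<alpha> = lam S (dec j \<alpha>)" if "\<alpha> j > 0"
        unfolding split[of "flip j S" \<alpha>] split[of S "dec j \<alpha>"] using False that r(1)[of \<alpha>] r(2)[of "dec j \<alpha>"]
        by (simp add: of_nat_diff)
      then show ?thesis using False
        by (cases "\<alpha> j > 0") (auto simp: bop_def clinearD[OF clinear_ops(2)] clinearD[OF clinear_ops(3)])
    qed
  qed
  show ?thesis
  proof (rule vec_eq_iff[THEN iffD2], rule allI)
    fix S :: "'a set"
    interpret D: Vector_Spaces.linear "(*\<^sub>C)" "(*\<^sub>C)" "diagop (\<lambda>\<alpha>. \<phi> (lam S \<alpha>))" by (rule clinear_ops)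
    show "dirac (lamK \<phi> x) $ S = lamK \<phi> (dirac x) $ S"
      using assms by (simp add: dirac_def diagK_def b polysK_D D.sum clinearD(6)[OF clinear_ops(3)])
  qed
qed

lemma norm_diagK_le:
  assumes x: "x \<in> polysK" and M: "M \<ge> 0" "\<And>S \<alpha>. \<bar>\<Psi> S \<alpha>\<bar> \<le> M"
  shows "norm (diagK \<Psi> x) \<le> M * norm x"
proof -
  have "diagK \<Psi> x \<bullet> diagK \<Psi> x = x \<bullet> diagK (\<lambda>S \<alpha>. \<Psi> S \<alpha> * \<Psi> S \<alpha>) x"
    using diagK_symmetric[OF x polysK_diagK[OF x]] diagK_diagK[OF x] by metis
  also have "\<dots> \<le> x \<bullet> diagK (\<lambda>S \<alpha>. M\<^sup>2) x"
  proof (intro diagK_form_mono x)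
    show "\<Psi> S \<alpha> * \<Psi> S \<alpha> \<le> M\<^sup>2" for S \<alpha>
      using M(2)[of S \<alpha>] M(1) by (metis abs_le_square_iff abs_of_nonneg power2_eq_square)
  qed
  also have "\<dots> = (M * norm x)\<^sup>2"
    by (simp add: diagK_const[OF x] power_mult_distrib power2_norm_eq_inner)
  finally have "(norm (diagK \<Psi> x))\<^sup>2 \<le> (M * norm x)\<^sup>2" by (simp add: power2_norm_eq_inner)
  then show ?thesis by (rule power2_le_imp_le) (use M in simp)
qed

text \<open>By symmetry the squared norm is the diagonal form of l \<phi>(l)^2 at x, so a bound on
  this one function suffices.\<close>

lemma norm_dirac_lamK_le:
  assumes x: "x \<in> polysK" and M: "M \<ge> 0" "\<And>l. l \<ge> 0 \<Longrightarrow> l * (\<phi> l)\<^sup>2 \<le> M\<^sup>2"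
  shows "norm (dirac (lamK \<phi> x)) \<le> M * norm x"
proof -
  have y: "lamK \<phi> x \<in> polysK" using x by auto
  have "dirac (lamK \<phi> x) \<bullet> dirac (lamK \<phi> x) = lamK \<phi> x \<bullet> dirac (dirac (lamK \<phi> x))"
    using y by (intro dirac_symmetric) auto
  also have "\<dots> = x \<bullet> lamK \<phi> (lamK (\<lambda>l. l) (lamK \<phi> x))"
    using x by (simp add: dirac_dirac[OF y] diagK_symmetric polysK_diagK)
  also have "\<dots> = x \<bullet> lamK (\<lambda>l. l * (\<phi> l)\<^sup>2) x"
    using x by (simp add: diagK_diagK polysK_diagK power2_eq_square mult_ac)
  also have "\<dots> \<le> x \<bullet> diagK (\<lambda>S \<alpha>. M\<^sup>2) x"
    using M lam_nonneg by (intro diagK_form_mono x) auto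
  also have "\<dots> = (M * norm x)\<^sup>2"
    by (simp add: diagK_const[OF x] power_mult_distrib power2_norm_eq_inner)
  finally have "(norm (dirac (lamK \<phi> x)))\<^sup>2 \<le> (M * norm x)\<^sup>2" by (simp add: power2_norm_eq_inner)
  then show ?thesis by (rule power2_le_imp_le) (use M in simp)
qed

section \<open>A bounded odd function of the Dirac operator\<close>

definition hn :: "real \<Rightarrow> nat \<Rightarrow> real \<Rightarrow> real" where
  "hn a n l = (\<Sum>j<n. (2 ^ j * a) / (l + (2 ^ j * a)\<^sup>2))"

text \<open>\<open>sqrt l * hs a l\<close> is comparable to 1 for \<open>l \<ge> a\<^sup>2\<close>, while every summand is built from a
  resolvent.\<close>

definition hs :: "real \<Rightarrow> real \<Rightarrow> real" where
  "hs a l = (\<Sum>j. (2 ^ j * a) / (l + (2 ^ j * a)\<^sup>2))"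

lemma hn_tendsto_hs:
  assumes a: "a > 0" and l: "l \<ge> 0"
  shows "(\<lambda>n. hn a n l) \<longlonglongrightarrow> hs a l"
proof -
  have "summable (\<lambda>j. (2 ^ j * a) / (l + (2 ^ j * a)\<^sup>2))"
  proof (rule summable_comparison_test')
    have "summable (\<lambda>j. (1/2::real) ^ j)" by (rule summable_geometric) simp
    then show "summable (\<lambda>j. (1/a) * (1/2) ^ j)" by (rule summable_mult)
    show "norm ((2 ^ j * a) / (l + (2 ^ j * a)\<^sup>2)) \<le> (1/a) * (1/2) ^ j" for j
    proof -
      define b where "b = 2 ^ j * a"
      have b: "b > 0" using a by (simp add: b_def)
      have "b / (l + b\<^sup>2) \<le> b / b\<^sup>2" using b l by (intro divide_left_mono) (auto intro!: mult_pos_pos add_nonneg_pos)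
      also have "\<dots> = (1/a) * (1/2) ^ j" using a by (simp add: b_def power2_eq_square field_simps)
      finally show ?thesis using b l by (simp add: b_def[symmetric])
    qed
  qed
  then show ?thesis unfolding hs_def hn_def by (rule summable_LIMSEQ)
qed

text \<open>The increment f (2 b) - f b is b x / ((2 b + x) (b + x)), whose denominator lies between
  x^2 + b^2 and four times that. Each summand is thus comparable to an increment of f, and over the
  points 2^j a these telescope.\<close>

lemma hn_telescope:
  fixes x a :: real
  assumes a: "a > 0" and x: "x > 0"
  defines "f \<equiv> \<lambda>b. b / (b + x)"
  shows "x * hn a n (x\<^sup>2) \<le> 4 * (f (2 ^ n * a) - f a)" and "f (2 ^ n * a) - f a \<le> x * hn a n (x\<^sup>2)"
proof -
  have step: "x * (b / (x\<^sup>2 + b\<^sup>2)) \<le> 4 * (f (2 * b) - f b) \<and> f (2 * b) - f b \<le> x * (b / (x\<^sup>2 + b\<^sup>2))" if b: "b > 0" for b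
  proof -
    have p: "2 * b + x > 0" "b + x > 0" "x\<^sup>2 + b\<^sup>2 > 0" using b x by (auto intro: add_pos_pos)
    have d: "f (2 * b) - f b = b * x / ((2 * b + x) * (b + x))"
      using p unfolding f_def by (simp add: divide_simps) (simp add: algebra_simps)
    have q: "(2 * b + x) * (b + x) \<le> 4 * (x\<^sup>2 + b\<^sup>2)"
    proof -
      have "4 * (x\<^sup>2 + b\<^sup>2) - (2 * b + x) * (b + x) = (b - x)\<^sup>2 + (b - x / 2)\<^sup>2 + 7 / 4 * x\<^sup>2"
        by (simp add: power2_eq_square field_simps)
      also have "\<dots> \<ge> 0" by simp
      finally show ?thesis by simp
    qed
    have q': "x\<^sup>2 + b\<^sup>2 \<le> (2 * b + x) * (b + x)"
    proof -
      have "0 \<le> b * b" "0 \<le> b * x" using b x by auto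
      then show ?thesis by (simp add: power2_eq_square algebra_simps)
    qed
    have bx: "b * x \<ge> 0" using b x by simp
    have "u / v = 4 * (u / (4 * v))" for u v :: real by simp
    then have "b * x / (x\<^sup>2 + b\<^sup>2) = 4 * (b * x / (4 * (x\<^sup>2 + b\<^sup>2)))" .
    also have "\<dots> \<le> 4 * (b * x / ((2 * b + x) * (b + x)))"
      using p q bx by (intro mult_left_mono divide_left_mono) auto
    finally have 1: "b * x / (x\<^sup>2 + b\<^sup>2) \<le> 4 * (f (2 * b) - f b)" unfolding d .
    have 2: "f (2 * b) - f b \<le> b * x / (x\<^sup>2 + b\<^sup>2)"
      unfolding d using p q' bx by (intro divide_left_mono) auto
    show ?thesis using 1 2 by (simp add: mult.commute)
  qed
  have "x * hn a n (x\<^sup>2) \<le> 4 * (f (2 ^ n * a) - f a) \<and> f (2 ^ n * a) - f a \<le> x * hn a n (x\<^sup>2)"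
  proof (induction n)
    case 0
    then show ?case by (simp add: hn_def)
  next
    case (Suc n)
    have "x * hn a (Suc n) (x\<^sup>2) = x * hn a n (x\<^sup>2) + x * ((2 ^ n * a) / (x\<^sup>2 + (2 ^ n * a)\<^sup>2))"
      by (simp add: hn_def distrib_left)
    moreover have "2 ^ Suc n * a = 2 * (2 ^ n * a)" by simp
    ultimately show ?case using Suc step[of "2 ^ n * a"] a by (simp only:) (auto simp: algebra_simps)
  qed
  then show "x * hn a n (x\<^sup>2) \<le> 4 * (f (2 ^ n * a) - f a)" "f (2 ^ n * a) - f a \<le> x * hn a n (x\<^sup>2)" by auto
qed

text \<open>The telescoped function takes values between 0 and 1, so sqrt l times
  \<open>hs a l\<close> is at most 4, whatever a is.\<close>

lemma hs_upper:
  assumes a: "a > 0" and l: "l \<ge> 0" shows "l * (hs a l)\<^sup>2 \<le> 4\<^sup>2"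
proof (cases "l = 0")
  case False
  define x where "x = sqrt l"
  have x: "x > 0" "x\<^sup>2 = l" using False l by (auto simp: x_def)
  have "x * hs a l \<le> 4"
  proof (rule LIMSEQ_le_const2)
    show "(\<lambda>n. x * hn a n l) \<longlonglongrightarrow> x * hs a l" by (intro tendsto_intros hn_tendsto_hs a l)
    have "x * hn a n l \<le> 4" for n
    proof -
      have "2 ^ n * a + x > 0" using a x by (simp add: add_pos_pos)
      then have "(2 ^ n * a) / (2 ^ n * a + x) \<le> 1" "a / (a + x) \<ge> 0" using a x by (simp_all add: divide_le_eq)
      moreover have "r \<le> 4" if "r \<le> 4 * (p - q)" "p \<le> 1" "q \<ge> 0" for p q r :: real
        using that by (simp add: algebra_simps)
      ultimately show ?thesis using hn_telescope(1)[OF a x(1), of n] unfolding x(2) by blast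
    qed
    then show "\<exists>N. \<forall>n\<ge>N. x * hn a n l \<le> 4" by blast
  qed
  moreover have "0 \<le> x * hs a l"
  proof (rule LIMSEQ_le_const)
    show "(\<lambda>n. x * hn a n l) \<longlonglongrightarrow> x * hs a l" by (intro tendsto_intros hn_tendsto_hs a l)
    have "0 \<le> x * hn a n l" for n
      unfolding hn_def using a x l by (intro mult_nonneg_nonneg sum_nonneg divide_nonneg_nonneg) auto
    then show "\<exists>N. \<forall>n\<ge>N. 0 \<le> x * hn a n l" by blast
  qed
  ultimately have "(x * hs a l)\<^sup>2 \<le> 4\<^sup>2" by (intro power_mono)
  then show ?thesis using x by (simp add: power_mult_distrib)
qed simp

text \<open>The telescoped lower bound tends to 1 - a / (a + x), which is at least 1/2 once x = sqrt
  l is at least a.\<close>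

lemma hs_lower:
  assumes a: "a > 0" and l: "l \<ge> a\<^sup>2" shows "hs a l > 0" "l * (hs a l)\<^sup>2 \<ge> 1/4"
proof -
  have "a\<^sup>2 > 0" using a by simp
  then have l0: "l \<ge> 0" "l > 0" using l by linarith+
  define x where "x = sqrt l"
  have x: "x > 0" "x\<^sup>2 = l" "x \<ge> a" using l0 l a by (auto simp: x_def real_le_rsqrt)
  have "1 - a / (a + x) \<le> x * hs a l"
  proof (rule LIMSEQ_le)
    show "(\<lambda>n. x * hn a n l) \<longlonglongrightarrow> x * hs a l" by (intro tendsto_intros hn_tendsto_hs a l0)
    show "(\<lambda>n. (2 ^ n * a) / (2 ^ n * a + x) - a / (a + x)) \<longlonglongrightarrow> 1 - a / (a + x)"
    proof (rule tendsto_diff[OF _ tendsto_const])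
      have "(\<lambda>n. (1/2::real) ^ n) \<longlonglongrightarrow> 0" by (rule LIMSEQ_realpow_zero) auto
      then have "(\<lambda>n. a / (a + (1/2) ^ n * x)) \<longlonglongrightarrow> a / (a + 0 * x)"
        using a by (intro tendsto_intros) auto
      moreover have "a / (a + (1/2) ^ n * x) = (2 ^ n * a) / (2 ^ n * a + x)" for n
      proof -
        have "a + (1/2) ^ n * x > 0" "2 ^ n * a + x > 0" using a x by (auto intro!: add_pos_pos)
        then show ?thesis by (simp add: field_simps power_divide)
      qed
      ultimately show "(\<lambda>n. (2 ^ n * a) / (2 ^ n * a + x)) \<longlonglongrightarrow> 1" using a by simp
    qed
    show "\<exists>N. \<forall>n\<ge>N. (2 ^ n * a) / (2 ^ n * a + x) - a / (a + x) \<le> x * hn a n l"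
      using hn_telescope(2)[OF a x(1)] x(2) by auto
  qed
  moreover have "a / (a + x) \<le> 1/2" using a x by (simp add: field_simps)
  ultimately have h: "1/2 \<le> x * hs a l" by linarith
  then have "0 < x * hs a l" by linarith
  then show "hs a l > 0" using x by (simp add: zero_less_mult_iff)
  have "(1/2)\<^sup>2 \<le> (x * hs a l)\<^sup>2" using h by (intro power_mono) auto
  then show "l * (hs a l)\<^sup>2 \<ge> 1/4" unfolding power_mult_distrib x(2) by (simp add: power2_eq_square)
qed

lemma sum_half_powers: "(\<Sum>j<n. 1 / 2 ^ j) \<le> (2::real)"
proof -
  have "(\<Sum>j<n. 1 / 2 ^ j) = (2::real) - 2 / 2 ^ n"
    by (induction n) (simp_all add: field_simps)
  then show ?thesis by simp
qed

subsection \<open>Commutators with Lipschitz operators\<close>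

lemma amp_linear:
  assumes "clinear A"
  shows "amp A (x + y) = amp A x + amp A y" "amp A (r *\<^sub>R x) = r *\<^sub>R amp A x" "amp A 0 = 0"
  by (simp_all add: amp_def vec_eq_iff clinearD[OF assms])

lemma dirac_add: "dirac (x + y) = dirac x + dirac y"
  by (simp add: dirac_def vec_eq_iff clinearD[OF clinear_bop] scaleR_add_right sum.distrib)

lemma dirac_scaleR: "dirac (r *\<^sub>R x) = r *\<^sub>R dirac x"
  by (simp add: dirac_def vec_eq_iff clinearD[OF clinear_bop] scaleR_sum_right mult.commute)

lemma dirac_0: "dirac 0 = 0"
  using dirac_scaleR[of 0 0] by simp

lemma diagK_add_right: "diagK \<Psi> (x + y) = diagK \<Psi> x + diagK \<Psi> y"
  by (simp add: diagK_def vec_eq_iff clinearD[OF clinear_ops(3)])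

text \<open>Here A is any operator whose commutator form with the Dirac operator is bounded by C;
  Lipschitz operators provide such a bound through \<open>dirac_commutator_bound\<close>.\<close>

context
  fixes A :: "'n::finite fock \<Rightarrow> 'n fock" and C :: real
  assumes A: "clinear A" and C0: "C \<ge> 0"
    and C: "\<And>x y. x \<in> polysK \<Longrightarrow> y \<in> polysK \<Longrightarrow>
      \<bar>dirac x \<bullet> amp A y - x \<bullet> amp A (dirac y)\<bar> \<le> C * norm x * norm y"
begin

text \<open>Inserting x = D^2 G x + b^2 G x, and likewise for y, expresses the commutator with D G
  by two values of the bounded commutator form c, namely - c (D G x, D G y) + b^2 c (G x, G y).
  Since D G has norm at most 1/(2 b) and G at most 1/b^2, the total is C (1/4 + 1) / b^2.\<close>

lemma resolvent_commutator:
  assumes b: "b > 0" and x: "x \<in> polysK" and y: "y \<in> polysK"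
  defines "G \<equiv> lamK (\<lambda>l. 1 / (l + b\<^sup>2))"
  shows "\<bar>dirac (G x) \<bullet> amp A y - x \<bullet> amp A (dirac (G y))\<bar> \<le> (5 / 4 * C / b\<^sup>2) * norm x * norm y"
proof -
  have pos: "lam S \<alpha> + b\<^sup>2 > 0" for S and \<alpha> :: "'n \<Rightarrow> nat" using b lam_nonneg[of S \<alpha>] by (simp add: add_nonneg_pos)
  have G: "z = dirac (dirac (G z)) + b\<^sup>2 *\<^sub>R G z" "G z \<in> polysK" "dirac (G z) \<in> polysK" if z: "z \<in> polysK" for z
  proof -
    show Gz: "G z \<in> polysK" "dirac (G z) \<in> polysK" using z by (auto simp: G_def)
    have "dirac (dirac (G z)) + b\<^sup>2 *\<^sub>R G z = diagK (\<lambda>S \<alpha>. lam S \<alpha> / (lam S \<alpha> + b\<^sup>2)) z + diagK (\<lambda>S \<alpha>. b\<^sup>2 / (lam S \<alpha> + b\<^sup>2)) z"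
      using diagK_const[OF Gz(1), of "b\<^sup>2"] z
      by (simp add: dirac_dirac[OF Gz(1)] diagK_diagK[OF z] flip: G_def) (simp add: G_def diagK_diagK[OF z])
    also have "\<dots> = diagK (\<lambda>S \<alpha>. 1) z"
      unfolding diagK_add[OF z] using pos by (simp add: add_divide_distrib[symmetric] less_imp_neq[THEN not_sym])
    finally show "z = dirac (dirac (G z)) + b\<^sup>2 *\<^sub>R G z" by (simp add: diagK_const[OF z])
  qed
  have nG: "norm (G z) \<le> (1 / b\<^sup>2) * norm z" if z: "z \<in> polysK" for z
    unfolding G_def
  proof (rule norm_diagK_le[OF z])
    show "\<bar>1 / (lam S \<alpha> + b\<^sup>2)\<bar> \<le> 1 / b\<^sup>2" for S and \<alpha> :: "'n \<Rightarrow> nat"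
      using b lam_nonneg[of S \<alpha>] pos[of S \<alpha>] by (simp add: frac_le)
  qed simp
  have nD: "norm (dirac (G z)) \<le> (1 / (2 * b)) * norm z" if z: "z \<in> polysK" for z
    unfolding G_def
  proof (rule norm_dirac_lamK_le[OF z])
    show "l * (1 / (l + b\<^sup>2))\<^sup>2 \<le> (1 / (2 * b))\<^sup>2" if l: "l \<ge> 0" for l
    proof -
      have p: "l + b\<^sup>2 > 0" using b l by (simp add: add_nonneg_pos)
      have "0 \<le> (l - b\<^sup>2)\<^sup>2" by simp
      then have "l * (2 * b)\<^sup>2 \<le> (l + b\<^sup>2)\<^sup>2" by (simp add: power2_eq_square algebra_simps)
      then show ?thesis using p b by (simp add: power_divide divide_simps mult.commute)
    qed
  qed (use b in simp)
  let ?c = "\<lambda>u v. dirac u \<bullet> amp A v - u \<bullet> amp A (dirac v)"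
  have "dirac (G x) \<bullet> amp A y - x \<bullet> amp A (dirac (G y))
     = dirac (G x) \<bullet> amp A (dirac (dirac (G y)) + b\<^sup>2 *\<^sub>R G y) - (dirac (dirac (G x)) + b\<^sup>2 *\<^sub>R G x) \<bullet> amp A (dirac (G y))"
    using G(1)[OF x] G(1)[OF y] by simp
  also have "\<dots> = - ?c (dirac (G x)) (dirac (G y)) + b\<^sup>2 * ?c (G x) (G y)"
    by (simp add: amp_linear[OF A] inner_add_left inner_add_right algebra_simps)
  also have "\<bar>\<dots>\<bar> \<le> C * norm (dirac (G x)) * norm (dirac (G y)) + b\<^sup>2 * (C * norm (G x) * norm (G y))"
  proof -
    have "\<bar>?c (dirac (G x)) (dirac (G y))\<bar> \<le> C * norm (dirac (G x)) * norm (dirac (G y))"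
      "\<bar>?c (G x) (G y)\<bar> \<le> C * norm (G x) * norm (G y)"
      using C G x y by auto
    then show ?thesis
      by (intro order_trans[OF abs_triangle_ineq] add_mono) (auto simp: abs_mult intro: mult_left_mono)
  qed
  also have "\<dots> \<le> C * ((1 / (2 * b)) * norm x) * ((1 / (2 * b)) * norm y) + b\<^sup>2 * (C * ((1 / b\<^sup>2) * norm x) * ((1 / b\<^sup>2) * norm y))"
    using C0 b by (intro add_mono mult_mono nD nG x y mult_left_mono) auto
  also have "\<dots> = (5 / 4 * C / b\<^sup>2) * norm x * norm y"
    using b by (simp add: power2_eq_square field_simps)
  finally show ?thesis .
qed

text \<open>The weight b_j against a bound of order C / b_j^2 leaves C / b_j, and the dyadic growth
  of b_j keeps the sum below twice its first term, uniformly in n.\<close>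

lemma hn_commutator:
  assumes a: "a > 0" and x: "x \<in> polysK" and y: "y \<in> polysK"
  shows "\<bar>dirac (lamK (hn a n) x) \<bullet> amp A y - x \<bullet> amp A (dirac (lamK (hn a n) y))\<bar> \<le> (5 / 2 * C / a) * norm x * norm y"
proof -
  define b where "b j = 2 ^ j * a" for j :: nat
  have b: "b j > 0" for j using a by (simp add: b_def)
  have "\<bar>dirac (lamK (hn a n) x) \<bullet> amp A y - x \<bullet> amp A (dirac (lamK (hn a n) y))\<bar>
    \<le> (\<Sum>j<n. b j * (5 / 4 * C / (b j)\<^sup>2)) * norm x * norm y"
  proof (induction n)
    case 0
    have "lamK (hn a 0) z = 0" if "z \<in> polysK" for z :: "'n famp"
      using diagK_const[OF that, of 0] by (simp add: hn_def)
    then show ?case using x y by (simp add: dirac_0 amp_linear[OF A])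
  next
    case (Suc n)
    let ?G = "lamK (\<lambda>l. 1 / (l + (b n)\<^sup>2))"
    have s: "dirac (lamK (hn a (Suc n)) z) = dirac (lamK (hn a n) z) + b n *\<^sub>R dirac (?G z)" if z: "z \<in> polysK" for z
    proof -
      have "b n *\<^sub>R ?G z = diagK (\<lambda>S \<alpha>. b n * (1 / (lam S \<alpha> + (b n)\<^sup>2))) z"
        using diagK_const[of "?G z" "b n"] z by (simp add: polysK_diagK diagK_diagK)
      then have "lamK (hn a (Suc n)) z = lamK (hn a n) z + b n *\<^sub>R ?G z"
        using diagK_add[OF z] by (simp add: hn_def b_def)
      then show ?thesis by (simp add: dirac_add dirac_scaleR)
    qed
    have "dirac (lamK (hn a (Suc n)) x) \<bullet> amp A y - x \<bullet> amp A (dirac (lamK (hn a (Suc n)) y))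
      = (dirac (lamK (hn a n) x) \<bullet> amp A y - x \<bullet> amp A (dirac (lamK (hn a n) y)))
       + b n * (dirac (?G x) \<bullet> amp A y - x \<bullet> amp A (dirac (?G y)))"
      unfolding s[OF x] s[OF y] by (simp add: amp_linear[OF A] inner_add_left inner_add_right algebra_simps)
    also have "\<bar>\<dots>\<bar> \<le> (\<Sum>j<n. b j * (5 / 4 * C / (b j)\<^sup>2)) * norm x * norm y + b n * ((5 / 4 * C / (b n)\<^sup>2) * norm x * norm y)"
    proof (rule order_trans[OF abs_triangle_ineq add_mono[OF Suc]])
      show "\<bar>b n * (dirac (?G x) \<bullet> amp A y - x \<bullet> amp A (dirac (?G y)))\<bar>
          \<le> b n * ((5 / 4 * C / (b n)\<^sup>2) * norm x * norm y)"
        using mult_left_mono[OF resolvent_commutator[OF b x y, of n], of "b n"] b[of n]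
        by (simp only: abs_mult abs_of_pos less_imp_le)
    qed
    also have "\<dots> = (\<Sum>j<Suc n. b j * (5 / 4 * C / (b j)\<^sup>2)) * norm x * norm y" by (simp add: algebra_simps)
    finally show ?case .
  qed
  also have "(\<Sum>j<n. b j * (5 / 4 * C / (b j)\<^sup>2)) = (5 / 4 * C / a) * (\<Sum>j<n. 1 / 2 ^ j)"
    unfolding sum_distrib_left using a by (intro sum.cong) (auto simp: b_def power2_eq_square field_simps)
  also have "\<dots> * norm x * norm y \<le> (5 / 4 * C / a) * 2 * norm x * norm y"
    using C0 a by (intro mult_right_mono mult_left_mono sum_half_powers) auto
  finally show ?thesis by simp
qed

text \<open>A polynomial involves finitely many monomials, so pointwise convergence of the
  eigenvalues is enough.\<close>

lemma lamK_tendsto: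
  assumes "\<And>l. l \<ge> 0 \<Longrightarrow> (\<lambda>n. \<phi> n l) \<longlonglongrightarrow> \<psi> l" and x: "(x :: 'n famp) \<in> polysK"
  shows "(\<lambda>n. lamK (\<phi> n) x) \<longlonglongrightarrow> lamK \<psi> x"
proof -
  have "(\<lambda>n. diagop (\<lambda>\<alpha>. \<phi> n (lam S \<alpha>)) p) \<longlonglongrightarrow> diagop (\<lambda>\<alpha>. \<psi> (lam S \<alpha>)) p" if "p \<in> polys" for S and p :: "'n fock"
    using that
  proof (induction rule: polys_induct)
    case (step c \<alpha> p)
    have "(\<lambda>n. \<phi> n (lam S \<alpha>) *\<^sub>R (c *\<^sub>C monomial \<alpha>) + diagop (\<lambda>\<alpha>. \<phi> n (lam S \<alpha>)) p)
      \<longlonglongrightarrow> \<psi> (lam S \<alpha>) *\<^sub>R (c *\<^sub>C monomial \<alpha>) + diagop (\<lambda>\<alpha>. \<psi> (lam S \<alpha>)) p"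
      by (intro tendsto_intros assms(1) lam_nonneg step)
    then show ?case by (simp add: clinearD[OF clinear_ops(3)] scaleC_scaleR)
  qed (simp add: clinearD[OF clinear_ops(3)])
  then show ?thesis
    unfolding diagK_def using x by (intro vec_tendstoI) (simp add: polysK_D)
qed

lemma hs_commutator:
  assumes A': "bounded_linear A" and a: "a > 0" and x: "x \<in> polysK" and y: "y \<in> polysK"
  shows "\<bar>dirac (lamK (hs a) x) \<bullet> amp A y - x \<bullet> amp A (dirac (lamK (hs a) y))\<bar> \<le> (5 / 2 * C / a) * norm x * norm y"
proof (rule LIMSEQ_le_const2)
  have lim: "(\<lambda>n. dirac (lamK (hn a n) z)) \<longlonglongrightarrow> dirac (lamK (hs a) z)" if z: "z \<in> polysK" for z :: "'n famp"
    \<comment> \<open>The Dirac operator is not continuous; commuting it past the diagonal operator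
      lets it act before the limit is taken.\<close>
    unfolding dirac_lamK[OF z] using lamK_tendsto[OF hn_tendsto_hs[OF a] polysK_dirac[OF z]] .
  have amp_lim: "(\<lambda>n. amp A (f n)) \<longlonglongrightarrow> amp A g" if "f \<longlonglongrightarrow> g" for f g
    unfolding amp_def by (intro vec_tendstoI) (simp add: bounded_linear.tendsto[OF A'] tendsto_vec_nth[OF that])
  show "(\<lambda>n. \<bar>dirac (lamK (hn a n) x) \<bullet> amp A y - x \<bullet> amp A (dirac (lamK (hn a n) y))\<bar>)
    \<longlonglongrightarrow> \<bar>dirac (lamK (hs a) x) \<bullet> amp A y - x \<bullet> amp A (dirac (lamK (hs a) y))\<bar>"
    by (intro tendsto_intros amp_lim lim x y)
qed (use hn_commutator[OF a x y] in blast)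

end

section \<open>Fredholm properties of the odd operator\<close>

lemma orthogonal_projection_span:
  fixes B :: "'a::real_inner set"
  assumes "finite B"
  obtains p where "\<And>x. p x \<in> span B" "\<And>x y. y \<in> span B \<Longrightarrow> (x - p x) \<bullet> y = 0"
    "continuous_on UNIV p"
proof -
  obtain C where C: "finite C" "span C = span B" "pairwise orthogonal C"
    using basis_orthogonal[OF assms] by blast
  \<comment> \<open>C may contain 0; since \<open>inverse 0 = 0\<close>, such a vector contributes
    nothing.\<close>
  define p where "p x = (\<Sum>c\<in>C. ((x \<bullet> c) * inverse (c \<bullet> c)) *\<^sub>R c)" for x
  have pc: "p x \<bullet> c = x \<bullet> c" if c: "c \<in> C" for x c
  proof -
    have "p x \<bullet> c = (\<Sum>d\<in>C. if d = c then x \<bullet> c else 0)"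
      unfolding p_def inner_sum_left using C(3) c
      by (intro sum.cong refl) (cases "c = 0"; auto simp: pairwise_def orthogonal_def)
    then show ?thesis using C(1) c by simp
  qed
  show ?thesis
  proof
    show "p x \<in> span B" for x unfolding p_def C(2)[symmetric] by (intro span_sum span_scale span_base)
    show "continuous_on UNIV p" unfolding p_def by (intro continuous_intros)
    show "(x - p x) \<bullet> y = 0" if "y \<in> span B" for x y
      using that unfolding C(2)[symmetric]
    proof (induction rule: span_induct_alt)
      case (step r c y)
      then show ?case by (simp add: inner_add_right inner_diff_left pc)
    qed simp
  qed
qed

lemma closed_span_finite:
  fixes B :: "'a::real_inner set"
  assumes "finite B" shows "closed (span B)"
proof -
  obtain p where p: "\<And>x. p x \<in> span B" "\<And>x y. y \<in> span B \<Longrightarrow> (x - p x) \<bullet> y = 0" "continuous_on UNIV p"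
    using orthogonal_projection_span[OF assms] by blast
  have "span B = {x. p x = x}"
  proof (intro set_eqI iffI)
    show "x \<in> span B" if "x \<in> {x. p x = x}" for x using p(1)[of x] that by simp
    show "x \<in> {x. p x = x}" if "x \<in> span B" for x
    proof -
      have "(x - p x) \<bullet> (x - p x) = 0" using p(1)[of x] that by (intro p(2) span_diff)
      then show ?thesis by simp
    qed
  qed
  moreover have "closed {x. p x = x}" by (intro closed_Collect_eq continuous_intros p(3))
  ultimately show ?thesis by simp
qed

section \<open>Complex scalars on a real inner product space\<close>

locale complex_inner_space = trace_space scale
  for scale :: "complex \<Rightarrow> 'b::real_inner \<Rightarrow> 'b" (infixr \<open>\<odot>\<close> 75) +
  assumes scale_of_real: "complex_of_real r \<odot> x = r *\<^sub>R x"
begin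

lemma scale_Re_Im: "c \<odot> x = Re c *\<^sub>R x + Im c *\<^sub>R (\<i> \<odot> x)"
proof -
  have "c = of_real (Re c) + of_real (Im c) * \<i>" by (simp add: complex_eq_iff)
  then have "c \<odot> x = (of_real (Re c) + of_real (Im c) * \<i>) \<odot> x" by simp
  also have "\<dots> = Re c *\<^sub>R x + Im c *\<^sub>R (\<i> \<odot> x)"
    by (simp add: scale_left_distrib scale_of_real flip: scale_scale)
  finally show ?thesis .
qed

lemma real_subspace_of_subspace: "subspace E \<Longrightarrow> Real_Vector_Spaces.subspace E"
  unfolding subspace_def Real_Vector_Spaces.subspace_def by (metis scale_of_real)

text \<open>The complex span of B is the real span of B together with i B, which reduces closedness
  of complex spans to the real case.\<close>

lemma span_eq_real_span:
  assumes "finite B"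
  obtains C where "finite C" "span B = Real_Vector_Spaces.span C"
proof -
  let ?C = "B \<union> (\<lambda>x. \<i> \<odot> x) ` B"
  have i: "\<i> \<odot> x \<in> Real_Vector_Spaces.span ?C" if "x \<in> Real_Vector_Spaces.span ?C" for x
    using that
  proof (induction rule: real_vector.span_induct_alt)
    case base
    then show ?case by (simp add: real_vector.span_zero)
  next
    case (step r y x)
    have "\<i> \<odot> y \<in> Real_Vector_Spaces.span ?C"
    proof (cases "y \<in> B")
      case True
      then show ?thesis by (intro real_vector.span_base) auto
    next
      case False
      then obtain z where z: "z \<in> B" "y = \<i> \<odot> z" using step by auto
      have "\<i> \<odot> y = (-1) *\<^sub>R z" using z scale_of_real[of "-1" z] by simp
      then show ?thesis using z by (simp add: real_vector.span_neg real_vector.span_base)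
    qed
    moreover have "\<i> \<odot> (r *\<^sub>R y + x) = r *\<^sub>R (\<i> \<odot> y) + \<i> \<odot> x"
      by (simp add: scale_right_distrib mult.commute flip: scale_of_real)
    ultimately show ?case using step by (simp add: real_vector.span_add real_vector.span_scale)
  qed
  have "span B = Real_Vector_Spaces.span ?C"
  proof
    show "span B \<subseteq> Real_Vector_Spaces.span ?C"
    proof (rule span_minimal)
      show "B \<subseteq> Real_Vector_Spaces.span ?C" using real_vector.span_superset by blast
      show "subspace (Real_Vector_Spaces.span ?C)"
        unfolding subspace_def
      proof (intro conjI ballI allI)
        show "c \<odot> x \<in> Real_Vector_Spaces.span ?C" if "x \<in> Real_Vector_Spaces.span ?C" for c x
          unfolding scale_Re_Im[of c x] using that i by (intro real_vector.span_add real_vector.span_scale) auto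
      qed (simp_all add: real_vector.span_zero real_vector.span_add)
    qed
    show "Real_Vector_Spaces.span ?C \<subseteq> span B"
    proof (rule real_vector.span_minimal)
      show "?C \<subseteq> span B" using span_base span_scale by blast
      show "Real_Vector_Spaces.subspace (span B)"
        by (rule real_subspace_of_subspace[OF subspace_span])
    qed
  qed
  then show ?thesis using assms by (intro that[of ?C]) auto
qed

lemma closed_span_finite_complex:
  assumes "finite B" shows "closed (span B)"
  using span_eq_real_span[OF assms] closed_span_finite by metis

end

interpretation fock_cis: complex_inner_space "(*\<^sub>C) :: complex \<Rightarrow> 'n::finite fock \<Rightarrow> 'n fock"
  by unfold_locales (simp add: scaleR_eq_scaleC)

definition scaleK :: "complex \<Rightarrow> 'n::finite famp \<Rightarrow> 'n famp" where
  "scaleK c x = (\<chi> S. c *\<^sub>C x $ S)"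

interpretation K: complex_inner_space "scaleK :: complex \<Rightarrow> 'n::finite famp \<Rightarrow> 'n famp"
  by unfold_locales
     (simp_all add: scaleK_def vec_eq_iff scaleR_eq_scaleC fock.scale_right_distrib fock.scale_left_distrib)

abbreviation Klinear :: "('n::finite famp \<Rightarrow> 'n famp) \<Rightarrow> bool" where
  "Klinear \<equiv> Vector_Spaces.linear scaleK scaleK"

lemma Klinear_iff: "Klinear F \<longleftrightarrow> (\<forall>x y. F (x + y) = F x + F y) \<and> (\<forall>c x. F (scaleK c x) = scaleK c (F x))"
  by (rule K.linear_iff_scale)

lemma Klinear_real: "Klinear F \<Longrightarrow> linear F"
  unfolding Klinear_iff by (intro linearI) (auto simp flip: K.scale_of_real)

lemma Klinear_amp: "clinear F \<Longrightarrow> Klinear (amp F)"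
  by (simp add: Klinear_iff amp_def scaleK_def vec_eq_iff clinear_iff)

lemma bounded_linear_scaleK: "bounded_linear (scaleK c)"
proof (rule bounded_linear_intro[of _ "cmod c"])
  show "norm (scaleK c x) \<le> norm x * cmod c" for x
    by (simp add: norm_vec_def scaleK_def norm_scaleC L2_set_right_distrib[symmetric] mult.commute)
qed (simp_all add: K.scale_right_distrib mult.commute flip: K.scale_of_real)

lemma bounded_linear_amp:
  assumes "bounded_linear F" shows "bounded_linear (amp F)"
proof -
  interpret F: bounded_linear F by fact
  obtain k where k: "k \<ge> 0" "\<And>x. norm (F x) \<le> norm x * k" using F.nonneg_bounded by blast
  show ?thesis
  proof (rule bounded_linear_intro[of _ k])
    show "norm (amp F x) \<le> norm x * k" for x
    proof -
      have "norm (amp F x) \<le> L2_set (\<lambda>S. norm (x $ S) * k) UNIV"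
        unfolding norm_vec_def amp_def by (intro L2_set_mono) (auto simp: k)
      also have "\<dots> = norm x * k" using k by (simp add: norm_vec_def L2_set_left_distrib)
      finally show ?thesis .
    qed
  qed (simp_all add: amp_def vec_eq_iff F.add F.scaleR)
qed

lemma norm_amp_le:
  assumes "\<And>x. norm (F x) \<le> k * norm x" "k \<ge> 0" shows "norm (amp F x) \<le> k * norm x"
proof -
  have "norm (amp F x) \<le> L2_set (\<lambda>S. k * norm (x $ S)) UNIV"
    unfolding norm_vec_def amp_def by (intro L2_set_mono) (auto simp: assms)
  also have "\<dots> = k * norm x" using assms by (simp add: norm_vec_def L2_set_right_distrib)
  finally show ?thesis .
qed

lemma polysK_dense: "closure (polysK :: 'n::finite famp set) = UNIV"
proof (rule closure_subspace_eq_UNIV[OF subspace_polysK])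
  fix x :: "'n famp" assume perp: "\<And>p. p \<in> polysK \<Longrightarrow> x \<bullet> p = 0"
  have "x $ S = 0" for S
  proof -
    have "polys \<subseteq> {y. x $ S \<bullet> y = 0}"
    proof
      fix p :: "'n fock" assume p: "p \<in> polys"
      have "axis S p \<in> polysK" using p by (auto simp: polysK_def axis_def)
      from perp[OF this] show "p \<in> {y. x $ S \<bullet> y = 0}" by (simp add: inner_axis)
    qed
    moreover have "closed {y. x $ S \<bullet> y = 0}" by (intro closed_Collect_eq continuous_intros)
    ultimately have "closure polys \<subseteq> {y. x $ S \<bullet> y = 0}" by (rule closure_minimal)
    then have "x $ S \<in> {y. x $ S \<bullet> y = 0}" unfolding polys_dense by blast
    then show ?thesis by simp
  qed
  then show "x = 0" by (simp add: vec_eq_iff)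
qed

lemma polysK_eq_UNIV:
  assumes "bounded_linear F" "bounded_linear G" "\<And>x. x \<in> polysK \<Longrightarrow> F x = G x"
  shows "F x = G x"
proof -
  have "closed {x. F x = G x}"
    by (intro closed_Collect_eq linear_continuous_on assms)
  moreover have "polysK \<subseteq> {x. F x = G x}" using assms by auto
  ultimately have "closure polysK \<subseteq> {x. F x = G x}" by (rule closure_minimal[rotated])
  then show ?thesis by (auto simp: polysK_dense)
qed

lemma Klinear_dirac: "Klinear dirac"
  unfolding Klinear_iff
  by (auto simp: dirac_add) (simp add: dirac_def scaleK_def vec_eq_iff clinearD[OF clinear_bop] fock.scale_sum_right scaleC_scaleR)

lemma Klinear_diagK: "Klinear (diagK \<Psi>)"
  unfolding Klinear_iff
  by (auto simp: diagK_add_right) (simp add: diagK_def scaleK_def vec_eq_iff clinearD[OF clinear_ops(3)])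

lemma Klinear_comp: "Klinear F \<Longrightarrow> Klinear G \<Longrightarrow> Klinear (\<lambda>x. F (G x))"
  by (simp add: Klinear_iff)

lemma polysK_scaleK [intro]: "x \<in> polysK \<Longrightarrow> scaleK c x \<in> polysK"
  by (auto simp: polysK_def scaleK_def)

lemma extend_dirac_lamK:
  assumes M: "M \<ge> 0" "\<And>l. l \<ge> 0 \<Longrightarrow> l * (\<phi> l)\<^sup>2 \<le> M\<^sup>2"
  obtains V :: "'n::finite famp \<Rightarrow> 'n famp" where "bounded_linear V" "Klinear V"
    "\<And>x. x \<in> polysK \<Longrightarrow> V x = dirac (lamK \<phi> x)" "\<And>x. norm (V x) \<le> M * norm x"
proof -
  let ?f = "\<lambda>x :: 'n famp. dirac (lamK \<phi> x)"
  have Kf: "Klinear ?f" by (intro Klinear_comp[OF Klinear_dirac] Klinear_diagK)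
  obtain V where V: "bounded_linear V" "\<And>x. x \<in> polysK \<Longrightarrow> V x = ?f x" "\<And>x. norm (V x) \<le> M * norm x"
    using extend_bounded_linear[OF Klinear_real[OF Kf] subspace_polysK polysK_dense norm_dirac_lamK_le[OF _ M]] by blast
  have "V (scaleK c x) = scaleK c (V x)" for c x
  proof (rule polysK_eq_UNIV[where F = "\<lambda>x. V (scaleK c x)" and G = "\<lambda>x. scaleK c (V x)"])
    show "bounded_linear (\<lambda>x. V (scaleK c x))" "bounded_linear (\<lambda>x. scaleK c (V x))"
      using bounded_linear_compose[OF V(1) bounded_linear_scaleK] bounded_linear_compose[OF bounded_linear_scaleK V(1)] by auto
    show "V (scaleK c x) = scaleK c (V x)" if "x \<in> polysK" for x
      using that Kf by (simp add: V polysK_scaleK Klinear_iff)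
  qed
  then have "Klinear V" using V(1) by (simp add: Klinear_iff bounded_linear.linear linear_add)
  with V that show ?thesis by blast
qed

text \<open>Every exponent is bounded by the eigenvalue. Spectral subspaces below b are therefore
  finite-dimensional, which makes the defects of the parametrix of V finite-rank.\<close>

lemma finite_lam_less: "finite {(S, \<alpha>). lam S \<alpha> < b}"
proof -
  obtain N where N: "b \<le> real N" using real_arch_simple by blast
  have "{(S, \<alpha>). lam S \<alpha> < b} \<subseteq> (UNIV :: 'a set set) \<times> (PiE (UNIV :: 'a set) (\<lambda>_. {..N}))"
  proof clarsimp
    fix S and \<alpha> :: "'a \<Rightarrow> nat" assume *: "lam S \<alpha> < b"
    have "\<alpha> j \<le> N" for j
    proof -
      have "real (\<alpha> j) \<le> 2 * real (\<alpha> j) + (if j \<in> S then 0 else 2)" by simp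
      also have "\<dots> \<le> lam S \<alpha>" unfolding lam_def by (rule member_le_sum) auto
      finally show ?thesis using * N by linarith
    qed
    then show "\<alpha> \<in> PiE UNIV (\<lambda>_. {..N})" by (auto simp: PiE_def)
  qed
  then show ?thesis by (rule finite_subset) (intro finite_cartesian_product finite_PiE; simp)
qed

lemma finite_support_diagK:
  "\<exists>B. finite B \<and> (\<forall>x\<in>polysK. lamK (\<lambda>l. if l < b then 1 else 0) (x :: 'n::finite famp) \<in> K.span B)"
proof (intro exI conjI ballI)
  let ?B = "(\<lambda>(S, \<alpha>). axis S (monomial \<alpha>)) ` {(S :: 'n set, \<alpha>). lam S \<alpha> < b}"
  let ?\<phi> = "\<lambda>l. if l < b then 1 else (0::real)"
  show "finite ?B" by (intro finite_imageI finite_lam_less)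
  fix x :: "'n famp" assume x: "x \<in> polysK"
  have ax: "axis S (diagop (\<lambda>\<alpha>. ?\<phi> (lam S \<alpha>)) p) \<in> K.span ?B" if "p \<in> polys" for S and p :: "'n fock"
    using that
  proof (induction rule: polys_induct)
    case zero
    have "axis S 0 = (0 :: 'n famp)" by (simp add: axis_def vec_eq_iff)
    then show ?case by (simp only: clinearD(4)[OF clinear_ops(3)] K.span_zero)
  next
    case (step c \<alpha> p)
    have "axis S (diagop (\<lambda>\<alpha>. ?\<phi> (lam S \<alpha>)) (c *\<^sub>C monomial \<alpha> + p))
      = scaleK (c * of_real (?\<phi> (lam S \<alpha>))) (axis S (monomial \<alpha>)) + axis S (diagop (\<lambda>\<alpha>. ?\<phi> (lam S \<alpha>)) p)"
      by (auto simp: axis_def vec_eq_iff scaleK_def clinearD[OF clinear_ops(3)] scaleR_eq_scaleC)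
    moreover have "scaleK (c * of_real (?\<phi> (lam S \<alpha>))) (axis S (monomial \<alpha>)) \<in> K.span ?B"
    proof (cases "lam S \<alpha> < b")
      case True
      then show ?thesis by (intro K.span_scale K.span_base) auto
    qed (simp add: K.span_zero)
    ultimately show ?case using step by (simp only: K.span_add)
  qed
  have "lamK ?\<phi> x = (\<Sum>S\<in>UNIV. axis S (diagop (\<lambda>\<alpha>. ?\<phi> (lam S \<alpha>)) (x $ S)))"
    by (simp add: diagK_def vec_eq_iff axis_def)
  then show "lamK ?\<phi> x \<in> K.span ?B"
    using ax x by (simp add: K.span_sum polysK_D)
qed

text \<open>The values on polynomials lie in one finite-dimensional subspace, which is closed, so
  density puts the whole range there.\<close>

lemma finite_rank_of_polysK:
  fixes R :: "'n::finite famp \<Rightarrow> 'n famp"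
  assumes R: "bounded_linear R" "Klinear R" and eq: "\<And>x. x \<in> polysK \<Longrightarrow> R x = lamK (\<lambda>l. if l < b then 1 else 0) x"
  shows "K.finite_rank R"
proof -
  obtain B where B: "finite B" "\<And>x :: 'n famp. x \<in> polysK \<Longrightarrow> lamK (\<lambda>l. if l < b then 1 else 0) x \<in> K.span B"
    using finite_support_diagK by blast
  have "R x \<in> K.span B" for x
  proof -
    have "closed {x. R x \<in> K.span B}"
      using continuous_closed_vimage[OF K.closed_span_finite_complex[OF B(1)], of R]
        linear_continuous_at[OF R(1)] by (simp add: vimage_def)
    moreover have "polysK \<subseteq> {x. R x \<in> K.span B}" using B eq by auto
    ultimately have "closure polysK \<subseteq> {x. R x \<in> K.span B}" by (rule closure_minimal[rotated])
    then show ?thesis by (auto simp: polysK_dense)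
  qed
  then show ?thesis using K.finite_rank_cong_span[OF R(2) B(1)] by blast
qed

lemma K_linear_diff: "Klinear F \<Longrightarrow> Klinear G \<Longrightarrow> Klinear (\<lambda>x. F x - G x)"
  by (simp add: Klinear_iff K.scale_right_diff_distrib)

section \<open>Parity and its relation to the Dirac operator\<close>

lemma parity_mono: "parity (monomial \<alpha>) = (-1) ^ (\<Sum>i\<in>UNIV. \<alpha> i) *\<^sub>R monomial \<alpha>"
proof (rule fock_eqI)
  fix z :: "complex^'a"
  have "(\<Prod>i\<in>UNIV. (- (z $ i)) ^ \<alpha> i) = (\<Prod>i\<in>UNIV. (-1) ^ \<alpha> i * z $ i ^ \<alpha> i)"
    by (intro prod.cong refl) (rule power_minus)
  then show "fun_of (parity (monomial \<alpha>)) z = fun_of ((-1) ^ (\<Sum>i\<in>UNIV. \<alpha> i) *\<^sub>R monomial \<alpha>) z"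
    by (simp add: parity.rep_eq monomial.rep_eq scaleR_fock.rep_eq monom_fun_def prod.distrib power_sum)
qed

lemma clinear_parity: "clinear parity"
  unfolding clinear_iff by (auto intro!: fock_eqI simp: parity.rep_eq plus_fock.rep_eq fock_scale.rep_eq)

lemma parity_parity: "parity (parity f) = f"
  by (rule fock_eqI) (simp add: parity.rep_eq)

lemma norm_parity: "norm (parity f) = norm (f :: 'n::finite fock)"
proof -
  have "cmod (-1) = 1" by simp
  have e: "(-1) *s z = - z" for z :: "complex^'n" by (simp add: vec_eq_iff)
  have "(LINT z|gauss. (cmod (fun_of f z))\<^sup>2) = (LINT z|distr gauss borel (\<lambda>z. (-1) *s z). (cmod (fun_of f z))\<^sup>2)"
    by (simp only: distr_gauss_unimodular[OF \<open>cmod (-1) = 1\<close>])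
  also have "\<dots> = (LINT z|gauss. (cmod (fun_of f ((-1) *s z)))\<^sup>2)"
    by (subst integral_distr) auto
  finally show ?thesis by (simp add: norm_fock_def parity.rep_eq e)
qed

lemma bounded_linear_parity: "bounded_linear parity"
  by (rule bounded_linear_intro[of _ 1]) (simp_all add: clinearD[OF clinear_parity] norm_parity)

lemma polys_parity: "p \<in> polys \<Longrightarrow> parity p \<in> polys"
  by (rule polys_ops_aux[OF clinear_parity]) (auto simp: parity_mono)

lemma sum_inc: "(\<Sum>i\<in>UNIV. inc j \<alpha> i) = Suc (\<Sum>i\<in>UNIV. \<alpha> i)" for \<alpha> :: "'n::finite \<Rightarrow> nat"
  by (subst (1 2) sum.remove[of UNIV j]) auto

lemma bop_parity:
  assumes "p \<in> polys" shows "bop j b (parity p) = - parity (bop j b p)"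
proof -
  have "clinear (\<lambda>x. - parity (bop j b x))"
    using clinear_scale[OF clinear_comp[OF clinear_parity clinear_bop], of "-1"] by simp
  then show ?thesis
  proof (rule polys_eqI[OF clinear_comp[OF clinear_bop clinear_parity] _ _ assms])
    fix \<alpha>
    show "bop j b (parity (monomial \<alpha>)) = - parity (bop j b (monomial \<alpha>))"
    proof (cases b)
      case True
      then show ?thesis by (simp add: bop_def parity_mono sum_inc clinearD[OF clinear_ops(1)])
    next
      case False
      show ?thesis
      proof (cases "\<alpha> j > 0")
        case True
        have "(\<Sum>i\<in>UNIV. \<alpha> i) = Suc (\<Sum>i\<in>UNIV. dec j \<alpha> i)"
          using sum_inc[of j "dec j \<alpha>"] True by (simp add: inc_dec_same)
        then show ?thesis using \<open>\<not> b\<close>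
          by (simp add: bop_def parity_mono clinearD[OF clinear_ops(2)] clinearD[OF clinear_parity] mult.commute)
      qed (use False in \<open>simp add: bop_def parity_mono clinearD[OF clinear_ops(2)] clinearD[OF clinear_parity]\<close>)
    qed
  qed
qed

lemma diagop_parity: "p \<in> polys \<Longrightarrow> diagop \<psi> (parity p) = parity (diagop \<psi> p)"
  by (rule polys_eqI[OF clinear_comp[OF clinear_ops(3) clinear_parity] clinear_comp[OF clinear_parity clinear_ops(3)]])
     (simp_all add: parity_mono clinearD[OF clinear_ops(3)] clinearD[OF clinear_parity] mult.commute)

lemma dirac_lamK_parity:
  assumes x: "x \<in> polysK" shows "dirac (lamK \<phi> (amp parity x)) = - amp parity (dirac (lamK \<phi> x))"
proof -
  interpret P: Vector_Spaces.linear "(*\<^sub>C)" "(*\<^sub>C)" "parity :: 'a fock \<Rightarrow> 'a fock" by (rule clinear_parity)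
  have "lamK \<phi> (amp parity x) = amp parity (lamK \<phi> x)"
    using x by (simp add: diagK_def amp_def vec_eq_iff diagop_parity polysK_D)
  moreover have "dirac (amp parity y) = - amp parity (dirac y)" if "y \<in> polysK" for y :: "'a famp"
    using that by (simp add: dirac_def amp_def vec_eq_iff bop_parity polysK_D P.sum clinearD(6)[OF clinear_parity] sum_negf)
  ultimately show ?thesis using x by auto
qed

text \<open>W is a second function of the Dirac operator, chosen so that V W and W V are both the
  identity minus the spectral projection of D^2 below a^2. The bounds 4 and 2 come from
  \<open>hs_upper\<close> and \<open>hs_lower\<close>; that they do not involve a is essential
  later.\<close>

lemma odd_fredholm_operator:
  assumes a: "a > 0"
  obtains V W :: "'n::finite famp \<Rightarrow> 'n famp" where
    "bounded_linear V" "Klinear V" "bounded_linear W" "Klinear W"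
    "\<And>x. x \<in> polysK \<Longrightarrow> V x = dirac (lamK (hs a) x)"
    "\<And>x. norm (V x) \<le> 4 * norm x" "\<And>x. norm (W x) \<le> 2 * norm x"
    "\<And>x. V (amp parity x) = - amp parity (V x)"
    "\<And>x y. V x \<bullet> y = x \<bullet> V y"
    "K.parametrix V W"
proof -
  obtain V :: "'n famp \<Rightarrow> 'n famp" where V: "bounded_linear V" "Klinear V"
    "\<And>x. x \<in> polysK \<Longrightarrow> V x = dirac (lamK (hs a) x)" "\<And>x. norm (V x) \<le> 4 * norm x"
    using extend_dirac_lamK[of 4 "hs a"] hs_upper[OF a] by (metis zero_le_numeral)
  \<comment> \<open>The reciprocal of l hs(l) from a^2 on, where \<open>hs_lower\<close> applies;
    the value 0 below affects only finitely many eigenvectors.\<close>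
  define w where "w l = (if l < a\<^sup>2 then 0 else 1 / (l * hs a l))" for l
  have w: "l * (w l)\<^sup>2 \<le> 2\<^sup>2" if "l \<ge> 0" for l
  proof (cases "l < a\<^sup>2")
    case False
    then have l: "l \<ge> a\<^sup>2" by simp
    then have l0: "l > 0" using a by (smt (verit) zero_less_power)
    have "l * (w l)\<^sup>2 = 1 / (l * (hs a l)\<^sup>2)"
      using False l0 hs_lower(1)[OF a l] by (simp add: w_def power2_eq_square divide_simps)
    also have "\<dots> \<le> 1 / (1/4)" using hs_lower(2)[OF a l] by (intro divide_left_mono) auto
    finally show ?thesis by simp
  qed (simp add: w_def)
  obtain W :: "'n famp \<Rightarrow> 'n famp" where W: "bounded_linear W" "Klinear W"
    "\<And>x. x \<in> polysK \<Longrightarrow> W x = dirac (lamK w x)" "\<And>x. norm (W x) \<le> 2 * norm x"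
    using extend_dirac_lamK[of 2 w] w by (metis zero_le_numeral)
  have hw: "l * (hs a l * w l) = (if l < a\<^sup>2 then 0 else 1)" if "l \<ge> 0" for l
  proof (cases "l < a\<^sup>2")
    case False
    then have l: "l \<ge> a\<^sup>2" by simp
    then have l0: "l > 0" using a by (smt (verit) zero_less_power)
    show ?thesis using False l0 hs_lower(1)[OF a l] by (simp add: w_def)
  qed (simp add: w_def)
  have comp: "x - dirac (lamK \<phi> (dirac (lamK \<psi> x))) = lamK (\<lambda>l. if l < a\<^sup>2 then 1 else 0) x"
    if x: "x \<in> polysK" and hw: "\<And>l. l \<ge> 0 \<Longrightarrow> l * (\<phi> l * \<psi> l) = (if l < a\<^sup>2 then 0 else 1)" for x :: "'n famp" and \<phi> \<psi>
  proof -
    have y: "lamK \<psi> x \<in> polysK" using x by auto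
    have "dirac (lamK \<phi> (dirac (lamK \<psi> x))) = lamK \<phi> (lamK (\<lambda>l. l) (lamK \<psi> x))"
      using y by (simp add: dirac_lamK polysK_dirac dirac_dirac)
    also have "\<dots> = lamK (\<lambda>l. l * (\<phi> l * \<psi> l)) x"
      using x by (simp add: diagK_diagK polysK_diagK mult_ac)
    also have "\<dots> = lamK (\<lambda>l. if l < a\<^sup>2 then 0 else 1) x"
      by (simp add: hw[OF lam_nonneg])
    finally have "lamK (\<lambda>l. if l < a\<^sup>2 then 1 else 0) x + dirac (lamK \<phi> (dirac (lamK \<psi> x)))
       = diagK (\<lambda>S \<alpha>. (if lam S \<alpha> < a\<^sup>2 then 1 else 0) + (if lam S \<alpha> < a\<^sup>2 then 0 else 1)) x"
      by (simp add: diagK_add[OF x])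
    also have "\<dots> = diagK (\<lambda>S \<alpha>. 1) x" by (intro arg_cong[where f = "\<lambda>\<Psi>. diagK \<Psi> x"]) (auto simp: fun_eq_iff)
    finally show ?thesis by (simp add: diagK_const[OF x] algebra_simps)
  qed
  have pV: "V x \<in> polysK" and pW: "W x \<in> polysK" if "x \<in> polysK" for x
    using that by (auto simp: V W)
  have id: "Klinear (\<lambda>x. x)" by (simp add: Klinear_iff)
  have "K.parametrix V W"
    unfolding K.parametrix_def
  proof (intro conjI V(2) W(2) finite_rank_of_polysK[where b = "a\<^sup>2"])
    show "bounded_linear (\<lambda>x. x - W (V x))" "bounded_linear (\<lambda>x. x - V (W x))"
      using bounded_linear_sub[OF bounded_linear_ident bounded_linear_compose[OF W(1) V(1)]]
        bounded_linear_sub[OF bounded_linear_ident bounded_linear_compose[OF V(1) W(1)]] by auto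
    show "Klinear (\<lambda>x. x - W (V x))" "Klinear (\<lambda>x. x - V (W x))"
      using K_linear_diff[OF id Klinear_comp[OF W(2) V(2)]] K_linear_diff[OF id Klinear_comp[OF V(2) W(2)]] by auto
    show "x - W (V x) = lamK (\<lambda>l. if l < a\<^sup>2 then 1 else 0) x" if "x \<in> polysK" for x
      using comp[OF that, of w "hs a"] hw that pV by (simp add: V W mult.commute)
    show "x - V (W x) = lamK (\<lambda>l. if l < a\<^sup>2 then 1 else 0) x" if "x \<in> polysK" for x
      using comp[OF that, of "hs a" w] hw that pW by (simp add: V W)
  qed
  moreover have "V (amp parity x) = - amp parity (V x)" for x
  proof (rule polysK_eq_UNIV[where F = "\<lambda>x. V (amp parity x)" and G = "\<lambda>x. - amp parity (V x)"])
    show "bounded_linear (\<lambda>x. V (amp parity x))"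
      by (rule bounded_linear_compose[OF V(1) bounded_linear_amp[OF bounded_linear_parity]])
    show "bounded_linear (\<lambda>x. - amp parity (V x))"
      by (rule bounded_linear_minus[OF bounded_linear_compose[OF bounded_linear_amp[OF bounded_linear_parity] V(1)]])
    fix x :: "'n famp" assume x: "x \<in> polysK"
    then have "amp parity x \<in> polysK" by (auto simp: polysK_def amp_def polys_parity)
    then show "V (amp parity x) = - amp parity (V x)" using x by (simp add: V dirac_lamK_parity)
  qed
  moreover have "V x \<bullet> y = x \<bullet> V y" for x y
  proof -
    have 1: "V x \<bullet> y = x \<bullet> V y" if "x \<in> polysK" "y \<in> polysK" for x y
    proof -
      have "V x \<bullet> y = lamK (hs a) x \<bullet> dirac y" using that by (simp add: V dirac_symmetric polysK_diagK)
      also have "\<dots> = x \<bullet> lamK (hs a) (dirac y)" using that by (simp add: diagK_symmetric polysK_dirac)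
      also have "\<dots> = x \<bullet> V y" using that by (simp add: V dirac_lamK)
      finally show ?thesis .
    qed
    have cV: "continuous_on UNIV V" by (rule linear_continuous_on[OF V(1)])
    have 2: "V x \<bullet> y = x \<bullet> V y" if "y \<in> polysK" for x y
    proof -
      have "closed {x. V x \<bullet> y = x \<bullet> V y}" by (intro closed_Collect_eq continuous_intros cV)
      moreover have "polysK \<subseteq> {x. V x \<bullet> y = x \<bullet> V y}" using 1 that by auto
      ultimately have "closure polysK \<subseteq> {x. V x \<bullet> y = x \<bullet> V y}" by (rule closure_minimal[rotated])
      then show ?thesis by (auto simp: polysK_dense)
    qed
    have "closed {y. V x \<bullet> y = x \<bullet> V y}" by (intro closed_Collect_eq continuous_intros cV)
    moreover have "polysK \<subseteq> {y. V x \<bullet> y = x \<bullet> V y}" using 2 by auto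
    ultimately have "closure polysK \<subseteq> {y. V x \<bullet> y = x \<bullet> V y}" by (rule closure_minimal[rotated])
    then show ?thesis by (auto simp: polysK_dense)
  qed
  ultimately show ?thesis using that V W by blast
qed

section \<open>Lipschitz approximation of operators in \<open>C1\<close>\<close>

lemma cdot_scaleR: "cdot (t *\<^sub>R v) (s *\<^sub>R v) = of_real (t * s) * cdot v v"
proof -
  have c: "(r *\<^sub>R v) $ i = of_real r * v $ i" for r i by (simp) (simp add: scaleR_conv_of_real)
  show ?thesis unfolding cdot_def c by (simp add: sum_distrib_left mult_ac)
qed

text \<open>Along a real line the phase in the Weyl relation vanishes, so these operators form a
  one-parameter group.\<close>

lemma weyl_line: "weyl (t *\<^sub>R v) (weyl (s *\<^sub>R v) x) = weyl ((t + s) *\<^sub>R v) x"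
  by (simp add: weyl_weyl cdot_scaleR Im_cdot_self scaleR_add_left)

lemma linear_weylD: "weyl z (x - y) = weyl z x - weyl z y" "weyl z 0 = 0" "weyl z (r *\<^sub>R x) = r *\<^sub>R weyl z x"
  using linear_diff[OF linear_weyl] linear_0[OF linear_weyl] linear_scale[OF linear_weyl] by metis+

lemma bounded_linear_weyl: "bounded_linear (weyl z)"
  by (rule bounded_linear_intro[of _ 1]) (simp_all add: weyl_add linear_weylD norm_weyl)

text \<open>Strong continuity holds on polynomials by the first-order expansion and in general by
  density, since Weyl operators are isometries.\<close>

lemma weyl_tendsto_0: "((\<lambda>t. weyl (t *\<^sub>R axis j c) x) \<longlongrightarrow> x) (at 0)"
proof (rule tendstoI)
  fix e :: real assume e: "e > 0"
  have "x \<in> closure polys" by (simp add: polys_dense)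
  then obtain p where p: "p \<in> polys" "dist p x < e / 3" using e closure_approachable[of x polys] by (metis zero_less_divide_iff zero_less_numeral)
  obtain C where C: "C \<ge> 0" "\<And>t::real. \<bar>t\<bar> \<le> 1/2 \<Longrightarrow> norm (weyl (t *\<^sub>R axis j c) p - p - t *\<^sub>R gen c j p) \<le> C * t\<^sup>2"
    using weyl_expansion[OF p(1)] by metis
  have "((\<lambda>t. \<bar>t\<bar> * norm (gen c j p) + C * t\<^sup>2) \<longlongrightarrow> \<bar>0\<bar> * norm (gen c j p) + C * 0\<^sup>2) (at (0::real))"
    by (intro tendsto_intros)
  then have "\<forall>\<^sub>F t in at (0::real). \<bar>t\<bar> * norm (gen c j p) + C * t\<^sup>2 < e / 3"
    using e by (intro order_tendstoD(2)) auto
  moreover have "\<forall>\<^sub>F t in at (0::real). \<bar>t\<bar> \<le> 1/2"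
    by (rule eventually_at_ball'[of "1/2" 0 UNIV, THEN eventually_mono]) (auto simp: dist_real_def)
  ultimately show "\<forall>\<^sub>F t in at 0. dist (weyl (t *\<^sub>R axis j c) x) x < e"
  proof eventually_elim
    case (elim t)
    have "weyl (t *\<^sub>R axis j c) x - x = weyl (t *\<^sub>R axis j c) (x - p) + (weyl (t *\<^sub>R axis j c) p - p - t *\<^sub>R gen c j p)
        + t *\<^sub>R gen c j p + (p - x)" by (simp add: linear_weylD)
    also have "norm \<dots> \<le> norm (x - p) + norm (weyl (t *\<^sub>R axis j c) p - p - t *\<^sub>R gen c j p) + norm (t *\<^sub>R gen c j p) + norm (p - x)"
      by (intro order_trans[OF norm_triangle_ineq] add_mono) (auto simp: norm_weyl)
    also have "\<dots> \<le> norm (x - p) + C * t\<^sup>2 + \<bar>t\<bar> * norm (gen c j p) + norm (p - x)"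
      using C(2)[OF elim(2)] by simp
    also have "\<dots> < e" using elim(1) p(2) by (simp add: dist_norm norm_minus_commute)
    finally show ?case by (simp add: dist_norm)
  qed
qed

lemma continuous_weyl_line: "continuous_on S (\<lambda>t. weyl (t *\<^sub>R axis j c) x)"
proof (rule continuous_at_imp_continuous_on, rule ballI)
  fix s
  have "((\<lambda>h. weyl (s *\<^sub>R axis j c) (weyl (h *\<^sub>R axis j c) x)) \<longlongrightarrow> weyl (s *\<^sub>R axis j c) x) (at 0)"
    by (rule bounded_linear.tendsto[OF bounded_linear_weyl weyl_tendsto_0])
  then show "isCont (\<lambda>t. weyl (t *\<^sub>R axis j c) x) s"
    unfolding weyl_line isCont_def by (rule LIM_offset_zero_cancel)
qed

lemma norm_weyl_conj_le:
  assumes "\<And>x. norm (X x) \<le> K * norm x" shows "norm (weyl_conj z X x) \<le> K * norm x"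
  using assms[of "weyl (- z) x"] by (simp add: weyl_conj_def norm_weyl)

lemma clinear_weyl: "clinear (weyl z)"
  by (simp add: clinear_iff weyl_add weyl_scale)

text \<open>The phases arising on the left and on the right are inverse to each other: conjugation
  is a genuine group action, although Weyl operators compose only up to a phase. In particular
  conjugations commute.\<close>

lemma weyl_conj_conj:
  assumes X: "clinear X" shows "weyl_conj z (weyl_conj y X) x = weyl_conj (z + y) X x"
proof -
  have "Im (cdot y z) = - Im (cdot z y)"
  proof -
    have "cdot y z = cnj (cdot z y)" by (simp add: cdot_def mult.commute)
    then show ?thesis by simp
  qed
  then have 1: "exp (- \<i> * Im (cdot (- y) (- z)) / 2) * exp (- \<i> * Im (cdot z y) / 2) = 1"
    by (simp add: cdot_minus flip: exp_add)
  have 2: "- y + - z = - (z + y)" by simp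
  show ?thesis
    unfolding weyl_conj_def weyl_weyl clinearD(2)[OF X] weyl_scale fock.scale_scale 1 2 by simp
qed

lemma continuous_weyl_conj:
  assumes X: "bounded_linear X"
  shows "continuous_on S (\<lambda>t. weyl_conj (t *\<^sub>R axis j c) X x)"
proof -
  interpret X: bounded_linear X by fact
  have W: "continuous_on S (\<lambda>t. weyl (t *\<^sub>R axis j c) y)" for y :: "'a fock" and S by (rule continuous_weyl_line)
  have c1: "continuous_on S (\<lambda>t. weyl (- (t *\<^sub>R axis j c)) y)" for y :: "'a fock" and S
    using continuous_on_compose2[OF W[of UNIV y] continuous_on_minus[OF continuous_on_id], of S] by simp
  show ?thesis
    unfolding continuous_on_def
  proof
    fix s assume "s \<in> S"
    let ?w = "\<lambda>t. weyl (- (t *\<^sub>R axis j c)) x"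
    \<comment> \<open>The first summand tends to 0 because Weyl operators are isometric; the second
      is strong continuity at a fixed vector.\<close>
    have "((\<lambda>t. weyl (t *\<^sub>R axis j c) (X (?w t) - X (?w s)) + weyl (t *\<^sub>R axis j c) (X (?w s))) \<longlongrightarrow> 0 + weyl (s *\<^sub>R axis j c) (X (?w s))) (at s within S)"
    proof (rule tendsto_add)
      have "((\<lambda>t. X (?w t) - X (?w s)) \<longlongrightarrow> X (?w s) - X (?w s)) (at s within S)"
        using c1[of S x] \<open>s \<in> S\<close> by (intro tendsto_intros X.tendsto) (simp add: continuous_on_def)
      then have "((\<lambda>t. norm (X (?w t) - X (?w s))) \<longlongrightarrow> 0) (at s within S)"
        by (simp add: tendsto_norm_zero_iff)
      then show "((\<lambda>t. weyl (t *\<^sub>R axis j c) (X (?w t) - X (?w s))) \<longlongrightarrow> 0) (at s within S)"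
        by (intro tendsto_norm_zero_cancel[of "\<lambda>t. weyl (t *\<^sub>R axis j c) (X (?w t) - X (?w s))"]) (simp add: norm_weyl)
      show "((\<lambda>t. weyl (t *\<^sub>R axis j c) (X (?w s))) \<longlongrightarrow> weyl (s *\<^sub>R axis j c) (X (?w s))) (at s within S)"
        using W[of S "X (?w s)"] \<open>s \<in> S\<close> by (simp add: continuous_on_def)
    qed
    then show "((\<lambda>t. weyl_conj (t *\<^sub>R axis j c) X x) \<longlongrightarrow> weyl_conj (s *\<^sub>R axis j c) X x) (at s within S)"
      by (simp add: weyl_conj_def linear_weylD)
  qed
qed

text \<open>The mean of the conjugates of X over the segment from 0 to d c e_j, integrated vector by
  vector, for which strong continuity is enough.\<close>

definition average :: "complex \<Rightarrow> 'n::finite \<Rightarrow> real \<Rightarrow> ('n fock \<Rightarrow> 'n fock) \<Rightarrow> 'n fock \<Rightarrow> 'n fock" where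
  "average c j d X x = (1 / d) *\<^sub>R integral {0..d} (\<lambda>t. weyl_conj (t *\<^sub>R axis j c) X x)"

context
  fixes X :: "'n::finite fock \<Rightarrow> 'n fock" and K d :: real and c :: complex and j :: 'n
  assumes X: "bounded_linear X" "clinear X" and K: "K \<ge> 0" "\<And>x. norm (X x) \<le> K * norm x" and d: "d > 0"
begin

lemma conj_integrable: "(\<lambda>t. weyl_conj (t *\<^sub>R axis j c) X x) integrable_on {a..b}"
  by (rule integrable_continuous_interval[OF continuous_weyl_conj[OF X(1)]])

lemma clinear_conj: "clinear (weyl_conj z X)"
  unfolding weyl_conj_def[abs_def] by (rule clinear_comp[OF clinear_weyl clinear_comp[OF X(2) clinear_weyl]])

lemma bounded_linear_scaleC: "bounded_linear (\<lambda>x :: 'n fock. r *\<^sub>C x)"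
  by (rule bounded_linear_intro[of _ "cmod r"]) (simp_all add: fock.scale_right_distrib scaleC_scaleR norm_scaleC mult.commute)

lemma clinear_average: "clinear (average c j d X)"
  unfolding clinear_iff
proof (intro conjI allI)
  show "average c j d X (x + y) = average c j d X x + average c j d X y" for x y
    unfolding average_def clinearD(1)[OF clinear_conj]
    by (simp add: integral_add conj_integrable scaleR_add_right)
  show "average c j d X (r *\<^sub>C x) = r *\<^sub>C average c j d X x" for r x
    using integral_linear[OF conj_integrable[of x 0 d] bounded_linear_scaleC[of r]]
    unfolding average_def clinearD(2)[OF clinear_conj] by (simp add: o_def scaleC_scaleR)
qed

lemma average_bound_aux:
  fixes g :: "real \<Rightarrow> 'n fock"
  assumes "g integrable_on {0..d}" "\<And>t. t \<in> {0..d} \<Longrightarrow> norm (g t) \<le> M" "continuous_on {0..d} g"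
  shows "norm ((1 / d) *\<^sub>R integral {0..d} g) \<le> M"
proof -
  have "norm (integral {0..d} g) \<le> M * (d - 0)" using assms d by (intro integral_bound) auto
  then show ?thesis using d by (simp add: divide_simps)
qed

lemma norm_average: "norm (average c j d X x) \<le> K * norm x"
  unfolding average_def
  by (rule average_bound_aux[OF conj_integrable norm_weyl_conj_le[OF K(2)] continuous_weyl_conj[OF X(1)]])

lemma bounded_linear_average: "bounded_linear (average c j d X)"
  by (rule bounded_linear_intro[of _ K]) (use norm_average in \<open>simp_all add: clinearD[OF clinear_average] mult.commute\<close>)

lemma average_approx:
  assumes "\<And>t x. 0 \<le> t \<Longrightarrow> t \<le> d \<Longrightarrow> norm (weyl_conj (t *\<^sub>R axis j c) X x - X x) \<le> e * norm x"
  shows "norm (average c j d X x - X x) \<le> e * norm x"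
proof -
  have "average c j d X x - X x = (1 / d) *\<^sub>R integral {0..d} (\<lambda>t. weyl_conj (t *\<^sub>R axis j c) X x - X x)"
    using d by (subst integral_diff[OF conj_integrable]) (auto simp: average_def scaleR_diff_right)
  also have "norm \<dots> \<le> e * norm x"
  proof (rule average_bound_aux)
    show "(\<lambda>t. weyl_conj (t *\<^sub>R axis j c) X x - X x) integrable_on {0..d}"
      by (intro integrable_diff conj_integrable) auto
    show "continuous_on {0..d} (\<lambda>t. weyl_conj (t *\<^sub>R axis j c) X x - X x)"
      by (intro continuous_intros continuous_weyl_conj[OF X(1)])
  qed (use assms in auto)
  finally show ?thesis .
qed

lemma conj_average: "weyl_conj z (average c j d X) x = (1 / d) *\<^sub>R integral {0..d} (\<lambda>t. weyl_conj (z + t *\<^sub>R axis j c) X x)"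
proof -
  have "weyl_conj z (average c j d X) x = (1 / d) *\<^sub>R weyl z (integral {0..d} (\<lambda>t. weyl_conj (t *\<^sub>R axis j c) X (weyl (- z) x)))"
    by (simp add: weyl_conj_def average_def linear_weylD)
  also have "weyl z (integral {0..d} (\<lambda>t. weyl_conj (t *\<^sub>R axis j c) X (weyl (- z) x)))
     = integral {0..d} (\<lambda>t. weyl z (weyl_conj (t *\<^sub>R axis j c) X (weyl (- z) x)))"
    using integral_linear[OF conj_integrable[of "weyl (- z) x" 0 d] bounded_linear_weyl[of z]] by (simp add: o_def)
  also have "(\<lambda>t. weyl z (weyl_conj (t *\<^sub>R axis j c) X (weyl (- z) x))) = (\<lambda>t. weyl_conj (z + t *\<^sub>R axis j c) X x)"
    using weyl_conj_conj[OF X(2), of z _ x] by (auto simp: weyl_conj_def)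
  finally show ?thesis .
qed

text \<open>Conjugations commute and preserve norms, so averaging does not worsen the modulus of
  continuity at any z. Lipschitz bounds won in earlier directions thus survive the treatment of the
  next one.\<close>

lemma average_modulus:
  assumes "\<And>x. norm (weyl_conj z X x - X x) \<le> e * norm x"
  shows "norm (weyl_conj z (average c j d X) x - average c j d X x) \<le> e * norm x"
proof -
  have e: "weyl_conj (z + y) X x = weyl y (weyl_conj z X (weyl (- y) x))" for y
    using weyl_conj_conj[OF X(2), of y z x] by (simp add: weyl_conj_def add.commute)
  have cz: "clinear (weyl_conj z X)" by (rule clinear_conj)
  have bz: "bounded_linear (weyl_conj z X)"
    by (rule bounded_linear_intro[of _ K]) (use norm_weyl_conj_le[OF K(2)] in \<open>simp_all add: clinearD[OF cz] mult.commute\<close>)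
  have c1: "continuous_on {0..d} (\<lambda>t. weyl_conj (z + t *\<^sub>R axis j c) X x)"
    using continuous_weyl_conj[OF bz, of "{0..d}" j c x]
    unfolding e weyl_conj_def[of _ "weyl_conj z X"] .
  have "weyl_conj z (average c j d X) x - average c j d X x
      = (1 / d) *\<^sub>R integral {0..d} (\<lambda>t. weyl_conj (z + t *\<^sub>R axis j c) X x - weyl_conj (t *\<^sub>R axis j c) X x)"
    unfolding conj_average
    by (subst integral_diff[OF integrable_continuous_interval[OF c1] conj_integrable]) (auto simp: average_def scaleR_diff_right)
  also have "norm \<dots> \<le> e * norm x"
  proof (rule average_bound_aux)
    show c2: "continuous_on {0..d} (\<lambda>t. weyl_conj (z + t *\<^sub>R axis j c) X x - weyl_conj (t *\<^sub>R axis j c) X x)"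
      by (intro continuous_intros c1 continuous_weyl_conj[OF X(1)])
    then show "(\<lambda>t. weyl_conj (z + t *\<^sub>R axis j c) X x - weyl_conj (t *\<^sub>R axis j c) X x) integrable_on {0..d}"
      by (rule integrable_continuous_interval)
    fix t
    let ?y = "t *\<^sub>R axis j c"
    have "weyl_conj (z + ?y) X x - weyl_conj ?y X x = weyl ?y (weyl_conj z X (weyl (- ?y) x) - X (weyl (- ?y) x))"
      unfolding e by (simp add: weyl_conj_def linear_weylD)
    then show "norm (weyl_conj (z + ?y) X x - weyl_conj ?y X x) \<le> e * norm x"
      using assms[of "weyl (- ?y) x"] by (simp add: norm_weyl)
  qed
  finally show ?thesis .
qed

text \<open>Conjugation by s c e_j shifts the interval of integration. For s \<ge> 0 only the pieces
  [0, s] and [d, d + s] fail to cancel, each contributing at most K s norm x.\<close>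

lemma average_lipschitz:
  "norm (weyl_conj (s *\<^sub>R axis j c) (average c j d X) x - average c j d X x) \<le> (2 * K / d) * \<bar>s\<bar> * norm x"
proof -
  let ?Y = "average c j d X"
  have pos: "norm (weyl_conj (s *\<^sub>R axis j c) ?Y x - ?Y x) \<le> (2 * K / d) * s * norm x" if s: "s \<ge> 0" for s x
  proof -
    let ?g = "\<lambda>t. weyl_conj (t *\<^sub>R axis j c) X x"
    have gi: "?g integrable_on {a..b}" for a b by (rule conj_integrable)
    have bd: "norm (integral {a..b} ?g) \<le> (K * norm x) * (b - a)" if "a \<le> b" for a b
      using that norm_weyl_conj_le[OF K(2)] by (intro integral_bound continuous_weyl_conj[OF X(1)]) auto
    have sh: "integral {0..d} (\<lambda>t. weyl_conj (s *\<^sub>R axis j c + t *\<^sub>R axis j c) X x) = integral {s..d + s} ?g"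
      using integral_shift_Icc_real[of 0 d ?g s] by (simp add: o_def scaleR_add_left)
    have "integral {0..s} ?g + integral {s..d + s} ?g = integral {0..d + s} ?g"
      using s d by (intro Henstock_Kurzweil_Integration.integral_combine gi) auto
    moreover have "integral {0..d} ?g + integral {d..d + s} ?g = integral {0..d + s} ?g"
      using s d by (intro Henstock_Kurzweil_Integration.integral_combine gi) auto
    ultimately have eq: "integral {s..d + s} ?g - integral {0..d} ?g = integral {d..d + s} ?g - integral {0..s} ?g"
      by (simp add: algebra_simps)
    have "norm (integral {d..d + s} ?g) \<le> (K * norm x) * s" "norm (integral {0..s} ?g) \<le> (K * norm x) * s"
      using bd[of d "d + s"] bd[of 0 s] s by simp_all
    then have "norm (integral {s..d + s} ?g - integral {0..d} ?g) \<le> (K * norm x) * s + (K * norm x) * s"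
      unfolding eq by (rule order_trans[OF norm_triangle_ineq4 add_mono])
    moreover have "weyl_conj (s *\<^sub>R axis j c) ?Y x - ?Y x = (1 / d) *\<^sub>R (integral {s..d + s} ?g - integral {0..d} ?g)"
      unfolding conj_average sh by (simp add: average_def scaleR_diff_right)
    ultimately have "norm (weyl_conj (s *\<^sub>R axis j c) ?Y x - ?Y x) \<le> (1 / d) * ((K * norm x) * s + (K * norm x) * s)"
      using d by (simp add: divide_right_mono)
    also have "\<dots> = (2 * K / d) * s * norm x" by simp
    finally show ?thesis .
  qed
  show ?thesis
  proof (cases "s \<ge> 0")
    case False
    \<comment> \<open>For negative s, pulling out the Weyl operator exchanges the two terms and
      reduces to - s.\<close>
    let ?z = "s *\<^sub>R axis j c"
    have "weyl_conj ?z ?Y x - ?Y x = - weyl ?z (weyl_conj (- ?z) ?Y (weyl (- ?z) x) - ?Y (weyl (- ?z) x))"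
      by (simp add: weyl_conj_def linear_weylD weyl_minus)
    then have "norm (weyl_conj ?z ?Y x - ?Y x) = norm (weyl_conj ((- s) *\<^sub>R axis j c) ?Y (weyl (- ?z) x) - ?Y (weyl (- ?z) x))"
      by (simp add: norm_weyl)
    also have "\<dots> \<le> (2 * K / d) * (- s) * norm (weyl (- ?z) x)" using False by (intro pos) simp
    finally show ?thesis using False by (simp add: norm_weyl)
  qed (use pos in simp)
qed

end

lemma C1_D:
  assumes "A \<in> C1"
  shows "bounded_linear A" "clinear A"
    "\<And>e. e > 0 \<Longrightarrow> \<exists>d>0. \<forall>z. norm z < d \<longrightarrow> (\<forall>x. norm (weyl_conj z A x - A x) \<le> e * norm x)"
proof -
  show A: "bounded_linear A" "clinear A"
    using assms by (auto simp: C1_def bounded_ops_def clinear_iff bounded_linear.linear linear_add)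
  interpret A: bounded_linear A by fact
  fix e :: real assume e: "e > 0"
  have "((\<lambda>z. onorm (\<lambda>f. weyl z (A (fock_adjoint (weyl z) f)) - A f)) \<longlongrightarrow> 0) (at 0)"
    using assms by (simp add: C1_def)
  then have "\<forall>\<^sub>F z in at 0. dist (onorm (\<lambda>f. weyl z (A (fock_adjoint (weyl z) f)) - A f)) 0 < e"
    using e by (rule tendstoD)
  then obtain d where d: "d > 0" "\<And>z. z \<noteq> 0 \<Longrightarrow> dist z 0 < d \<Longrightarrow>
      dist (onorm (\<lambda>f. weyl z (A (fock_adjoint (weyl z) f)) - A f)) 0 < e"
    unfolding eventually_at by auto
  have "norm (weyl_conj z A x - A x) \<le> e * norm x" if z: "norm z < d" for z x
  proof (cases "z = 0")
    case True
    then show ?thesis using e by (simp add: weyl_conj_def weyl_0)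
  next
    case False
    let ?f = "\<lambda>f. weyl_conj z A f - A f"
    have "bounded_linear ?f"
      unfolding weyl_conj_def
      by (rule bounded_linear_sub[OF bounded_linear_compose[OF bounded_linear_weyl
            bounded_linear_compose[OF A(1) bounded_linear_weyl]] A(1)])
    then have "norm (?f x) \<le> onorm ?f * norm x" by (rule onorm)
    also have "onorm ?f \<le> e"
      using d(2)[OF False] z by (simp add: weyl_adjoint weyl_conj_def dist_norm)
    finally show ?thesis by (simp add: mult_right_mono)
  qed
  with d(1) show "\<exists>d>0. \<forall>z. norm z < d \<longrightarrow> (\<forall>x. norm (weyl_conj z A x - A x) \<le> e * norm x)" by blast
qed

text \<open>Directions are averaged one at a time. The last clause hands the modulus of continuity
  of A down to Y, so that the length of each further segment can be chosen from A alone; every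
  direction adds an error of e.\<close>

lemma lipschitz_approximation_aux:
  fixes A :: "'n::finite fock \<Rightarrow> 'n fock"
  assumes A: "A \<in> C1" and e: "e > 0" and D: "finite D"
  shows "\<exists>Y L. bounded_linear Y \<and> clinear Y \<and> L \<ge> 0 \<and>
     (\<forall>(j, c)\<in>D. \<forall>t x. norm (weyl_conj (t *\<^sub>R axis j c) Y x - Y x) \<le> L * \<bar>t\<bar> * norm x) \<and>
     (\<forall>x. norm (Y x - A x) \<le> real (card D) * e * norm x) \<and>
     (\<forall>z h. (\<forall>x. norm (weyl_conj z A x - A x) \<le> h * norm x) \<longrightarrow> (\<forall>x. norm (weyl_conj z Y x - Y x) \<le> h * norm x))"
  using D
proof (induction rule: finite_induct)
  case empty
  show ?case using C1_D(1,2)[OF A] by (intro exI[of _ A] exI[of _ 0]) auto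
next
  case (insert v D)
  obtain j c where v: "v = (j, c)" by (cases v)
  obtain X L where X0: "bounded_linear X \<and> clinear X \<and> L \<ge> 0 \<and>
     (\<forall>(j, c)\<in>D. \<forall>t x. norm (weyl_conj (t *\<^sub>R axis j c) X x - X x) \<le> L * \<bar>t\<bar> * norm x) \<and>
     (\<forall>x. norm (X x - A x) \<le> real (card D) * e * norm x) \<and>
     (\<forall>z h. (\<forall>x. norm (weyl_conj z A x - A x) \<le> h * norm x) \<longrightarrow> (\<forall>x. norm (weyl_conj z X x - X x) \<le> h * norm x))"
    using insert.IH by (elim exE)
  have X: "bounded_linear X" "clinear X" "L \<ge> 0"
    "\<And>j c t x. (j, c) \<in> D \<Longrightarrow> norm (weyl_conj (t *\<^sub>R axis j c) X x - X x) \<le> L * \<bar>t\<bar> * norm x"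
    "\<And>x. norm (X x - A x) \<le> real (card D) * e * norm x"
    "\<And>z h x. (\<And>x. norm (weyl_conj z A x - A x) \<le> h * norm x) \<Longrightarrow> norm (weyl_conj z X x - X x) \<le> h * norm x"
    using X0 by blast+
  obtain d0 where d0: "d0 > 0" "\<And>z x. norm z < d0 \<Longrightarrow> norm (weyl_conj z A x - A x) \<le> e * norm x"
    using C1_D(3)[OF A e] by blast
  \<comment> \<open>For 0 \<le> t \<le> d the vector \<open>t *\<^sub>R axis j c\<close> then has
    norm at most d0/2; the summand 1 avoids a division by 0.\<close>
  define d where "d = d0 / (norm (axis j c :: complex^'n) + 1) / 2"
  have d: "d > 0" using d0 by (simp add: d_def add_nonneg_pos)
  obtain K where K: "K \<ge> 0" "\<And>x. norm (X x) \<le> K * norm x"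
    using bounded_linear.nonneg_bounded[OF X(1)] by (metis mult.commute)
  define Y where "Y = average c j d X"
  note avg = X(1,2) K d
  define M where "M = max L (2 * K / d)"
  have LM: "L * \<bar>t\<bar> * norm x \<le> M * \<bar>t\<bar> * norm x" "2 * K / d * \<bar>t\<bar> * norm x \<le> M * \<bar>t\<bar> * norm x" for t and x :: "'n fock"
    by (intro mult_right_mono; simp add: M_def)+
  have 1: "norm (weyl_conj z Y x - Y x) \<le> h * norm x" if "\<And>x. norm (weyl_conj z X x - X x) \<le> h * norm x" for z h x
    unfolding Y_def by (rule average_modulus[OF avg that])
  have 2: "norm (weyl_conj (t *\<^sub>R axis j' c') Y x - Y x) \<le> M * \<bar>t\<bar> * norm x" if "(j', c') \<in> insert v D" for j' c' t x
  proof (cases "(j', c') \<in> D")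
    case True
    have "norm (weyl_conj (t *\<^sub>R axis j' c') Y x - Y x) \<le> L * \<bar>t\<bar> * norm x" by (rule 1) (rule X(4)[OF True])
    then show ?thesis using LM(1) order_trans by blast
  next
    case False
    then have "j' = j" "c' = c" using that v by auto
    then show ?thesis using average_lipschitz[OF avg, of t j c x] LM(2) order_trans unfolding Y_def by blast
  qed
  have 3: "norm (Y x - A x) \<le> real (card (insert v D)) * e * norm x" for x
  proof -
    have "norm (Y x - X x) \<le> e * norm x"
      unfolding Y_def
    proof (rule average_approx[OF avg])
      fix t x assume t: "0 \<le> t" "t \<le> d"
      have "norm (t *\<^sub>R axis j c :: complex^'n) \<le> d * (norm (axis j c :: complex^'n) + 1)"
        using t by (auto intro!: mult_mono)
      also have "\<dots> = d0 / 2" using norm_ge_zero[of "axis j c :: complex^'n"] by (simp add: d_def field_simps add_nonneg_eq_0_iff)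
      also have "\<dots> < d0" using d0 by simp
      finally show "norm (weyl_conj (t *\<^sub>R axis j c) X x - X x) \<le> e * norm x"
        by (intro X(6) d0(2))
    qed
    then have "norm ((Y x - X x) + (X x - A x)) \<le> e * norm x + real (card D) * e * norm x"
      by (intro norm_triangle_mono X(5))
    then show ?thesis using insert(1,2) by (simp add: algebra_simps)
  qed
  have "bounded_linear Y" "clinear Y" unfolding Y_def by (rule bounded_linear_average[OF avg] clinear_average[OF avg])+
  moreover have "M \<ge> 0" using X(3) by (simp add: M_def)
  ultimately show ?case
    using 1 2 3 X(6) by (intro exI[of _ Y] exI[of _ M]) auto
qed

lemma lipschitz_approximation:
  fixes A :: "'n::finite fock \<Rightarrow> 'n fock"
  assumes A: "A \<in> C1" and e: "e > 0"
  obtains Y L where "bounded_linear Y" "clinear Y" "L \<ge> 0"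
    "\<And>j c t x. c \<in> {1, \<i>} \<Longrightarrow> norm (weyl_conj (t *\<^sub>R axis j c) Y x - Y x) \<le> L * \<bar>t\<bar> * norm x"
    "\<And>x. norm (Y x - A x) \<le> e * norm x"
proof -
  let ?D = "(UNIV :: 'n set) \<times> {1, \<i>}"
  have card: "card ?D > 0" by (simp add: card_gt_0_iff)
  \<comment> \<open>The 2 n real directions share the error equally.\<close>
  then have "e / card ?D > 0" using e by simp
  from lipschitz_approximation_aux[OF A this, of ?D]
  obtain Y L where Y: "bounded_linear Y" "clinear Y" "L \<ge> 0"
     "\<forall>(j, c)\<in>?D. \<forall>t x. norm (weyl_conj (t *\<^sub>R axis j c) Y x - Y x) \<le> L * \<bar>t\<bar> * norm x"
     "\<forall>x. norm (Y x - A x) \<le> real (card ?D) * (e / card ?D) * norm x" by auto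
  show ?thesis
  proof (rule that[OF Y(1-3)])
    show "norm (Y x - A x) \<le> e * norm x" for x using Y(5) card by simp
    show "norm (weyl_conj (t *\<^sub>R axis j c) Y x - Y x) \<le> L * \<bar>t\<bar> * norm x" if "c \<in> {1, \<i>}" for j c t x
      using Y(4) that by blast
  qed
qed

section \<open>Parametrices of Fredholm operators\<close>

text \<open>\<open>amp F\<close> is a direct sum of copies of F, one for each subset of the index
  set, and an expansion of F is repeated along every axis.\<close>

lemma
  fixes F :: "'n::finite fock \<Rightarrow> 'n fock"
  assumes "fock_ts.finite_rank F"
  shows finite_rank_amp: "K.finite_rank (amp F)"
    and trace_amp: "K.trace (amp F) = of_nat (CARD('n set)) * fock_ts.trace F"
proof -
  obtain C \<phi> where C: "finite C" "\<And>c. c \<in> C \<Longrightarrow> fock_ts.functional (\<phi> c)" "\<And>x. F x = (\<Sum>c\<in>C. \<phi> c x *\<^sub>C c)"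
    using fock_ts.finite_rank_expansion[OF assms] by metis
  let ?I = "(UNIV :: 'n set set) \<times> C"
  let ?\<phi> = "\<lambda>i (x :: 'n famp). \<phi> (snd i) (x $ fst i)" and ?v = "\<lambda>i :: 'n set \<times> 'n fock. axis (fst i) (snd i)"
  have 1: "finite ?I" using C by simp
  have 2: "K.functional (?\<phi> i)" if "i \<in> ?I" for i
    using C(2)[of "snd i"] that by (auto simp: K.functional_def fock_ts.functional_def scaleK_def)
  have 3: "amp F x = (\<Sum>i\<in>?I. scaleK (?\<phi> i x) (?v i))" for x
  proof -
    have "(\<Sum>i\<in>?I. scaleK (?\<phi> i x) (?v i)) = (\<Sum>S\<in>UNIV. \<Sum>c\<in>C. scaleK (\<phi> c (x $ S)) (axis S c))"
      by (simp add: sum.cartesian_product split_beta)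
    moreover have "\<dots> $ T = (\<Sum>S\<in>UNIV. if S = T then F (x $ S) else 0)" for T
      unfolding sum_component by (intro sum.cong refl) (auto simp: scaleK_def axis_def C(3))
    ultimately show ?thesis by (simp add: vec_eq_iff amp_def)
  qed
  show "K.finite_rank (amp F)" by (rule K.finite_rank_sumI[OF 1 2 3])
  have "K.trace (amp F) = (\<Sum>i\<in>?I. ?\<phi> i (?v i))" by (rule K.trace_sum[OF 1 2 3])
  also have "\<dots> = (\<Sum>S\<in>(UNIV :: 'n set set). \<Sum>c\<in>C. \<phi> c c)"
    by (subst sum.cartesian_product) (auto intro!: sum.cong)
  also have "(\<Sum>c\<in>C. \<phi> c c) = fock_ts.trace F"
    by (rule fock_ts.trace_sum[OF C, symmetric])
  finally show "K.trace (amp F) = of_nat (CARD('n set)) * fock_ts.trace F" by simp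
qed

lemma
  fixes T B :: "'n::finite fock \<Rightarrow> 'n fock"
  assumes "fock_ts.parametrix T B"
  shows parametrix_amp: "K.parametrix (amp T) (amp B)"
    and pindex_amp: "K.pindex (amp T) (amp B) = of_nat (CARD('n set)) * fock_ts.pindex T B"
proof -
  have e: "(\<lambda>x. x - amp B (amp T x)) = amp (\<lambda>x. x - B (T x))" "(\<lambda>x. x - amp T (amp B x)) = amp (\<lambda>x. x - T (B x))"
    by (auto simp: amp_def vec_eq_iff)
  have a: "clinear T" "clinear B" "fock_ts.finite_rank (\<lambda>x. x - B (T x))" "fock_ts.finite_rank (\<lambda>x. x - T (B x))"
    using assms by (simp_all add: fock_ts.parametrix_def)
  show "K.parametrix (amp T) (amp B)"
    unfolding K.parametrix_def e by (intro conjI Klinear_amp finite_rank_amp a)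
  show "K.pindex (amp T) (amp B) = of_nat (CARD('n set)) * fock_ts.pindex T B"
    unfolding K.pindex_def fock_ts.pindex_def e trace_amp[OF a(3)] trace_amp[OF a(4)] by (simp add: algebra_simps)
qed

lemma quotient_basis_independent:
  assumes "quotient_basis (range A) C" "0 \<in> range A"
  shows "finite C" "fock.independent C"
proof -
  show "finite C" using assms by (simp add: quotient_basis_def)
  then show "fock.independent C"
    using assms fock.dependent_finite[of C] by (auto simp: quotient_basis_def)
qed

lemma fock_subspace_kernel: "clinear A \<Longrightarrow> fock.subspace (kernel A)"
  by (auto simp: kernel_def fock.subspace_def clinearD)

text \<open>The parametrix is the inverse of the bijection \<open>(x, u) \<mapsto> A x + u\<close> from
  \<open>(ker A)\<^sup>\<bottom> \<times> span C\<close> onto the whole space, which is bounded by the open mapping theorem.\<close>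

lemma fredholm_parametrix:
  fixes A :: "'n::finite fock \<Rightarrow> 'n fock"
  assumes A: "bounded_linear A" "clinear A" and ker: "finite_dim (kernel A)" and C: "quotient_basis (range A) C"
  obtains B where "bounded_linear B" "fock_ts.parametrix A B"
    "\<And>x. A (B (A x)) = A x" "\<And>x. A x = 0 \<Longrightarrow> B (A x) = 0"
    "range (\<lambda>x. x - B (A x)) = kernel A"
    "fock_ts.pindex A B = of_nat (fock.dim (kernel A)) - of_nat (card C)"
proof -
  let ?N = "kernel A"
  interpret A: bounded_linear A by fact
  have N: "fock.subspace ?N" by (rule fock_subspace_kernel[OF A(2)])
  have "0 \<in> range A" using A.zero by (metis rangeI)
  note Cf = quotient_basis_independent[OF C this]
  obtain B0 where B0: "finite B0" "?N \<subseteq> fock.span B0" using ker by (auto simp: finite_dim_def)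
  obtain B1 where B1: "B1 \<subseteq> ?N" "fock.independent B1" "?N \<subseteq> fock.span B1" "card B1 = fock.dim ?N"
    using fock.basis_exists[of ?N] by blast
  have fB1: "finite B1" using fock.independent_span_bound[OF B0(1) B1(2)] B1(1) B0(2) by auto
  have sB1: "fock.span B1 = ?N" using B1 N by (metis fock.span_minimal subset_antisym)
  obtain R where R: "finite R" "?N = span R" using fock_cis.span_eq_real_span[OF fB1] sB1 by metis
  obtain p where p: "\<And>x. p x \<in> ?N" "\<And>x y. y \<in> ?N \<Longrightarrow> (x - p x) \<bullet> y = 0"
    using orthogonal_projection_span[OF R(1)] unfolding R(2) by metis
  define X where "X = {(x, u). (\<forall>k\<in>?N. x \<bullet> k = 0) \<and> u \<in> fock.span C}"
  define f where "f = (\<lambda>(x, u). A x + u)"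
  have fb: "bounded_linear f"
    unfolding f_def split_beta
    by (intro bounded_linear_add bounded_linear_compose[OF A(1)] bounded_linear_fst bounded_linear_snd)
  have X: "subspace X"
  proof -
    have memX: "z \<in> X \<longleftrightarrow> (\<forall>k\<in>?N. fst z \<bullet> k = 0) \<and> snd z \<in> fock.span C" for z
      by (cases z) (simp add: X_def)
    have sC: "subspace (fock.span C)" by (rule real_subspace[OF fock.subspace_span])
    show ?thesis
      by (rule subspaceI)
         (simp_all add: memX inner_add_left subspace_0[OF sC] subspace_add[OF sC] subspace_scale[OF sC])
  qed
  have cX: "closed X"
  proof -
    have "X = (\<Inter>k\<in>?N. {z. fst z \<bullet> k = 0}) \<inter> {z. snd z \<in> fock.span C}"
      by (auto simp: X_def)
    moreover have "closed (\<Inter>k\<in>?N. {z :: 'n fock \<times> 'n fock. fst z \<bullet> k = 0})"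
      by (intro closed_INT ballI closed_Collect_eq continuous_intros)
    moreover have "closed {z :: 'n fock \<times> 'n fock. snd z \<in> fock.span C}"
      using closed_vimage[OF fock_cis.closed_span_finite_complex[OF Cf(1)] continuous_on_snd[OF continuous_on_id]]
      by (simp add: vimage_def)
    ultimately show ?thesis by (auto intro: closed_Int)
  qed
  have surj: "\<exists>z\<in>X. f z = y" for y
  proof -
    obtain u where "y - (\<Sum>b\<in>C. u b *\<^sub>C b) \<in> range A" using C unfolding quotient_basis_def by blast
    then obtain x where x: "y - (\<Sum>b\<in>C. u b *\<^sub>C b) = A x" by blast
    have "A (x - p x) = A x" using p(1)[of x] by (simp add: A.diff kernel_def)
    then have "f (x - p x, \<Sum>b\<in>C. u b *\<^sub>C b) = y" using x by (simp add: f_def algebra_simps)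
    moreover have "(x - p x, \<Sum>b\<in>C. u b *\<^sub>C b) \<in> X"
      by (auto simp: X_def p intro!: fock.span_sum fock.span_scale intro: fock.span_base)
    ultimately show ?thesis by blast
  qed
  have inj: "x = x' \<and> u = u'" if xu: "(x, u) \<in> X" "(x', u') \<in> X" "A x + u = A x' + u'" for x u x' u'
  proof -
    have "u - u' \<in> fock.span C" using xu by (auto simp: X_def intro: fock.span_diff)
    then obtain w where w: "u - u' = (\<Sum>b\<in>C. w b *\<^sub>C b)" using Cf(1) by (auto simp: fock.span_finite)
    have "u - u' = A (x' - x)" using xu(3) by (simp add: A.diff algebra_simps)
    then have "\<forall>b\<in>C. w b = 0" using C w by (auto simp: quotient_basis_def)
    then have u: "u = u'" using w by simp
    then have "x - x' \<in> ?N" using xu(3) by (simp add: kernel_def A.diff)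
    then have "(x - x') \<bullet> (x - x') = 0" using xu(1,2) by (auto simp: X_def inner_diff_left)
    then show ?thesis using u by simp
  qed
  obtain c where c: "c > 0" "\<And>y. \<exists>z\<in>X. f z = y \<and> norm z \<le> c * norm y"
    using open_mapping_bound[OF fb X cX] surj by (metis (no_types, lifting) UNIV_eq_I imageI)
  then obtain g where g: "\<And>y. g y \<in> X" "\<And>y. f (g y) = y" "\<And>y. norm (g y) \<le> c * norm y" by metis
  define B where "B y = fst (g y)" for y
  define Q where "Q y = snd (g y)" for y
  have BQ: "(B y, Q y) \<in> X" "A (B y) + Q y = y" for y
    using g(1,2)[of y] by (auto simp: B_def Q_def f_def split_beta)
  have uniq: "B y = x \<and> Q y = u" if "(x, u) \<in> X" "A x + u = y" for x u y
    using inj[OF BQ(1) that(1)] BQ(2)[of y] that(2) by auto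
  have add: "B (y + y') = B y + B y' \<and> Q (y + y') = Q y + Q y'" for y y'
  proof (rule uniq)
    show "(B y + B y', Q y + Q y') \<in> X" using subspace_add[OF X BQ(1) BQ(1)] by simp
    show "A (B y + B y') + (Q y + Q y') = y + y'" using BQ(2)[of y] BQ(2)[of y'] by (simp add: A.add algebra_simps)
  qed
  have scl: "B (r *\<^sub>C y) = r *\<^sub>C B y \<and> Q (r *\<^sub>C y) = r *\<^sub>C Q y" for r y
  proof (rule uniq)
    have "(r *\<^sub>C B y) \<bullet> k = 0" if k: "k \<in> ?N" for k
    proof -
      have "cnj r *\<^sub>C k \<in> ?N" using N k by (simp add: fock.subspace_scale)
      then have "B y \<bullet> (cnj r *\<^sub>C k) = 0" using BQ(1)[of y] by (auto simp: X_def)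
      then show ?thesis by (simp add: inner_scale_right)
    qed
    then show "(r *\<^sub>C B y, r *\<^sub>C Q y) \<in> X" using BQ(1)[of y] by (auto simp: X_def intro: fock.span_scale)
    show "A (r *\<^sub>C B y) + r *\<^sub>C Q y = r *\<^sub>C y"
      using BQ(2)[of y] by (simp add: clinearD[OF A(2)] flip: fock.scale_right_distrib)
  qed
  have Bl: "clinear B" "clinear Q" using add scl by (simp_all add: clinear_iff)
  have Bb: "bounded_linear B"
  proof (rule bounded_linear_intro[of _ c])
    show "norm (B y) \<le> norm y * c" for y
      using g(3)[of y] norm_fst_le[of "fst (g y)" "snd (g y)"] by (simp add: B_def mult.commute) 
  qed (simp_all add: clinearD[OF Bl(1)])
  \<comment> \<open>Thus 1 - B A is the orthogonal projection onto the kernel, and 1 - A B is the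
    projection Q onto the span of C along the range of A. Their traces are the two dimensions in the
    index.\<close>
  have BA: "B (A x) = x - p x" "Q (A x) = 0" for x
  proof -
    have "(x - p x, 0) \<in> X" by (simp add: X_def p fock.span_zero)
    moreover have "A (x - p x) + 0 = A x" using p(1)[of x] by (simp add: A.diff kernel_def)
    ultimately show "B (A x) = x - p x" "Q (A x) = 0" using uniq by blast+
  qed
  have ABA: "A (B (A x)) = A x" for x using BQ(2)[of "A x"] BA(2)[of x] by simp
  let ?P = "\<lambda>x. x - B (A x)" and ?Q = "\<lambda>x. x - A (B x)"
  have QQ: "?Q = Q" using BQ(2) by (auto simp: fun_eq_iff algebra_simps)
  have B0': "B 0 = 0" by (rule clinearD(4)[OF Bl(1)])
  have Pid: "?P (?P x) = ?P x" for x by (simp add: A.diff ABA clinearD[OF Bl(1)])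
  have rP: "range ?P = ?N"
  proof
    show "range ?P \<subseteq> ?N" using p(1) by (auto simp: BA)
    show "?N \<subseteq> range ?P"
    proof
      fix k assume "k \<in> ?N"
      then have "?P k = k" by (simp add: kernel_def B0')
      then show "k \<in> range ?P" by (rule range_eqI[OF sym])
    qed
  qed
  have Qid: "Q u = u" if "u \<in> fock.span C" for u
  proof -
    have "(0, u) \<in> X" using that by (simp add: X_def)
    then show ?thesis using uniq[of 0 u u] by (simp add: A.zero)
  qed
  have Qr: "Q y \<in> fock.span C" for y using BQ(1)[of y] by (auto simp: X_def)
  have rQ: "range Q = fock.span C"
  proof
    show "range Q \<subseteq> fock.span C" using Qr by auto
    show "fock.span C \<subseteq> range Q" proof
      fix u assume "u \<in> fock.span C"
      then have "Q u = u" by (rule Qid)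
      then show "u \<in> range Q" by (rule range_eqI[OF sym])
    qed
  qed
  have frP: "fock_ts.finite_rank ?P"
  proof (rule fock_ts.finite_rank_cong_span[OF _ fB1])
    show "clinear ?P" by (rule clinear_diff[OF clinear_id clinear_comp[OF Bl(1) A(2)]])
    show "?P x \<in> fock.span B1" for x using rP sB1 by blast
  qed
  have frQ: "fock_ts.finite_rank ?Q"
    unfolding QQ using fock_ts.finite_rank_cong_span[OF Bl(2) Cf(1) Qr] .
  have "fock_ts.trace ?P = of_nat (fock.dim ?N)"
    using fock_ts.trace_idempotent[OF frP Pid] rP by simp
  moreover have "fock_ts.trace ?Q = of_nat (card C)"
  proof -
    have "fock_ts.trace Q = of_nat (fock.dim (range Q))"
      by (rule fock_ts.trace_idempotent) (use frQ QQ in simp, rule Qid[OF Qr])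
    then show ?thesis
      unfolding QQ rQ using fock.dim_span_eq_card_independent[OF Cf(2)] by simp
  qed
  ultimately have idx: "fock_ts.pindex A B = of_nat (fock.dim ?N) - of_nat (card C)"
    by (simp add: fock_ts.pindex_def)
  have par: "fock_ts.parametrix A B"
    unfolding fock_ts.parametrix_def using A(2) Bl(1) frP frQ by blast
  show ?thesis
    by (rule that[OF Bb par ABA _ rP idx]) (simp add: B0')
qed

text \<open>\<open>pindex\<close> is independent of the parametrix, so any two quotient bases of the
  range have the same cardinality. This gives the \<open>THE\<close> in \<open>codim\<close> its
  value.\<close>

lemma pindex_eq_fredholm_index:
  fixes A :: "'n::finite fock \<Rightarrow> 'n fock"
  assumes A: "fredholm A"
  obtains B where "bounded_linear B" "fock_ts.parametrix A B"
    "\<And>x. A (B (A x)) = A x" "range (\<lambda>x. x - B (A x)) = kernel A"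
    "fock_ts.pindex A B = of_int (fredholm_index A)"
proof -
  have a: "bounded_linear A" "clinear A" "finite_dim (kernel A)"
    using A by (auto simp: fredholm_def bounded_ops_def clinear_iff bounded_linear.linear linear_add)
  obtain C where C: "quotient_basis (range A) C" using A by (auto simp: fredholm_def finite_codim_def)
  have card: "card C' = card C" if C': "quotient_basis (range A) C'" for C'
  proof -
    obtain B where "fock_ts.parametrix A B" "fock_ts.pindex A B = of_nat (fock.dim (kernel A)) - of_nat (card C)"
      using fredholm_parametrix[OF a C] by metis
    moreover obtain B' where "fock_ts.parametrix A B'" "fock_ts.pindex A B' = of_nat (fock.dim (kernel A)) - of_nat (card C')"
      using fredholm_parametrix[OF a C'] by metis
    ultimately have "complex_of_nat (card C') = of_nat (card C)" using fock_ts.pindex_unique[of A B B'] by simp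
    then show ?thesis by (simp only: of_nat_eq_iff)
  qed
  have codim: "codim (range A) = card C"
    unfolding codim_def
  proof (rule the_equality)
    show "\<exists>B. quotient_basis (range A) B \<and> card B = card C" using C by blast
    show "k = card C" if "\<exists>B. quotient_basis (range A) B \<and> card B = k" for k using that card by blast
  qed
  obtain B where B: "bounded_linear B" "fock_ts.parametrix A B"
    "\<And>x. A (B (A x)) = A x" "range (\<lambda>x. x - B (A x)) = kernel A"
    "fock_ts.pindex A B = of_nat (fock.dim (kernel A)) - of_nat (card C)"
    by (rule fredholm_parametrix[OF a C]) blast
  show ?thesis
    by (rule that[OF B(1-4)]) (simp add: B(5) fredholm_index_def codim)
qed

section \<open>Even operators\<close>

definition even_part :: "'n::finite fock \<Rightarrow> 'n fock" where "even_part x = (1/2) *\<^sub>R (x + parity x)"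
definition odd_part :: "'n::finite fock \<Rightarrow> 'n fock" where "odd_part x = (1/2) *\<^sub>R (x - parity x)"

lemma parts_sum: "even_part x + odd_part x = x"
  by (simp add: even_part_def odd_part_def algebra_simps flip: scaleR_add_left)

lemma parts_idem: "even_part (even_part x) = even_part x" "odd_part (odd_part x) = odd_part x"
  "even_part (odd_part x) = 0" "odd_part (even_part x) = 0"
  by (simp_all add: even_part_def odd_part_def clinearD[OF clinear_parity] parity_parity algebra_simps flip: scaleR_add_left)

lemma clinear_parts: "clinear even_part" "clinear odd_part"
  by (simp_all add: clinear_iff even_part_def odd_part_def clinearD[OF clinear_parity]
      scaleR_add_right scaleR_diff_right scaleC_scaleR fock.scale_right_distrib fock.scale_right_diff_distrib)

lemma norm_parts: "norm (even_part x) \<le> norm x" "norm (odd_part x) \<le> norm x"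
proof -
  have "norm (x + parity x) \<le> norm x + norm x" by (rule order_trans[OF norm_triangle_ineq]) (simp add: norm_parity)
  then show "norm (even_part x) \<le> norm x" by (simp add: even_part_def)
  have "norm (x - parity x) \<le> norm x + norm x" by (rule order_trans[OF norm_triangle_ineq4]) (simp add: norm_parity)
  then show "norm (odd_part x) \<le> norm x" by (simp add: odd_part_def)
qed

text \<open>For complementary projections \<open>p\<close>, \<open>q\<close> commuting with \<open>A\<close>, the corner of \<open>A\<close> in the range of \<open>p\<close>,
  extended by the identity on the range of \<open>q\<close>.\<close>

lemma corner_parametrix:
  fixes A B p q :: "'n::finite fock \<Rightarrow> 'n fock"
  assumes p: "clinear p" "\<And>x. p (p x) = p x" and q: "clinear q" "\<And>x. q (q x) = q x"
    and pq: "\<And>x. p (q x) = 0" "\<And>x. q (p x) = 0" "\<And>x. p x + q x = x"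
    and Ap: "\<And>x. A (p x) = p (A x)"
    and par: "fock_ts.parametrix A B" and ABA: "\<And>x. A (B (A x)) = A x"
    and rP: "range (\<lambda>x. x - B (A x)) = kernel A"
  defines "T \<equiv> \<lambda>x. A (p x) + q x" and "C \<equiv> \<lambda>x. p (B (p x)) + q x"
  shows "fock_ts.parametrix T C" "fock_ts.pindex T C \<in> \<int>"
    "fock_ts.pindex T C = fock_ts.trace (\<lambda>x. p x - B (A (p x))) - fock_ts.trace (\<lambda>x. p x - A (B (p x)))"
proof -
  have A: "clinear A" and B: "clinear B" and fr: "fock_ts.finite_rank (\<lambda>x. x - B (A x))" "fock_ts.finite_rank (\<lambda>x. x - A (B x))"
    using par by (auto simp: fock_ts.parametrix_def)
  note lin = clinearD[OF A] clinearD[OF B] clinearD[OF p(1)] clinearD[OF q(1)]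
  define P where "P = (\<lambda>x. x - B (A x))"
  define Q where "Q = (\<lambda>x. x - A (B x))"
  have frPQ: "fock_ts.finite_rank P" "fock_ts.finite_rank Q" using fr by (simp_all add: P_def Q_def)
  have PQ: "clinear P" "clinear Q" using frPQ by (simp_all add: fock_ts.finite_rank_def)
  have e1: "x - C (T x) = p (P (p x))" for x
  proof -
    have "p (T x) = A (p x)" by (simp add: T_def lin Ap p(2) pq)
    moreover have "q (T x) = q x" by (simp add: T_def lin Ap q(2) pq)
    ultimately have "C (T x) = p (B (A (p x))) + q x" by (simp add: C_def)
    then have "x - C (T x) = p x - p (B (A (p x)))" using pq(3)[of x] by (simp add: algebra_simps)
    then show ?thesis by (simp add: P_def lin p(2))
  qed
  have e2: "x - T (C x) = p (Q (p x))" for x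
  proof -
    have "p (C x) = p (B (p x))" by (simp add: C_def lin p(2) pq)
    moreover have "q (C x) = q x" by (simp add: C_def lin q(2) pq)
    ultimately have "T (C x) = A (p (B (p x))) + q x" by (simp only: T_def)
    then have "T (C x) = p (A (B (p x))) + q x" by (simp only: Ap)
    then have "x - T (C x) = p x - p (A (B (p x)))" using pq(3)[of x] by (simp add: algebra_simps)
    then show ?thesis by (simp add: Q_def lin p(2))
  qed
  have pPp: "fock_ts.finite_rank (\<lambda>x. P (p x))" "fock_ts.finite_rank (\<lambda>x. Q (p x))"
    by (rule fock_ts.finite_rank_comp_right[OF _ p(1)], fact)+
  have f: "fock_ts.finite_rank (\<lambda>x. p (P (p x)))" "fock_ts.finite_rank (\<lambda>x. p (Q (p x)))"
    by (rule fock_ts.finite_rank_comp_left[OF _ p(1)], fact)+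
  have T: "clinear T" unfolding T_def by (intro clinear_add clinear_comp[OF A p(1)] q(1))
  have C: "clinear C" unfolding C_def by (intro clinear_add clinear_comp[OF p(1) clinear_comp[OF B p(1)]] q(1))
  show "fock_ts.parametrix T C"
    unfolding fock_ts.parametrix_def e1 e2 using T C f by blast
  have idx: "fock_ts.pindex T C = fock_ts.trace (\<lambda>x. p (P (p x))) - fock_ts.trace (\<lambda>x. p (Q (p x)))"
    by (simp add: fock_ts.pindex_def e1 e2)
  have "fock_ts.trace (\<lambda>x. p (P (p x))) = fock_ts.trace (\<lambda>x. P (p (p x)))"
    "fock_ts.trace (\<lambda>x. p (Q (p x))) = fock_ts.trace (\<lambda>x. Q (p (p x)))"
    using fock_ts.trace_commute[OF pPp(1) p(1)] fock_ts.trace_commute[OF pPp(2) p(1)] by auto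
  then show "fock_ts.pindex T C = fock_ts.trace (\<lambda>x. p x - B (A (p x))) - fock_ts.trace (\<lambda>x. p x - A (B (p x)))"
    by (simp add: idx p(2)) (simp add: P_def Q_def)
  have AP: "A (P x) = 0" for x by (simp add: P_def lin ABA)
  have Pk: "P x = x" if "A x = 0" for x using that by (simp add: P_def lin)
  \<comment> \<open>The kernel of A is invariant under p and P is the identity on it, so the
    compression of P by p is idempotent and its trace is a dimension.\<close>
  have id1: "p (P (p (p (P (p x))))) = p (P (p x))" for x
  proof -
    have "A (p (P (p x))) = 0" by (simp add: Ap AP lin)
    then have "P (p (P (p x))) = p (P (p x))" by (rule Pk)
    then show ?thesis by (simp add: p(2))
  qed
  have QA: "Q (A x) = 0" for x by (simp add: Q_def ABA)
  have Aq: "A (q x) = q (A x)" for x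
  proof -
    have "A (p x + q x) = p (A x) + q (A x)" by (simp add: pq(3))
    then show ?thesis by (simp add: lin Ap)
  qed
  \<comment> \<open>The range of A is invariant under q and annihilated by Q; this is what makes the
    compression of Q by p idempotent.\<close>
  have Qq: "Q (q (x - Q x)) = 0" for x
  proof -
    have "q (x - Q x) = A (q (B x))" by (simp add: Q_def Aq)
    then show ?thesis by (simp add: QA)
  qed
  have id2: "p (Q (p (p (Q (p x))))) = p (Q (p x))" for x
  proof -
    have "Q (q (p x)) = Q (q (Q (p x)))"
      using Qq[of "p x"] by (simp add: clinearD[OF PQ(2)] lin)
    then have 0: "Q (q (Q (p x))) = 0" by (simp add: pq clinearD[OF PQ(2)])
    have "Q (p (Q (p x))) + Q (q (Q (p x))) = Q (Q (p x))"
      by (simp add: pq(3) flip: clinearD(1)[OF PQ(2)])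
    moreover have "Q (Q y) = Q y" for y
    proof -
      have "Q (y - Q y) = 0" using QA[of "B y"] by (simp add: Q_def)
      then show ?thesis by (simp add: clinearD[OF PQ(2)])
    qed
    ultimately have "Q (p (Q (p x))) = Q (p x)" using 0 by simp
    then show ?thesis by (simp add: p(2))
  qed
  show "fock_ts.pindex T C \<in> \<int>"
    unfolding idx fock_ts.trace_idempotent[OF f(1) id1] fock_ts.trace_idempotent[OF f(2) id2] by simp
qed

text \<open>Half of e pays for the commutator with the Lipschitz approximation Y. The other half
  pays for replacing A by Y on both sides of V: as V has norm at most 4, each replacement costs 4
  e/16.\<close>

lemma odd_operator_commutator_small:
  fixes A :: "'n::finite fock \<Rightarrow> 'n fock"
  assumes A: "A \<in> C1" and e: "e > 0"
  obtains V W :: "'n famp \<Rightarrow> 'n famp" where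
    "bounded_linear V" "bounded_linear W" "\<And>x. norm (W x) \<le> 2 * norm x"
    "\<And>x. V (amp parity x) = - amp parity (V x)" "K.parametrix V W"
    "\<And>x. norm (V (amp A x) - amp A (V x)) \<le> e * norm x"
proof -
  have "e / 16 > 0" using e by simp
  from lipschitz_approximation[OF A this]
  obtain Y L where Y: "bounded_linear Y" "clinear Y" "L \<ge> 0"
    "\<And>j c t x. c \<in> {1, \<i>} \<Longrightarrow> norm (weyl_conj (t *\<^sub>R axis j c) Y x - Y x) \<le> L * \<bar>t\<bar> * norm x"
    "\<And>x. norm (Y x - A x) \<le> e / 16 * norm x" by metis
  define M where "M = 2 * L * CARD('n) * CARD('n set)"
  have M: "M \<ge> 0" using Y(3) by (simp add: M_def)
  \<comment> \<open>Makes the bound 5/2 M / a from \<open>hs_commutator\<close> at most e/2; the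
    summand 1 keeps a positive when M = 0.\<close>
  define a where "a = 5 * M / e + 1"
  have a: "a > 0" using M e by (simp add: a_def add_nonneg_pos)
  have aM: "5 / 2 * M / a \<le> e / 2"
  proof -
    have "5 * M \<le> e * a" using e by (simp add: a_def distrib_left)
    then show ?thesis using a by (simp add: divide_le_eq field_simps)
  qed
  obtain V W :: "'n famp \<Rightarrow> 'n famp" where V: "bounded_linear V" "Klinear V" "bounded_linear W" "Klinear W"
    "\<And>x. x \<in> polysK \<Longrightarrow> V x = dirac (lamK (hs a) x)"
    "\<And>x. norm (V x) \<le> 4 * norm x" "\<And>x. norm (W x) \<le> 2 * norm x"
    "\<And>x. V (amp parity x) = - amp parity (V x)"
    "\<And>x y. V x \<bullet> y = x \<bullet> V y"
    "K.parametrix V W"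
    using odd_fredholm_operator[OF a] by blast
  interpret V: bounded_linear V by (rule V(1))
  have YK: "norm (V (amp Y y) - amp Y (V y)) \<le> e / 2 * norm y" for y
  proof (rule norm_le_of_inner_le_dense[where E = polysK and E' = polysK])
    show "bounded_linear (\<lambda>y. V (amp Y y) - amp Y (V y))"
      by (intro bounded_linear_sub bounded_linear_compose[OF V(1) bounded_linear_amp[OF Y(1)]]
          bounded_linear_compose[OF bounded_linear_amp[OF Y(1)] V(1)])
    show "(V (amp Y y) - amp Y (V y)) \<bullet> x \<le> e / 2 * norm y * norm x" if y: "y \<in> polysK" and x: "x \<in> polysK" for x y
    proof -
      have "(V (amp Y y) - amp Y (V y)) \<bullet> x = V x \<bullet> amp Y y - x \<bullet> amp Y (V y)"
        unfolding V(9)[of x "amp Y y"] by (subst inner_commute) (rule inner_diff_right)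
      also have "\<dots> = dirac (lamK (hs a) x) \<bullet> amp Y y - x \<bullet> amp Y (dirac (lamK (hs a) y))"
        by (simp only: V(5)[OF x] V(5)[OF y])
      also have "\<dots> \<le> (5 / 2 * M / a) * norm x * norm y"
        using hs_commutator[OF Y(2) M _ Y(1) a x y] dirac_commutator_bound[OF Y(1,2,3,4)]
        unfolding M_def by (meson abs_le_D1)
      also have "\<dots> \<le> e / 2 * norm x * norm y" using aM by (intro mult_right_mono) auto
      finally show ?thesis by (simp add: mult_ac)
    qed
  qed (use e polysK_dense in auto)
  have comm: "norm (V (amp A x) - amp A (V x)) \<le> e * norm x" for x
  proof -
    have d: "norm (amp Y z - amp A z) \<le> e / 16 * norm z" for z
    proof -
      have "norm (amp (\<lambda>x. Y x - A x) z) \<le> e / 16 * norm z" using Y(5) e by (intro norm_amp_le) auto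
      moreover have "amp (\<lambda>x. Y x - A x) z = amp Y z - amp A z" by (simp add: amp_def vec_eq_iff)
      ultimately show ?thesis by simp
    qed
    have "V (amp A x) - amp A (V x) = (V (amp Y x) - amp Y (V x)) - V (amp Y x - amp A x) + (amp Y (V x) - amp A (V x))"
      by (simp add: V.diff)
    also have "norm \<dots> \<le> e / 2 * norm x + 4 * (e / 16 * norm x) + e / 16 * (4 * norm x)"
    proof -
      have n: "norm (u - v + w) \<le> norm u + norm v + norm w" for u v w :: "'n famp"
        by (intro order_trans[OF norm_triangle_ineq] add_right_mono norm_triangle_ineq4)
      have "norm (V (amp Y x - amp A x)) \<le> 4 * (e / 16 * norm x)"
        using V(6)[of "amp Y x - amp A x"] d[of x] by linarith
      moreover have "norm (amp Y (V x) - amp A (V x)) \<le> e / 16 * (4 * norm x)"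
        using d[of "V x"] mult_left_mono[OF V(6)[of x], of "e / 16"] e by linarith
      ultimately show ?thesis using n YK[of x] by (meson add_mono order_trans)
    qed
    also have "\<dots> = e * norm x" by simp
    finally show ?thesis .
  qed
  show thesis
    by (rule that[OF V(1,3,7,8,10) comm])
qed

theorem theorem3p7:
  fixes A :: "'n::finite fock \<Rightarrow> 'n fock"
  assumes "A \<in> C1"
    and "parity \<circ> A \<circ> parity = A"
    and "fredholm A"
  shows "even (fredholm_index A)"
proof -
  obtain B where B: "bounded_linear B" "fock_ts.parametrix A B"
    "\<And>x. A (B (A x)) = A x" "range (\<lambda>x. x - B (A x)) = kernel A"
    "fock_ts.pindex A B = of_int (fredholm_index A)"
    using pindex_eq_fredholm_index[OF assms(3)] by blast
  have A: "bounded_linear A" "clinear A" using C1_D(1,2)[OF assms(1)] by auto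
  have Bl: "clinear B" using B(2) by (simp add: fock_ts.parametrix_def)
  have fr: "fock_ts.finite_rank (\<lambda>x. x - B (A x))" "fock_ts.finite_rank (\<lambda>x. x - A (B x))"
    using B(2) by (auto simp: fock_ts.parametrix_def)
  have Apar: "A (parity x) = parity (A x)" for x
  proof -
    have "parity (A (parity x)) = A x" using fun_cong[OF assms(2), of x] by (simp add: o_def)
    then show ?thesis using parity_parity by metis
  qed
  have Ae: "A (even_part x) = even_part (A x)" and Ao: "A (odd_part x) = odd_part (A x)" for x
    by (simp_all add: even_part_def odd_part_def clinearD[OF A(2)] Apar)
  define T1 where "T1 = (\<lambda>x. A (even_part x) + odd_part x)"
  define T2 where "T2 = (\<lambda>x. A (odd_part x) + even_part x)"
  define B1 where "B1 = (\<lambda>x. even_part (B (even_part x)) + odd_part x)"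
  define B2 where "B2 = (\<lambda>x. odd_part (B (odd_part x)) + even_part x)"
  have oe: "odd_part x + even_part x = x" for x :: "'n fock" using parts_sum[of x] by (simp add: add.commute)
  note c1 = corner_parametrix[OF clinear_parts(1) parts_idem(1) clinear_parts(2) parts_idem(2,3,4) parts_sum Ae B(2,3,4), folded T1_def B1_def]
  note c2 = corner_parametrix[OF clinear_parts(2) parts_idem(2) clinear_parts(1) parts_idem(1,4,3) oe Ao B(2,3,4), folded T2_def B2_def]
  have "fock_ts.trace (\<lambda>x. x - B (A x)) = fock_ts.trace (\<lambda>x. even_part x - B (A (even_part x))) + fock_ts.trace (\<lambda>x. odd_part x - B (A (odd_part x)))"
    and "fock_ts.trace (\<lambda>x. x - A (B x)) = fock_ts.trace (\<lambda>x. even_part x - A (B (even_part x))) + fock_ts.trace (\<lambda>x. odd_part x - A (B (odd_part x)))"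
  proof -
    have s: "fock_ts.trace F = fock_ts.trace (\<lambda>x. F (even_part x)) + fock_ts.trace (\<lambda>x. F (odd_part x))"
      if F: "fock_ts.finite_rank F" for F :: "'n fock \<Rightarrow> 'n fock"
    proof -
      have "F = (\<lambda>x. F (even_part x) + F (odd_part x))"
        using F by (auto simp: fock_ts.finite_rank_def parts_sum simp flip: clinearD(1))
      then have "fock_ts.trace F = fock_ts.trace (\<lambda>x. F (even_part x) + F (odd_part x))" by (rule arg_cong)
      also have "\<dots> = fock_ts.trace (\<lambda>x. F (even_part x)) + fock_ts.trace (\<lambda>x. F (odd_part x))"
        by (intro fock_ts.trace_add fock_ts.finite_rank_comp_right[OF F] clinear_parts)
      finally show ?thesis .
    qed
    show "fock_ts.trace (\<lambda>x. x - B (A x)) = fock_ts.trace (\<lambda>x. even_part x - B (A (even_part x))) + fock_ts.trace (\<lambda>x. odd_part x - B (A (odd_part x)))"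
      by (rule s[OF fr(1)])
    show "fock_ts.trace (\<lambda>x. x - A (B x)) = fock_ts.trace (\<lambda>x. even_part x - A (B (even_part x))) + fock_ts.trace (\<lambda>x. odd_part x - A (B (odd_part x)))"
      by (rule s[OF fr(2)])
  qed
  then have sum: "fock_ts.pindex A B = fock_ts.pindex T1 B1 + fock_ts.pindex T2 B2"
    unfolding c1(3) c2(3) by (simp add: fock_ts.pindex_def)
  have B1b: "bounded_linear B1"
  proof -
    have p: "bounded_linear (even_part :: 'n fock \<Rightarrow> 'n fock)" "bounded_linear (odd_part :: 'n fock \<Rightarrow> 'n fock)"
      using norm_parts by (auto intro!: bounded_linear_intro[of _ 1] simp: clinearD[OF clinear_parts(1)] clinearD[OF clinear_parts(2)])
    show ?thesis unfolding B1_def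
      by (intro bounded_linear_add bounded_linear_compose[OF p(1) bounded_linear_compose[OF B(1) p(1)]] p(2))
  qed
  then obtain b where b: "b > 0" "\<And>x. norm (B1 x) \<le> norm x * b"
    using bounded_linear.pos_bounded by blast
  \<comment> \<open>\<open>amp B1\<close> has norm at most b and W at most 2, so the error E below
    has norm at most 2 b e = 1/2.\<close>
  define e where "e = 1 / (4 * b)"
  have e: "e > 0" using b by (simp add: e_def)
  obtain V W :: "'n famp \<Rightarrow> 'n famp" where V: "bounded_linear V" "bounded_linear W" "\<And>x. norm (W x) \<le> 2 * norm x"
    "\<And>x. V (amp parity x) = - amp parity (V x)" "K.parametrix V W"
    "\<And>x. norm (V (amp A x) - amp A (V x)) \<le> e * norm x"
    using odd_operator_commutator_small[OF assms(1) e] by blast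
  interpret V: bounded_linear V by (rule V(1))
  have VK: "Klinear V" "Klinear W" using V(5) by (simp_all add: K.parametrix_def)
  let ?N = "of_nat (CARD('n set)) :: complex"
  let ?X = "\<lambda>x. V (amp T1 x)" and ?BX = "\<lambda>x. amp B1 (W x)"
  let ?Y = "\<lambda>x. amp T2 (V x)" and ?BY = "\<lambda>x. W (amp B2 x)"
  have X: "K.parametrix ?X ?BX" "K.pindex ?X ?BX = K.pindex V W + ?N * fock_ts.pindex T1 B1"
    using K.parametrix_comp[OF V(5) parametrix_amp[OF c1(1)]] K.pindex_comp[OF V(5) parametrix_amp[OF c1(1)]]
    by (simp_all only: pindex_amp[OF c1(1)])
  have Y: "K.parametrix ?Y ?BY" "K.pindex ?Y ?BY = ?N * fock_ts.pindex T2 B2 + K.pindex V W"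
    using K.parametrix_comp[OF parametrix_amp[OF c2(1)] V(5)] K.pindex_comp[OF parametrix_amp[OF c2(1)] V(5)]
    by (simp_all only: pindex_amp[OF c2(1)])
  have half: "amp even_part x = (1/2) *\<^sub>R (x + amp parity x)" "amp odd_part x = (1/2) *\<^sub>R (x - amp parity x)" for x :: "'n famp"
    by (simp_all add: amp_def even_part_def odd_part_def vec_eq_iff)
  \<comment> \<open>Being odd, V exchanges the two projections. In V T1 - T2 V the identity parts
    therefore cancel, and only a commutator with A remains.\<close>
  have swap: "V (amp even_part x) = amp odd_part (V x)" "V (amp odd_part x) = amp even_part (V x)" for x
    by (simp_all add: half V.scaleR V.add V.diff V(4))
  have ampT: "amp T1 x = amp A (amp even_part x) + amp odd_part x" "amp T2 x = amp A (amp odd_part x) + amp even_part x" for x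
    by (simp_all add: amp_def T1_def T2_def vec_eq_iff)
  have diff: "?X x - ?Y x = V (amp A (amp even_part x)) - amp A (V (amp even_part x))" for x
    by (simp add: ampT V.add swap)
  define E where "E = (\<lambda>x. ?BX (?X x - ?Y x))"
  have linBX: "Klinear ?BX" and linX: "Klinear ?X" and linY: "Klinear ?Y"
    using X(1) Y(1) by (simp_all add: K.parametrix_def)
  have EK: "Klinear E"
    unfolding E_def by (rule Klinear_comp[OF linBX K_linear_diff[OF linX linY]])
  have nE: "norm (E x) \<le> 1/2 * norm x" for x
  proof -
    have "norm (E x) \<le> b * norm (W (?X x - ?Y x))"
      unfolding E_def using b by (intro norm_amp_le) (auto simp: mult.commute)
    also have "\<dots> \<le> b * (2 * norm (?X x - ?Y x))" using b V(3) by (intro mult_left_mono) auto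
    also have "\<dots> \<le> b * (2 * (e * norm (amp even_part x)))"
      unfolding diff using b V(6) by (intro mult_left_mono) auto
    also have "\<dots> \<le> b * (2 * (e * (1 * norm x)))"
      using b e norm_parts by (intro mult_left_mono norm_amp_le) auto
    also have "\<dots> = 1/2 * norm x" using b by (simp add: e_def)
    finally show ?thesis .
  qed
  \<comment> \<open>Applied to Y, the parametrix of X gives (1 - E) minus the finite-rank defect of
    X, with 1 - E bijective because E has norm at most 1/2.\<close>
  have "K.pindex ?X ?BX = K.pindex ?Y ?BY"
  proof (rule K.pindex_perturbation[OF X(1) Y(1)])
    show "Klinear (\<lambda>x. x - E x)" by (rule K_linear_diff[OF _ EK]) (simp add: Klinear_iff)
    show "bij (\<lambda>x. x - E x)" by (rule bij_diff_small[OF Klinear_real[OF EK] nE]) simp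
    show "K.finite_rank (\<lambda>x. x - ?BX (?X x))" using X(1) by (simp add: K.parametrix_def)
    show "?BX (?Y x) = (x - E x) - (x - ?BX (?X x))" for x
    proof -
      interpret BX: Vector_Spaces.linear scaleK scaleK ?BX by (rule linBX)
      show ?thesis unfolding E_def BX.diff by simp
    qed
  qed
  then have "?N * fock_ts.pindex T1 B1 = ?N * fock_ts.pindex T2 B2"
    using X(2) Y(2) by (simp only:) (simp add: add.commute)
  moreover have "?N \<noteq> 0" by (simp add: card_eq_0_iff)
  ultimately have eq: "fock_ts.pindex T1 B1 = fock_ts.pindex T2 B2" by (simp only: mult_cancel_left) blast
  \<comment> \<open>The equality alone makes the index twice a complex number; integrality of the
    corner index turns this into evenness.\<close>
  obtain k where k: "fock_ts.pindex T1 B1 = of_int k" using c1(2) by (auto elim: Ints_cases)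
  have "complex_of_int (fredholm_index A) = of_int (2 * k)"
    using sum B(5) eq k by simp
  then have "fredholm_index A = 2 * k" by (simp only: of_int_eq_iff)
  then show ?thesis by simp
qed

end
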